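(* Let $\alpha,\alpha'$ be ribbons with $\alpha\sim\alpha'$. Let $D$ be a connected skew diagram and $\omega$ a ribbon protruding from the top and from the bottom of $D$, such that (i) $D\cdot_\omega D$ is defined, and (ii) the two copies of $\omega$ protruding from the top and bottom of $D$ are separated by at least one diagonal, i.e. there is a nonempty diagonal of $D$ intersecting neither copy of $\omega$. Then $$\alpha'\circ_\omega D\ \sim\ \alpha\circ_\omega D\ \sim\ \alpha\circ_{\omega^{*}}D^{*}.$$
   Context: Partitions are identified with Ferrers diagrams in English notation (row 1 on top); a skew diagram $D=\lambda/\mu$ is the set of cells of $\lambda$ not in $\mu\subseteq\lambda$. Skew diagrams are identified if they differ by translation or by insertion/removal of empty rows or columns. $s_D=\sum_Tx^T$ over column-strict fillings of $D$ by positive integers (rows weakly increasing left to right, columns strictly increasing downward) is the skew Schur function, and $D_1\sim D_2$ means $s_{D_1}=s_{D_2}$. $D^{*}$ is $D$ rotated by 180 degrees. The disjoint union $D_1\oplus D_2$ places $D_2$ north and east of $D_1$ with no shared row or column; $D$ is connected if it is not $D_1\oplus D_2$ for proper subdiagrams. A ribbon is a connected (nonempty) skew diagram with no $2\times 2$ block of cells; a composition $\alpha=(\alpha_1,\dots,\alpha_\ell)$ is identified with the ribbon having $\alpha_i$ cells in the $i$-th row from the bottom. The diagonal (content) of cell $(i,j)$ is $j-i$; $|\omega|$ is the number of cells of $\omega$. Protrusion: a nonempty ribbon $\omega$ protrudes from the top (resp. bottom) of $D$ if the restriction of $D$ to its $|\omega|$ northeasternmost (resp. southwesternmost) diagonals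 is the ribbon $\omega$ and the restriction of $D$ to its $|\omega|+1$ northeasternmost (resp. southwesternmost) diagonals is also a ribbon. Amalgamation: if $\omega$ protrudes from the top of $D_1$ and the bottom of $D_2$, then $D_1\amalg_\omega D_2$ is the skew diagram obtained from $D_1\oplus D_2$ by (after translation) identifying the copy of $\omega$ in the northeast of $D_1$ with the copy of $\omega$ in the southwest of $D_2$. Projection: in the same situation, the outer (resp. inner) projection of $D_1$ onto $D_2$ with respect to $\omega$ is the diagram in the plane (not necessarily skew) obtained from $D_1\oplus D_2$ by translating $D_1$ and $D_2$ until the two copies of $\omega$ are adjacent and occupy the same set of diagonals, with the copy of $\omega$ in $D_1$ immediately northwest (resp. southeast) of the copy in $D_2$. At most one of these is a skew diagram; when one of them is, it is denoted $D_1\cdot_\omega D_2$ and one says $D_1\cdot_\omega D_2$ is defined. Amalgamated composition: if $\omega$ protrudes from both the top and bottom of $D$, set $D^{\amalg_\omega n}=((D\amalg_\omega D)\amalg_\omega\cdots)\amalg_\omega D$ ($n$ factors). If moreover $D\cdot_\omega D$ is defined, then $D^{\amalg_\omega m}\cdot_\omega D^{\amalg_\omega n}$ is defined for all positive integers $m,n$, and for a ribbon $\alpha=(\alpha_1,\dots,\alpha_\ell)$ one sets $\alpha\circ_\omega D:=(D^{\amalg_\omega\alpha_1})\cdot_\omega\cdots\cdot_\omega(D^{\amalg_\omega\alpha_\ell})$ (consecutive blocks joined by $\cdot_\omega$, using the top copy of $\omega$ in a block and the bottom copy of $\omega$ in the next block). *)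

theory Defs
  imports Main
begin

text \<open>
  Cells are pairs (row, column) in matrix coordinates: rows grow downward and columns grow to
  the right. Integer coordinates are used so that diagrams can be translated freely.
\<close>

type_synonym cell = "int \<times> int"
type_synonym diagram = "cell set"

definition translate :: "int \<times> int \<Rightarrow> diagram \<Rightarrow> diagram" where
  "translate v D = (\<lambda>(i, j). (i + fst v, j + snd v)) ` D"

definition rotate180 :: "diagram \<Rightarrow> diagram" where
  "rotate180 D = (\<lambda>(i, j). (- i, - j)) ` D"

definition content :: "cell \<Rightarrow> int" where
  "content c = snd c - fst c"


subsection \<open>Skew diagrams\<close>

definition partition :: "(nat \<Rightarrow> nat) \<Rightarrow> bool" where
  "partition lam \<longleftrightarrow> antimono lam \<and> finite {i. lam i \<noteq> 0}"

definition ferrers :: "(nat \<Rightarrow> nat) \<Rightarrow> diagram" where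
  "ferrers lam = {(int i, int j) | i j. j < lam i}"

text \<open>
  All translates of \<open>\<lambda>/\<mu>\<close> are admitted. Inserting or removing empty rows and columns of a
  diagram \<open>\<lambda>/\<mu>\<close> again gives a set of this form, so every representative of a skew diagram is covered.
\<close>

definition skew_diagram :: "diagram \<Rightarrow> bool" where
  "skew_diagram D \<longleftrightarrow> (\<exists>lam mu v. partition lam \<and> partition mu \<and> ferrers mu \<subseteq> ferrers lam \<and>
     D = translate v (ferrers lam - ferrers mu))"

text \<open>
  \<open>D = D\<^sub>1 \<oplus> D\<^sub>2\<close>, read up to empty rows and columns: all of \<open>D\<^sub>2\<close> lies
  strictly north and strictly east of all of \<open>D\<^sub>1\<close>.
\<close>

definition is_disjoint_union :: "diagram \<Rightarrow> diagram \<Rightarrow> diagram \<Rightarrow> bool" where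
  "is_disjoint_union D D1 D2 \<longleftrightarrow> D = D1 \<union> D2 \<and>
     (\<forall>(i, j) \<in> D1. \<forall>(i', j') \<in> D2. i' < i \<and> j < j')"

definition connected_diagram :: "diagram \<Rightarrow> bool" where
  "connected_diagram D \<longleftrightarrow> \<not> (\<exists>D1 D2. D1 \<noteq> {} \<and> D2 \<noteq> {} \<and> is_disjoint_union D D1 D2)"

definition ribbon :: "diagram \<Rightarrow> bool" where
  "ribbon D \<longleftrightarrow> skew_diagram D \<and> D \<noteq> {} \<and> connected_diagram D \<and>
     \<not> (\<exists>i j. {(i, j), (i, j + 1), (i + 1, j), (i + 1, j + 1)} \<subseteq> D)"

definition composition :: "nat list \<Rightarrow> bool" where
  "composition \<alpha> \<longleftrightarrow> \<alpha> \<noteq> [] \<and> (\<forall>a \<in> set \<alpha>. 0 < a)"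

text \<open>
  Row \<open>r\<close> from the bottom has \<open>\<alpha> ! r\<close> cells, and its first cell lies directly above the last
  cell of the row below it.
\<close>

definition ribbon_of :: "nat list \<Rightarrow> diagram" where
  "ribbon_of \<alpha> =
     {(- int r, (\<Sum>k<r. (int (\<alpha> ! k) - 1)) + int j) | r j. r < length \<alpha> \<and> j < \<alpha> ! r}"


subsection \<open>Skew Schur functions\<close>

text \<open>Entries outside \<open>D\<close> are set to \<open>0\<close>, so that a filling of \<open>D\<close> is a unique function.\<close>

definition column_strict_filling :: "diagram \<Rightarrow> (cell \<Rightarrow> nat) \<Rightarrow> bool" where
  "column_strict_filling D T \<longleftrightarrow>
     (\<forall>c. c \<in> D \<longrightarrow> 0 < T c) \<and> (\<forall>c. c \<notin> D \<longrightarrow> T c = 0) \<and>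
     (\<forall>i j j'. (i, j) \<in> D \<and> (i, j') \<in> D \<and> j < j' \<longrightarrow> T (i, j) \<le> T (i, j')) \<and>
     (\<forall>i i' j. (i, j) \<in> D \<and> (i', j) \<in> D \<and> i < i' \<longrightarrow> T (i, j) < T (i', j))"

text \<open>The exponent vector of the monomial \<open>x\<^sup>T\<close>.\<close>

definition weight :: "diagram \<Rightarrow> (cell \<Rightarrow> nat) \<Rightarrow> nat \<Rightarrow> nat" where
  "weight D T = (\<lambda>k. card {c \<in> D. T c = k})"

text \<open>
  The formal power series \<open>s\<^sub>D\<close> in infinitely many variables, given by its coefficients: it maps
  an exponent vector \<open>m\<close> to the coefficient of \<open>x\<^sup>m\<close>. The set counted is finite for finite \<open>D\<close>
  (see \<open>finite_fillings_of_weight\<close> below).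
\<close>

definition skew_schur :: "diagram \<Rightarrow> (nat \<Rightarrow> nat) \<Rightarrow> nat" where
  "skew_schur D = (\<lambda>m. card {T. column_strict_filling D T \<and> weight D T = m})"

definition skew_equiv :: "diagram \<Rightarrow> diagram \<Rightarrow> bool" (infix "\<sim>\<^sub>s" 50) where
  "D1 \<sim>\<^sub>s D2 \<longleftrightarrow> skew_schur D1 = skew_schur D2"

lemma finite_fillings_of_weight:
  assumes "finite D"
  shows "finite {T. column_strict_filling D T \<and> weight D T = m}"
proof (cases "\<exists>T0. weight D T0 = m")
  case False
  then show ?thesis by auto
next
  case True
  then obtain T0 where T0: "weight D T0 = m" by blast
  have "T c \<in> T0 ` D" if "weight D T = m" "c \<in> D" for T c
  proof -
    have "finite {c' \<in> D. T c' = T c}" using assms by simp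
    moreover have "c \<in> {c' \<in> D. T c' = T c}" using that by simp
    ultimately have "card {c' \<in> D. T c' = T c} \<noteq> 0" by (metis card_0_eq empty_iff)
    then have "card {c' \<in> D. T0 c' = T c} \<noteq> 0"
      using that(1) T0 unfolding weight_def by metis
    then have "{c' \<in> D. T0 c' = T c} \<noteq> {}" by (metis card.empty)
    then obtain c' where "c' \<in> D" "T0 c' = T c" by blast
    then show ?thesis by (metis imageI)
  qed
  then have "{T. column_strict_filling D T \<and> weight D T = m} \<subseteq>
      {T. \<forall>c. (c \<in> D \<longrightarrow> T c \<in> T0 ` D) \<and> (c \<notin> D \<longrightarrow> T c = 0)}"
    unfolding column_strict_filling_def by blast
  moreover have "finite \<dots>"
    using assms by (intro finite_set_of_finite_funs) auto
  ultimately show ?thesis by (rule finite_subset)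
qed


subsection \<open>Protrusion\<close>

text \<open>
  Restriction of \<open>D\<close> to its \<open>k\<close> northeasternmost (southwesternmost) nonempty diagonals: a cell is
  kept if fewer than \<open>k\<close> diagonals of \<open>D\<close> lie strictly further northeast (southwest).
\<close>

definition ne_part :: "nat \<Rightarrow> diagram \<Rightarrow> diagram" where
  "ne_part k D = {c \<in> D. card {d \<in> content ` D. content c < d} < k}"

definition sw_part :: "nat \<Rightarrow> diagram \<Rightarrow> diagram" where
  "sw_part k D = {c \<in> D. card {d \<in> content ` D. d < content c} < k}"

definition protrudes_top :: "diagram \<Rightarrow> diagram \<Rightarrow> bool" where
  "protrudes_top \<omega> D \<longleftrightarrow> ribbon \<omega> \<and>
     (\<exists>v. ne_part (card \<omega>) D = translate v \<omega>) \<and> ribbon (ne_part (card \<omega> + 1) D)"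

definition protrudes_bottom :: "diagram \<Rightarrow> diagram \<Rightarrow> bool" where
  "protrudes_bottom \<omega> D \<longleftrightarrow> ribbon \<omega> \<and>
     (\<exists>v. sw_part (card \<omega>) D = translate v \<omega>) \<and> ribbon (sw_part (card \<omega> + 1) D)"

definition copies_separated :: "diagram \<Rightarrow> diagram \<Rightarrow> bool" where
  "copies_separated \<omega> D \<longleftrightarrow> (\<exists>d \<in> content ` D.
     {c \<in> D. content c = d} \<inter> ne_part (card \<omega>) D = {} \<and>
     {c \<in> D. content c = d} \<inter> sw_part (card \<omega>) D = {})"


subsection \<open>Amalgamation and projection\<close>

text \<open>
  Throughout this section \<open>\<omega>\<close> is supposed to protrude from the top of \<open>D1\<close> and from the bottom of
  \<open>D2\<close>; the copies of \<open>\<omega>\<close> involved are \<open>ne_part (card \<omega>) D1\<close> and \<open>sw_part (card \<omega>) D2\<close>.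
  \<open>attach \<omega> u D1 D2\<close> keeps \<open>D1\<close> in place and translates \<open>D2\<close> so that its copy of \<open>\<omega>\<close> becomes
  the copy in \<open>D1\<close> displaced by \<open>u\<close>. The two copies are nonempty finite translates of each
  other, so the translation vector exists and is unique.
\<close>

definition attach :: "diagram \<Rightarrow> int \<times> int \<Rightarrow> diagram \<Rightarrow> diagram \<Rightarrow> diagram" where
  "attach \<omega> u D1 D2 = D1 \<union> translate
     (THE v. translate v (sw_part (card \<omega>) D2) = translate u (ne_part (card \<omega>) D1)) D2"

definition amalg :: "diagram \<Rightarrow> diagram \<Rightarrow> diagram \<Rightarrow> diagram" where
  "amalg \<omega> D1 D2 = attach \<omega> (0, 0) D1 D2"

text \<open>
  In the outer projection the copy in \<open>D1\<close> is immediately northwest of the copy in \<open>D2\<close>, i.e.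
  the copy in \<open>D2\<close> is displaced by one row down and one column right.
\<close>

definition outer_proj :: "diagram \<Rightarrow> diagram \<Rightarrow> diagram \<Rightarrow> diagram" where
  "outer_proj \<omega> D1 D2 = attach \<omega> (1, 1) D1 D2"

definition inner_proj :: "diagram \<Rightarrow> diagram \<Rightarrow> diagram \<Rightarrow> diagram" where
  "inner_proj \<omega> D1 D2 = attach \<omega> (- 1, - 1) D1 D2"

definition proj_defined :: "diagram \<Rightarrow> diagram \<Rightarrow> diagram \<Rightarrow> bool" where
  "proj_defined \<omega> D1 D2 \<longleftrightarrow> protrudes_top \<omega> D1 \<and> protrudes_bottom \<omega> D2 \<and>
     (skew_diagram (outer_proj \<omega> D1 D2) \<or> skew_diagram (inner_proj \<omega> D1 D2))"

text \<open>\<open>D1 \<cdot>\<^sub>\<omega> D2\<close>; meaningful only under \<open>proj_defined\<close>.\<close>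

definition proj :: "diagram \<Rightarrow> diagram \<Rightarrow> diagram \<Rightarrow> diagram" where
  "proj \<omega> D1 D2 =
     (if skew_diagram (outer_proj \<omega> D1 D2) then outer_proj \<omega> D1 D2 else inner_proj \<omega> D1 D2)"


subsection \<open>Amalgamated composition\<close>

text \<open>The \<open>n\<close>-fold amalgamation of \<open>D\<close> with itself, for \<open>n \<ge> 1\<close>.\<close>

definition amalg_power :: "diagram \<Rightarrow> diagram \<Rightarrow> nat \<Rightarrow> diagram" where
  "amalg_power \<omega> D n = ((\<lambda>E. amalg \<omega> E D) ^^ (n - 1)) D"

text \<open>
  The blocks are joined from left to right. When the two copies of \<open>\<omega>\<close> in \<open>D\<close> are separated,
  the top copy of \<open>\<omega>\<close> in the part already built is the top copy in its last block.
\<close>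

definition amalg_comp :: "nat list \<Rightarrow> diagram \<Rightarrow> diagram \<Rightarrow> diagram" where
  "amalg_comp \<alpha> \<omega> D =
     foldl (proj \<omega>) (amalg_power \<omega> D (hd \<alpha>)) (map (amalg_power \<omega> D) (tl \<alpha>))"

end

theory Submission
  imports "HOL-Computational_Algebra.Polynomial_FPS" "HOL-Computational_Algebra.Fundamental_Theorem_Algebra"
    "HOL-Combinatorics.Permutations" Defs
begin

text \<open>
  Write \<open>s(E)\<close> for the value of a skew Schur function at a fixed point \<open>x\<close>. The key identity is
  \<open>s(E\<^sub>1) s(E\<^sub>2) = s(E\<^sub>1 \<amalg>\<^sub>\<omega> E\<^sub>2) s(\<omega>) + s(E\<^sub>1 \<cdot>\<^sub>\<omega> E\<^sub>2)\<close>: with the fillings of both diagrams fixed outside the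
  copies of \<open>\<omega>\<close>, it says that a two-by-two Lindstroem-Gessel-Viennot determinant of path sums counts
  the pairs of fillings of the two copies that are compatible when one is pushed diagonally onto the
  other. It gives the numbers \<open>s(\<alpha> \<circ>\<^sub>\<omega> D) / s(\<omega>)\<^bsup>l(\<alpha>)\<^esup>\<close> the same recursion that ribbon Schur functions
  satisfy (the case of a single cell \<open>D\<close> and an empty \<open>\<omega>\<close>), with \<open>h\<^sub>n\<close> replaced by \<open>s(D\<^bsup>\<amalg>n\<^esup>) / s(\<omega>)\<close>.
  Over the complex numbers there is a point \<open>y\<close> at which \<open>h\<^sub>1, h\<^sub>2, \<dots>\<close> take these values up to any given
  degree, so the quotient is the ribbon Schur function of \<open>\<alpha>\<close> at \<open>y\<close>. This settles the first
  equivalence. The second one follows because \<open>D\<^bsup>\<amalg>n\<^esup>\<close> and \<open>\<omega>\<close> have the same Schur functions as their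
  rotations, by the symmetry of skew Schur functions.
\<close>

subsection \<open>Sums over fillings\<close>

text \<open>Everything is done with values in finitely many variables, because the argument divides
  by the Schur function of \<omega> and has to solve polynomial equations for \<open>y\<close>.
  Positive integer points are the right ones: there the Schur function of \<omega> is nonzero once
  \<open>N\<close> is large, and such points still determine every coefficient. Since the quotients
  carry a power indexed by the number of rows, the first equivalence also requires that \<alpha> and
  \<alpha>' have equally many rows; this is read off from the same recursion. Geometrically, content
  plays the part of time. Near a copy of \<omega> every diagonal carries one cell, so the rest of a
  diagram sees the copy only through one value before or after it, and the key identity becomes one
  between functions of two values. It holds when the steps into and out of \<omega> go in the same
  direction. Skewness of the projection of \<open>D\<close> onto itself enforces exactly this, and
  the common direction decides between outer and inner. Separation of the two copies keeps the
  neighbourhood of one copy intact while something is glued to the other.\<close>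

definition maps :: "nat \<Rightarrow> 'a set \<Rightarrow> ('a \<Rightarrow> nat) set" where
  "maps N V = {T. \<forall>c. if c \<in> V then T c \<in> {1..N} else T c = 0}"

text \<open>The integrand is arbitrary so that cells can be summed out one at a time, the partial
  sum becoming the new integrand.\<close>

definition weighted_sum ::
  "nat \<Rightarrow> (nat \<Rightarrow> 'b::comm_ring_1) \<Rightarrow> 'a set \<Rightarrow> (('a \<Rightarrow> nat) \<Rightarrow> 'b) \<Rightarrow> 'b" where
  "weighted_sum N x V \<phi> = (\<Sum>T\<in>maps N V. (\<Prod>c\<in>V. x (T c)) * \<phi> T)"

lemma maps_outside: "T \<in> maps N V \<Longrightarrow> c \<notin> V \<Longrightarrow> T c = 0"
  by (auto simp: maps_def)

lemma maps_inside: "T \<in> maps N V \<Longrightarrow> c \<in> V \<Longrightarrow> 1 \<le> T c \<and> T c \<le> N"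
  unfolding maps_def by (smt (verit, best) atLeastAtMost_iff mem_Collect_eq)

lemma mapsI: "(\<And>c. c \<in> V \<Longrightarrow> 1 \<le> T c \<and> T c \<le> N) \<Longrightarrow> (\<And>c. c \<notin> V \<Longrightarrow> T c = 0) \<Longrightarrow> T \<in> maps N V"
  by (auto simp: maps_def)

lemma finite_maps: "finite V \<Longrightarrow> finite (maps N V)"
proof -
  assume "finite V"
  then have "finite {T. \<forall>c. (c \<in> V \<longrightarrow> T c \<in> {1..N}) \<and> (c \<notin> V \<longrightarrow> T c = 0)}"
    by (intro finite_set_of_finite_funs) auto
  then show ?thesis by (rule finite_subset[rotated]) (auto simp: maps_def)
qed

lemma weighted_sum_cong:
  assumes "\<And>T. T \<in> maps N V \<Longrightarrow> \<phi> T = \<psi> T"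
  shows "weighted_sum N x V \<phi> = weighted_sum N x V \<psi>"
  unfolding weighted_sum_def by (rule sum.cong) (use assms in auto)

lemma weighted_sum_empty:
  fixes \<phi> :: "('a \<Rightarrow> nat) \<Rightarrow> 'b::comm_ring_1"
  shows "weighted_sum N x {} \<phi> = \<phi> (\<lambda>_. 0)"
proof -
  have "maps N ({} :: 'a set) = {\<lambda>_. 0}" by (auto simp: maps_def)
  then show ?thesis by (simp add: weighted_sum_def)
qed

lemma weighted_sum_insert:
  assumes "finite V" "c \<notin> V"
  shows "weighted_sum N x (insert c V) \<phi> =
    weighted_sum N x V (\<lambda>T. \<Sum>v=1..N. x v * \<phi> (T(c := v)))"
proof -
  have "weighted_sum N x (insert c V) \<phi> =
      (\<Sum>(T, v)\<in>maps N V \<times> {1..N}. (\<Prod>d\<in>V. x (T d)) * (x v * \<phi> (T(c := v))))"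
    unfolding weighted_sum_def
  proof (rule sum.reindex_bij_witness[where j="\<lambda>T. (T(c := 0), T c)" and i="\<lambda>(T, v). T(c := v)"], goal_cases)
    case (1 T) then show ?case by auto
  next
    case (2 T)
    then show ?case using assms
      by (auto intro!: mapsI dest: maps_outside maps_inside)
  next
    case (3 b) then show ?case using assms by (auto simp: fun_eq_iff dest: maps_outside)
  next
    case (4 b) then show ?case using assms
      by (auto intro!: mapsI simp: maps_outside dest: maps_inside split: if_splits)
  next
    case (5 T)
    have "(\<Prod>d\<in>V. x (if d = c then 0 else T d)) = (\<Prod>d\<in>V. x (T d))"
      using assms by (intro prod.cong) auto
    moreover have "T(c := 0, c := T c) = T" by simp
    ultimately show ?case using assms by (simp add: algebra_simps)
  qed
  also have "\<dots> = weighted_sum N x V (\<lambda>T. \<Sum>v=1..N. x v * \<phi> (T(c := v)))"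
    unfolding weighted_sum_def sum_distrib_left by (rule sum.cartesian_product[symmetric])
  finally show ?thesis .
qed

text \<open>Fillings are 0 outside their own set, so pointwise addition glues fillings of disjoint
  sets.\<close>

lemma weighted_sum_union:
  assumes "finite A" "finite B" "A \<inter> B = {}"
  shows "weighted_sum N x (A \<union> B) \<phi> =
    weighted_sum N x A (\<lambda>T. weighted_sum N x B (\<lambda>T'. \<phi> (\<lambda>c. T c + T' c)))"
proof -
  let ?r = "\<lambda>A T c. if c \<in> A then T c else (0::nat)"
  have "weighted_sum N x (A \<union> B) \<phi> = (\<Sum>(T, T')\<in>maps N A \<times> maps N B.
      (\<Prod>c\<in>A. x (T c)) * ((\<Prod>c\<in>B. x (T' c)) * \<phi> (\<lambda>c. T c + T' c)))"
    unfolding weighted_sum_def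
  proof (rule sum.reindex_bij_witness[where j="\<lambda>T. (?r A T, ?r B T)" and i="\<lambda>(T, T') c. T c + T' c"], goal_cases)
    case (1 T) then show ?case using assms by (auto simp: fun_eq_iff dest: maps_outside)
  next
    case (2 T) then show ?case by (auto intro!: mapsI dest: maps_inside)
  next
    case (3 b)
    then have "\<And>c. c \<in> A \<Longrightarrow> snd b c = 0" "\<And>c. c \<in> B \<Longrightarrow> fst b c = 0"
      "\<And>c. c \<notin> A \<Longrightarrow> fst b c = 0" "\<And>c. c \<notin> B \<Longrightarrow> snd b c = 0"
      using assms by (auto dest: maps_outside)
    then show ?case by (auto simp: fun_eq_iff split_beta prod_eq_iff)
  next
    case (4 b)
    show ?case
    proof (rule mapsI, goal_cases)
      case (1 c)
      obtain T T' where b: "b = (T, T')" "T \<in> maps N A" "T' \<in> maps N B" using 4 by auto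
      from 1 assms(3) consider "c \<in> A" "c \<notin> B" | "c \<in> B" "c \<notin> A" by auto
      then show ?case
        by cases (use b maps_inside[of T N A c] maps_inside[of T' N B c] in \<open>auto simp: maps_outside\<close>)
    next
      case (2 c)
      with 4 assms show ?case by (auto dest: maps_outside)
    qed
  next
    case (5 T)
    have "(\<lambda>c. ?r A T c + ?r B T c) = T"
      using 5 assms by (auto simp: fun_eq_iff dest: maps_outside)
    moreover have "(\<Prod>c\<in>A \<union> B. x (T c)) = (\<Prod>c\<in>A. x (?r A T c)) * (\<Prod>c\<in>B. x (?r B T c))"
      using assms by (simp add: prod.union_disjoint)
    ultimately show ?case by (simp add: mult.assoc)
  qed
  also have "\<dots> = weighted_sum N x A (\<lambda>T. weighted_sum N x B (\<lambda>T'. \<phi> (\<lambda>c. T c + T' c)))"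
    unfolding weighted_sum_def sum_distrib_left by (rule sum.cartesian_product[symmetric])
  finally show ?thesis .
qed

lemma weighted_sum_image:
  assumes "bij h"
  shows "weighted_sum N x (h ` V) \<phi> = weighted_sum N x V (\<lambda>T. \<phi> (T \<circ> inv h))"
  unfolding weighted_sum_def
proof (rule sum.reindex_bij_witness[where j="\<lambda>T. T \<circ> h" and i="\<lambda>T. T \<circ> inv h"], goal_cases)
  have inj: "inj h" and surj: "surj h" using assms by (auto simp: bij_def)
  {
    case (1 T) then show ?case using surj by (auto simp: fun_eq_iff surj_f_inv_f)
  next
    case (2 T) then show ?case using inj
      by (auto intro!: mapsI simp: inj_image_mem_iff maps_outside dest: maps_inside)
  next
    case (3 T) then show ?case using inj by (auto simp: fun_eq_iff)
  next
    case (4 T)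
    have "c \<in> h ` V \<longleftrightarrow> inv h c \<in> V" for c
      using inj surj by (metis inj_image_mem_iff surj_f_inv_f)
    with 4 show ?case by (auto intro!: mapsI simp: maps_outside inj inv_f_f dest: maps_inside)
  next
    case (5 T)
    have "T \<circ> h \<circ> inv h = T" using surj by (auto simp: fun_eq_iff surj_f_inv_f)
    moreover have "(\<Prod>c\<in>h ` V. x (T c)) = (\<Prod>c\<in>V. x (T (h c)))"
      using inj by (subst prod.reindex) (auto simp: inj_on_def)
    ultimately show ?case by simp
  }
qed

lemma weighted_sum_scale: "weighted_sum N x V (\<lambda>T. a * \<phi> T) = a * weighted_sum N x V \<phi>"
  unfolding weighted_sum_def sum_distrib_left by (rule sum.cong) (auto simp: algebra_simps)

lemma weighted_sum_add:
  "weighted_sum N x V (\<lambda>T. \<phi> T + \<psi> T) = weighted_sum N x V \<phi> + weighted_sum N x V \<psi>"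
  unfolding weighted_sum_def by (simp add: algebra_simps sum.distrib)

section \<open>Column-strictness as a condition on neighbouring cells\<close>

definition adjacent :: "cell \<Rightarrow> cell \<Rightarrow> bool" where
  "adjacent c c' \<longleftrightarrow> c' = (fst c, snd c + 1) \<or> c' = (fst c - 1, snd c)"

text \<open>\<open>adjacent\<close> is oriented towards larger content, to the right or upwards. The
  single equivalence then covers both rules: no strict descent along a row, a strict descent up a
  column.\<close>

definition locally_strict :: "diagram \<Rightarrow> (cell \<Rightarrow> nat) \<Rightarrow> bool" where
  "locally_strict D T \<longleftrightarrow> (\<forall>c\<in>D. \<forall>c'\<in>D. adjacent c c' \<longrightarrow> (T c' < T c \<longleftrightarrow> fst c' < fst c))"

definition schur :: "nat \<Rightarrow> (nat \<Rightarrow> 'b::comm_ring_1) \<Rightarrow> diagram \<Rightarrow> 'b" where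
  "schur N x D = weighted_sum N x D (\<lambda>T. of_bool (locally_strict D T))"

text \<open>Closure under intervals of the southeast order. By \<open>skew_diagram_iff\<close> the
  finite sets of this kind are exactly the skew diagrams.\<close>

definition order_convex :: "diagram \<Rightarrow> bool" where
  "order_convex D \<longleftrightarrow> (\<forall>i j i' j' k l. (i, j) \<in> D \<longrightarrow> (i', j') \<in> D \<longrightarrow>
     i \<le> k \<longrightarrow> k \<le> i' \<longrightarrow> j \<le> l \<longrightarrow> l \<le> j' \<longrightarrow> (k, l) \<in> D)"

lemma order_convexD:
  "order_convex D \<Longrightarrow> (i, j) \<in> D \<Longrightarrow> (i', j') \<in> D \<Longrightarrow> i \<le> k \<Longrightarrow> k \<le> i' \<Longrightarrow> j \<le> l \<Longrightarrow> l \<le> j' \<Longrightarrow> (k, l) \<in> D"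
  unfolding order_convex_def by blast

lemma locally_strict_rightD:
  "locally_strict D T \<Longrightarrow> (i, j) \<in> D \<Longrightarrow> (i, j + 1) \<in> D \<Longrightarrow> T (i, j) \<le> T (i, j + 1)"
  unfolding locally_strict_def adjacent_def by fastforce

lemma locally_strict_downD:
  "locally_strict D T \<Longrightarrow> (i, j) \<in> D \<Longrightarrow> (i + 1, j) \<in> D \<Longrightarrow> T (i, j) < T (i + 1, j)"
  unfolding locally_strict_def adjacent_def by force

lemma locally_strictI:
  assumes "\<And>i j. (i, j) \<in> D \<Longrightarrow> (i, j + 1) \<in> D \<Longrightarrow> T (i, j) \<le> T (i, j + 1)"
    and "\<And>i j. (i, j) \<in> D \<Longrightarrow> (i + 1, j) \<in> D \<Longrightarrow> T (i, j) < T (i + 1, j)"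
  shows "locally_strict D T"
  unfolding locally_strict_def
proof (intro ballI impI)
  fix c c' assume c: "c \<in> D" "c' \<in> D" "adjacent c c'"
  obtain i j where ij: "c = (i, j)" by force
  from c(3) consider "c' = (i, j + 1)" | "c' = (i - 1, j)" unfolding adjacent_def ij by auto
  then show "T c' < T c \<longleftrightarrow> fst c' < fst c"
  proof cases
    case 1 then show ?thesis using assms(1)[of i j] c ij by auto
  next
    case 2 then show ?thesis using assms(2)[of "i - 1" j] c ij by auto
  qed
qed

text \<open>Order convexity supplies all cells between two cells of a row or column, so the
  conditions on neighbours chain up.\<close>

lemma column_strict_filling_iff_locally_strict:
  assumes "order_convex D"
  shows "column_strict_filling D T \<longleftrightarrow>
    (\<forall>c. c \<in> D \<longrightarrow> 0 < T c) \<and> (\<forall>c. c \<notin> D \<longrightarrow> T c = 0) \<and> locally_strict D T"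
    (is "_ \<longleftrightarrow> ?pos \<and> ?zero \<and> _")
proof
  assume "column_strict_filling D T"
  then show "?pos \<and> ?zero \<and> locally_strict D T"
    unfolding column_strict_filling_def by (intro conjI locally_strictI) auto
next
  assume *: "?pos \<and> ?zero \<and> locally_strict D T"
  have row: "(i, j) \<in> D \<Longrightarrow> (i, j + int n) \<in> D \<Longrightarrow> T (i, j) \<le> T (i, j + int n)" for i j n
  proof (induction n)
    case (Suc n)
    have "(i, j + int n) \<in> D"
      by (rule order_convexD[OF assms Suc.prems]) auto
    with Suc.IH Suc.prems locally_strict_rightD[of D T i "j + int n"] * show ?case
      by (simp add: algebra_simps)
  qed simp
  have col: "(i, j) \<in> D \<Longrightarrow> (i + int n + 1, j) \<in> D \<Longrightarrow> T (i, j) < T (i + int n + 1, j)" for i j n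
  proof (induction n)
    case 0 then show ?case using locally_strict_downD * by auto
  next
    case (Suc n)
    have "(i + int n + 1, j) \<in> D"
      by (rule order_convexD[OF assms Suc.prems]) auto
    with Suc.IH Suc.prems locally_strict_downD[of D T "i + int n + 1" j] * show ?case
      by (simp add: algebra_simps)
  qed
  show "column_strict_filling D T"
    unfolding column_strict_filling_def
  proof (intro conjI allI impI, goal_cases)
    case (3 i j j')
    then show ?case using row[of i j "nat (j' - j)"] by simp
  next
    case (4 i i' j)
    then show ?case using col[of i j "nat (i' - i - 1)"] by simp
  qed (use * in auto)
qed

lemma translate_eq_image: "translate v D = (\<lambda>c. (fst c + fst v, snd c + snd v)) ` D"
  unfolding translate_def by (rule image_cong) auto

lemma mem_translate: "(i, j) \<in> translate v D \<longleftrightarrow> (i - fst v, j - snd v) \<in> D"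
proof
  assume "(i - fst v, j - snd v) \<in> D"
  then show "(i, j) \<in> translate v D" unfolding translate_def by (rule rev_image_eqI) simp
qed (auto simp: translate_def)

lemma translate_translate: "translate v (translate w D) = translate (fst v + fst w, snd v + snd w) D"
  by (auto simp: mem_translate algebra_simps)

lemma translate_0: "translate (0, 0) D = D" by (auto simp: mem_translate)

lemma translate_Un: "translate v (A \<union> B) = translate v A \<union> translate v B"
  by (auto simp: mem_translate)

lemma finite_translate: "finite D \<Longrightarrow> finite (translate v D)"
  by (simp add: translate_def)

lemma bij_translate_cell: "bij (\<lambda>c::cell. (fst c + a, snd c + b))"
  by (rule bij_betw_byWitness[where f'="\<lambda>c. (fst c - a, snd c - b)"]) auto

lemma schur_translate: "schur N x (translate v D) = schur N x D"
proof -
  let ?h = "\<lambda>c::cell. (fst c + fst v, snd c + snd v)"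
  have inv: "inv ?h (?h c) = c" for c by (rule inv_f_f[OF bij_is_inj[OF bij_translate_cell]])
  have "locally_strict (?h ` D) (T \<circ> inv ?h) \<longleftrightarrow> locally_strict D T" for T
  proof -
    have adj: "adjacent (?h c) (?h c') \<longleftrightarrow> adjacent c c'" for c c'
      by (auto simp: adjacent_def prod_eq_iff)
    show ?thesis unfolding locally_strict_def ball_simps comp_def inv adj by simp
  qed
  then show ?thesis
    unfolding schur_def translate_eq_image weighted_sum_image[OF bij_translate_cell] by simp
qed

subsection \<open>Symmetry of skew Schur functions\<close>

definition tableaux :: "nat \<Rightarrow> diagram \<Rightarrow> (cell \<Rightarrow> nat) set" where
  "tableaux N D = {T \<in> maps N D. locally_strict D T}"

lemma schur_eq_sum_tableaux:
  assumes "finite D"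
  shows "schur N x D = (\<Sum>T\<in>tableaux N D. \<Prod>c\<in>D. x (T c))"
proof -
  have "schur N x D = (\<Sum>T\<in>maps N D. if locally_strict D T then \<Prod>c\<in>D. x (T c) else 0)"
    unfolding schur_def weighted_sum_def by (rule sum.cong) auto
  also have "\<dots> = (\<Sum>T\<in>tableaux N D. \<Prod>c\<in>D. x (T c))"
    unfolding tableaux_def using finite_maps[OF assms] by (simp add: sum.inter_filter)
  finally show ?thesis .
qed

section \<open>The Bender-Knuth involution\<close>

definition bk_bound :: "(cell \<Rightarrow> nat) \<Rightarrow> nat \<Rightarrow> cell \<Rightarrow> bool" where
  "bk_bound T k c \<longleftrightarrow> T c = k \<and> T (fst c + 1, snd c) = Suc k \<or> T c = Suc k \<and> T (fst c - 1, snd c) = k"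

definition bk_free :: "(cell \<Rightarrow> nat) \<Rightarrow> nat \<Rightarrow> cell \<Rightarrow> bool" where
  "bk_free T k c \<longleftrightarrow> (T c = k \<or> T c = Suc k) \<and> \<not> bk_bound T k c"

text \<open>The free cells of a row form a contiguous segment (\<open>bk_cols_convex\<close>), so
  this reflection about its midpoint maps the segment onto itself.\<close>

definition bk_mirror :: "(cell \<Rightarrow> nat) \<Rightarrow> nat \<Rightarrow> cell \<Rightarrow> cell" where
  "bk_mirror T k c = (fst c, Min {j. bk_free T k (fst c, j)} + Max {j. bk_free T k (fst c, j)} - snd c)"

text \<open>
  The Bender-Knuth involution usually turns \<open>a\<close> free entries \<open>k\<close> and \<open>b\<close> free entries \<open>k + 1\<close> of a row
  into \<open>b\<close> and \<open>a\<close>; reversing the row segment and exchanging the two values does the same.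
\<close>

definition bk :: "nat \<Rightarrow> (cell \<Rightarrow> nat) \<Rightarrow> cell \<Rightarrow> nat" where
  "bk k T c = (if bk_free T k c then transpose k (Suc k) (T (bk_mirror T k c)) else T c)"

context
  fixes D :: diagram and N k :: nat and T :: "cell \<Rightarrow> nat"
  assumes fin: "finite D" and convex: "order_convex D"
    and k: "1 \<le> k" "Suc k \<le> N" and T: "T \<in> tableaux N D"
begin

lemma bk_pos: "c \<in> D \<longleftrightarrow> 0 < T c"
proof -
  have "T \<in> maps N D" using T by (simp add: tableaux_def)
  then show ?thesis using maps_inside[of T N D c] maps_outside[of T N D c] by (cases "c \<in> D") auto
qed

lemma bk_row: "(i, j) \<in> D \<Longrightarrow> (i, j') \<in> D \<Longrightarrow> j \<le> j' \<Longrightarrow> T (i, j) \<le> T (i, j')"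
  and bk_col: "(i, j) \<in> D \<Longrightarrow> (i', j) \<in> D \<Longrightarrow> i < i' \<Longrightarrow> T (i, j) < T (i', j)"
proof -
  have "column_strict_filling D T"
    unfolding column_strict_filling_iff_locally_strict[OF convex]
    using T bk_pos by (auto simp: tableaux_def)
  then have "\<forall>i j j'. (i, j) \<in> D \<and> (i, j') \<in> D \<and> j < j' \<longrightarrow> T (i, j) \<le> T (i, j')"
    and "\<forall>i i' j. (i, j) \<in> D \<and> (i', j) \<in> D \<and> i < i' \<longrightarrow> T (i, j) < T (i', j)"
    unfolding column_strict_filling_def by blast+
  then show "(i, j) \<in> D \<Longrightarrow> (i, j') \<in> D \<Longrightarrow> j \<le> j' \<Longrightarrow> T (i, j) \<le> T (i, j')"
    and "(i, j) \<in> D \<Longrightarrow> (i', j) \<in> D \<Longrightarrow> i < i' \<Longrightarrow> T (i, j) < T (i', j)"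
    by (cases "j = j'", simp, simp, simp)
qed

lemma bk_free_in: "bk_free T k c \<Longrightarrow> c \<in> D"
  unfolding bk_free_def bk_pos using k by linarith

lemma bk_cols_finite: "finite {j. bk_free T k (i, j)}"
proof -
  have "{j. bk_free T k (i, j)} \<subseteq> snd ` D" using bk_free_in by force
  then show ?thesis using fin by (meson finite_imageI finite_subset)
qed

text \<open>A bound cell in between would bind one of the two outer cells: order convexity provides
  the cell below \<open>(i, j1)\<close> or above \<open>(i, j2)\<close>, and its value is squeezed
  to \<open>Suc k\<close> or \<open>k\<close>.\<close>

lemma bk_cols_convex:
  assumes "bk_free T k (i, j1)" "bk_free T k (i, j2)" "j1 \<le> j" "j \<le> j2"
  shows "bk_free T k (i, j)"
proof -
  note D12 = bk_free_in[OF assms(1)] bk_free_in[OF assms(2)]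
  have D: "(i, j) \<in> D" by (rule order_convexD[OF convex D12]) (use assms in auto)
  have le: "T (i, j1) \<le> T (i, j)" "T (i, j) \<le> T (i, j2)"
    using bk_row[OF D12(1) D] bk_row[OF D D12(2)] assms by auto
  have val: "T (i, j) = k \<or> T (i, j) = Suc k"
    using le assms(1,2) by (auto simp: bk_free_def)
  moreover have "\<not> (T (i, j) = k \<and> T (i + 1, j) = Suc k)"
  proof
    assume *: "T (i, j) = k \<and> T (i + 1, j) = Suc k"
    then have below: "(i + 1, j) \<in> D" using bk_pos by simp
    have D1: "(i + 1, j1) \<in> D" by (rule order_convexD[OF convex D12(1) below]) (use assms in auto)
    have "T (i, j1) = k" using * le assms(1) by (auto simp: bk_free_def)
    moreover have "T (i, j1) < T (i + 1, j1)" by (rule bk_col[OF D12(1) D1]) auto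
    moreover have "T (i + 1, j1) \<le> Suc k" using bk_row[OF D1 below] * assms by auto
    ultimately show False using assms(1) by (auto simp: bk_free_def bk_bound_def)
  qed
  moreover have "\<not> (T (i, j) = Suc k \<and> T (i - 1, j) = k)"
  proof
    assume *: "T (i, j) = Suc k \<and> T (i - 1, j) = k"
    then have above: "(i - 1, j) \<in> D" using bk_pos k by simp
    have D2: "(i - 1, j2) \<in> D" by (rule order_convexD[OF convex above D12(2)]) (use assms in auto)
    have "T (i, j2) = Suc k" using * le assms(2) by (auto simp: bk_free_def)
    moreover have "T (i - 1, j2) < T (i, j2)" by (rule bk_col[OF D2 D12(2)]) auto
    moreover have "k \<le> T (i - 1, j2)" using bk_row[OF above D2] * assms by auto
    ultimately show False using assms(2) by (auto simp: bk_free_def bk_bound_def)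
  qed
  ultimately show ?thesis by (auto simp: bk_free_def bk_bound_def)
qed

lemma bk_free_mirror:
  assumes "bk_free T k c"
  shows "bk_free T k (bk_mirror T k c)"
proof -
  let ?S = "{j. bk_free T k (fst c, j)}"
  have c: "snd c \<in> ?S" using assms by simp
  have "Min ?S \<in> ?S" "Max ?S \<in> ?S"
    using Min_in[OF bk_cols_finite] Max_in[OF bk_cols_finite] c by blast+
  moreover have "Min ?S \<le> snd c" "snd c \<le> Max ?S"
    using Min_le[OF bk_cols_finite c] Max_ge[OF bk_cols_finite c] by auto
  ultimately show ?thesis
    unfolding bk_mirror_def by (auto intro: bk_cols_convex[of "fst c" "Min ?S" "Max ?S"])
qed

lemma bk_mirror_mirror: "bk_mirror T k (bk_mirror T k c) = c"
  by (simp add: bk_mirror_def)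

lemma bk_free_val: "bk_free T k c \<Longrightarrow> bk k T c = k \<or> bk k T c = Suc k"
  using bk_free_mirror[of c] by (auto simp: bk_def bk_free_def)

lemma bk_not_free: "\<not> bk_free T k c \<Longrightarrow> bk k T c = T c"
  by (simp add: bk_def)

text \<open>A free cell has no partner in its column, so the entry below it exceeds
  \<open>Suc k\<close> and the entry above it is less than \<open>k\<close>. Exchanging
  \<open>k\<close> and \<open>Suc k\<close> in a free cell therefore never violates a
  column.\<close>

lemma bk_vertical:
  assumes "(i, j) \<in> D" "(i + 1, j) \<in> D"
  shows "bk k T (i, j) < bk k T (i + 1, j)"
    and "bk_free T k (i, j) \<Longrightarrow> Suc k < T (i + 1, j)"
    and "bk_free T k (i + 1, j) \<Longrightarrow> T (i, j) < k"
proof -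
  have lt: "T (i, j) < T (i + 1, j)" using bk_col[OF assms] by simp
  show 1: "Suc k < T (i + 1, j)" if "bk_free T k (i, j)"
    using that lt by (auto simp: bk_free_def bk_bound_def)
  show 2: "T (i, j) < k" if "bk_free T k (i + 1, j)"
    using that lt by (auto simp: bk_free_def bk_bound_def)
  have "bk_free T k (i, j) \<Longrightarrow> \<not> bk_free T k (i + 1, j)" using 1 by (auto simp: bk_free_def)
  then show "bk k T (i, j) < bk k T (i + 1, j)"
    using lt 1 2 bk_free_val[of "(i, j)"] bk_free_val[of "(i + 1, j)"]
    by (cases "bk_free T k (i, j)"; cases "bk_free T k (i + 1, j)") (auto simp: bk_not_free)
qed

lemma bk_horizontal:
  assumes D: "(i, j) \<in> D" "(i, j + 1) \<in> D"
  shows "bk k T (i, j) \<le> bk k T (i, j + 1)"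
proof -
  have le: "T (i, j) \<le> T (i, j + 1)" using bk_row[OF D] by simp
  consider "bk_free T k (i, j)" "bk_free T k (i, j + 1)"
    | "bk_free T k (i, j)" "\<not> bk_free T k (i, j + 1)"
    | "\<not> bk_free T k (i, j)" "bk_free T k (i, j + 1)"
    | "\<not> bk_free T k (i, j)" "\<not> bk_free T k (i, j + 1)" by blast
  then show ?thesis
  proof cases
    \<comment> \<open>The reflection reverses the order of the two entries, and exchanging
      \<open>k\<close> with \<open>Suc k\<close> restores it.\<close>
    case 1
    let ?m = "bk_mirror T k (i, j)"
    have m: "bk_mirror T k (i, j + 1) = (i, snd ?m - 1)" "?m = (i, snd ?m)"
      by (simp_all add: bk_mirror_def)
    have fr: "bk_free T k (i, snd ?m)" "bk_free T k (i, snd ?m - 1)"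
      using bk_free_mirror[OF 1(1)] bk_free_mirror[OF 1(2)] m by simp_all
    have "T (i, snd ?m - 1) \<le> T (i, snd ?m)"
      by (rule bk_row[OF fr(2)[THEN bk_free_in] fr(1)[THEN bk_free_in]]) simp
    moreover have "bk k T (i, j) = transpose k (Suc k) (T (i, snd ?m))"
      "bk k T (i, j + 1) = transpose k (Suc k) (T (i, snd ?m - 1))"
      using 1 m by (simp_all add: bk_def)
    ultimately show ?thesis using fr by (auto simp: bk_free_def)
  next
    \<comment> \<open>A violation forces a bound \<open>k\<close> at \<open>(i, j + 1)\<close>. Then
      the entry at \<open>(i + 1, j)\<close> exceeds \<open>Suc k\<close>, while its right neighbour
      equals \<open>Suc k\<close>. Case 3 is the mirror image.\<close>
    case 2
    show ?thesis
    proof (rule ccontr)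
      assume "\<not> ?thesis"
      then have "T (i, j + 1) = k" "T (i, j) = k"
        using 2 le bk_free_val[OF 2(1)] by (auto simp: bk_not_free bk_free_def)
      then have b: "T (i + 1, j + 1) = Suc k" using 2 k
        by (auto simp: bk_free_def bk_bound_def)
      then have below: "(i + 1, j + 1) \<in> D" using bk_pos by simp
      have "(i + 1, j) \<in> D" by (rule order_convexD[OF convex D(1) below]) auto
      then have "Suc k < T (i + 1, j)" "T (i + 1, j) \<le> T (i + 1, j + 1)"
        using bk_vertical(2)[OF D(1) _ 2(1)] bk_row[of "i + 1" j "j + 1"] below by auto
      then show False using b by simp
    qed
  next
    case 3
    show ?thesis
    proof (rule ccontr)
      assume "\<not> ?thesis"
      then have "T (i, j) = Suc k"
        using 3 le bk_free_val[OF 3(2)] by (auto simp: bk_not_free bk_free_def)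
      then have a: "T (i - 1, j) = k" using 3
        by (auto simp: bk_free_def bk_bound_def)
      then have above: "(i - 1, j) \<in> D" using bk_pos k by simp
      have "(i - 1, j + 1) \<in> D" by (rule order_convexD[OF convex above D(2)]) auto
      then have "T (i - 1, j + 1) < k" "T (i - 1, j) \<le> T (i - 1, j + 1)"
        using bk_vertical(3)[of "i - 1" "j + 1"] D(2) 3(2) bk_row[of "i - 1" j "j + 1"] above by auto
      then show False using a by simp
    qed
  qed (use le in \<open>simp add: bk_not_free\<close>)
qed

lemma bk_tableau: "bk k T \<in> tableaux N D"
proof -
  have "1 \<le> bk k T c \<and> bk k T c \<le> N" if "c \<in> D" for c
    using that k bk_free_val[of c] T maps_inside[of T N D c]
    by (cases "bk_free T k c") (auto simp: bk_not_free tableaux_def)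
  moreover have "bk k T c = 0" if "c \<notin> D" for c
    using that bk_free_in[of c] T by (auto simp: bk_def tableaux_def maps_outside)
  ultimately show ?thesis
    unfolding tableaux_def using bk_horizontal bk_vertical(1) by (auto intro!: mapsI locally_strictI)
qed

text \<open>The column neighbours of a free cell have values other than \<open>k\<close> and
  \<open>Suc k\<close>, and the partner of a bound cell is bound as well; none of these entries
  changes. Hence the reflection is the same before and after, which makes \<open>bk k\<close> an
  involution.\<close>

lemma bk_free_bk: "bk_free (bk k T) k c \<longleftrightarrow> bk_free T k c"
proof (cases "bk_free T k c")
  case True
  note D = bk_free_in[OF True]
  have "\<not> bk_bound (bk k T) k c"
  proof
    assume "bk_bound (bk k T) k c"
    then consider "bk k T (fst c + 1, snd c) = Suc k" | "bk k T (fst c - 1, snd c) = k"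
      by (auto simp: bk_bound_def)
    then show False
    proof cases
      case 1
      then have "(fst c + 1, snd c) \<in> D" using bk_tableau
        by (metis maps_outside mem_Collect_eq nat.distinct(1) tableaux_def)
      then have "Suc k < T (fst c + 1, snd c)" using bk_vertical(2)[of "fst c" "snd c"] D True by simp
      then show False using 1 by (auto simp: bk_not_free bk_free_def)
    next
      case 2
      then have "(fst c - 1, snd c) \<in> D" using bk_tableau k
        by (metis maps_outside mem_Collect_eq not_one_le_zero tableaux_def)
      then have "T (fst c - 1, snd c) < k" using bk_vertical(3)[of "fst c - 1" "snd c"] D True by simp
      then show False using 2 by (auto simp: bk_not_free bk_free_def)
    qed
  qed
  then show ?thesis using True bk_free_val[OF True] by (auto simp: bk_free_def)
next
  case False
  have "bk_bound (bk k T) k c" if b: "bk_bound T k c"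
  proof -
    have c: "bk k T c = T c" using False by (rule bk_not_free)
    from b consider "T c = k" "T (fst c + 1, snd c) = Suc k" | "T c = Suc k" "T (fst c - 1, snd c) = k"
      by (auto simp: bk_bound_def)
    then show ?thesis
    proof cases
      case 1
      then have "\<not> bk_free T k (fst c + 1, snd c)" by (simp add: bk_free_def bk_bound_def)
      then show ?thesis using 1 c by (simp add: bk_bound_def bk_not_free)
    next
      case 2
      then have "\<not> bk_free T k (fst c - 1, snd c)" by (simp add: bk_free_def bk_bound_def)
      then show ?thesis using 2 c by (simp add: bk_bound_def bk_not_free)
    qed
  qed
  then show ?thesis using False by (auto simp: bk_free_def bk_not_free)
qed

lemma bk_bk: "bk k (bk k T) = T"
proof
  fix c
  have "bk_mirror (bk k T) k = bk_mirror T k"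
    by (simp add: bk_mirror_def bk_free_bk fun_eq_iff)
  then show "bk k (bk k T) c = T c"
    using bk_free_mirror[of c] bk_mirror_mirror[of c] by (simp add: bk_def bk_free_bk)
qed

text \<open>Bound cells pair off vertically, so equally many carry \<open>k\<close> and
  \<open>Suc k\<close> and their product is symmetric in the two variables. On free cells the
  product is reindexed along the reflection; the remaining cells do not see the exchange.\<close>

lemma bk_prod:
  fixes x :: "nat \<Rightarrow> 'b::comm_ring_1"
  shows "(\<Prod>c\<in>D. x (bk k T c)) = (\<Prod>c\<in>D. (x \<circ> transpose k (Suc k)) (T c))"
proof -
  let ?f = "transpose k (Suc k)"
  define F where "F = {c \<in> D. bk_free T k c}"
  define K where "K = {c \<in> D. bk_bound T k c \<and> T c = k}"
  define L where "L = {c \<in> D. bk_bound T k c \<and> T c = Suc k}"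
  define R where "R = {c \<in> D. T c \<noteq> k \<and> T c \<noteq> Suc k}"
  have D: "D = F \<union> (K \<union> L \<union> R)"
    by (auto simp: F_def K_def L_def R_def bk_free_def)
  have fins: "finite F" "finite K" "finite L" "finite R"
    using fin by (auto simp: F_def K_def L_def R_def)
  have split: "prod g D = prod g F * (prod g K * prod g L * prod g R)" for g :: "cell \<Rightarrow> 'b"
  proof -
    have "F \<inter> (K \<union> L \<union> R) = {}" "(K \<union> L) \<inter> R = {}" "K \<inter> L = {}"
      by (auto simp: F_def K_def L_def R_def bk_free_def)
    then show ?thesis using fins by (subst D) (simp add: prod.union_disjoint)
  qed
  have "bij_betw (\<lambda>c. (fst c + 1, snd c)) K L"
  proof (rule bij_betw_byWitness[where f'="\<lambda>c. (fst c - 1, snd c)"])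
    show "(\<lambda>c. (fst c + 1, snd c)) ` K \<subseteq> L"
      using bk_pos by (auto simp: K_def L_def bk_bound_def)
    show "(\<lambda>c. (fst c - 1, snd c)) ` L \<subseteq> K"
      using bk_pos k by (auto simp: K_def L_def bk_bound_def)
  qed auto
  then have "card K = card L" by (rule bij_betw_same_card)
  moreover have pow: "prod (\<lambda>c. h (T c)) K = h k ^ card K" "prod (\<lambda>c. h (T c)) L = h (Suc k) ^ card L"
    for h :: "nat \<Rightarrow> 'b" by (simp_all add: K_def L_def)
  ultimately have "prod (\<lambda>c. x (T c)) K * prod (\<lambda>c. x (T c)) L =
      prod (\<lambda>c. x (?f (T c))) K * prod (\<lambda>c. x (?f (T c))) L"
    using pow[of x] pow[of "\<lambda>v. x (?f v)"] by (simp add: mult.commute)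
  moreover have "prod (\<lambda>c. x (bk k T c)) K = prod (\<lambda>c. x (T c)) K"
    "prod (\<lambda>c. x (bk k T c)) L = prod (\<lambda>c. x (T c)) L"
    by (rule prod.cong; auto simp: K_def L_def bk_def bk_free_def)+
  moreover have "prod (\<lambda>c. x (bk k T c)) R = prod (\<lambda>c. x (?f (T c))) R"
    by (rule prod.cong) (auto simp: R_def bk_def bk_free_def)
  moreover have "prod (\<lambda>c. x (bk k T c)) F = prod (\<lambda>c. x (?f (T c))) F"
  proof -
    have "prod (\<lambda>c. x (?f (T c))) F = prod (\<lambda>c. x (?f (T (bk_mirror T k c)))) F"
      by (rule prod.reindex_bij_witness[where i="bk_mirror T k" and j="bk_mirror T k"])
        (auto simp: F_def bk_mirror_mirror bk_free_mirror bk_free_in)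
    also have "\<dots> = prod (\<lambda>c. x (bk k T c)) F"
      by (rule prod.cong) (auto simp: F_def bk_def)
    finally show ?thesis by simp
  qed
  ultimately show ?thesis by (simp add: split)
qed

end

lemma schur_transpose_Suc:
  assumes "finite D" "order_convex D" "1 \<le> k" "Suc k \<le> N"
  shows "schur N (x \<circ> transpose k (Suc k)) D = schur N x D"
  unfolding schur_eq_sum_tableaux[OF assms(1)]
proof (rule sum.reindex_bij_witness[where i="bk k" and j="bk k"], goal_cases)
  case (5 T)
  show ?case by (rule bk_prod[OF assms 5, of x])
qed (rule bk_bk[OF assms] bk_tableau[OF assms], assumption)+

text \<open>A transposition is a shorter one conjugated by an adjacent one.\<close>

lemma schur_transpose:
  assumes "finite D" "order_convex D" "1 \<le> a" "a < b" "b \<le> N"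
  shows "schur N (x \<circ> transpose a b) D = schur N x D"
  using assms(4,5)
proof (induction "b - a" arbitrary: b x)
  case (Suc n)
  obtain b' where b: "b = Suc b'" using Suc.prems by (cases b) auto
  show ?case
  proof (cases "a = b'")
    case True
    then show ?thesis using schur_transpose_Suc[OF assms(1-3)] Suc.prems b by simp
  next
    case False
    have eq: "transpose a b = transpose b' b \<circ> transpose a b' \<circ> transpose b' b"
      using False b Suc.prems by (auto simp: fun_eq_iff transpose_def)
    have "schur N (x \<circ> transpose a b) D = schur N ((x \<circ> transpose b' b \<circ> transpose a b') \<circ> transpose b' b) D"
      by (simp add: eq comp_assoc)
    also have "\<dots> = schur N (x \<circ> transpose b' b \<circ> transpose a b') D"
      unfolding b by (rule schur_transpose_Suc[OF assms(1,2)]) (use assms(3) False Suc.prems b in auto)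
    also have "\<dots> = schur N (x \<circ> transpose b' b) D"
      by (rule Suc.hyps(1)) (use False Suc.prems Suc.hyps b in auto)
    also have "\<dots> = schur N x D"
      unfolding b by (rule schur_transpose_Suc[OF assms(1,2)]) (use assms(3) False Suc.prems b in auto)
    finally show ?thesis .
  qed
qed simp

lemma schur_permutes:
  assumes "finite D" "order_convex D" "p permutes {1..N}"
  shows "schur N (x \<circ> p) D = schur N x D"
  using assms(3) finite_atLeastAtMost
proof (induction p arbitrary: x rule: permutes_induct)
  case (swap a b p)
  have "schur N ((x \<circ> transpose a b) \<circ> p) D = schur N (x \<circ> transpose a b) D" by (rule swap.IH)
  also have "\<dots> = schur N x D"
    using swap.hyps schur_transpose[OF assms(1,2), of a b N x] schur_transpose[OF assms(1,2), of b a N x]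
    by (cases "a < b") (auto simp: transpose_commute)
  finally show ?case by (simp only: comp_assoc)
qed simp

section \<open>Rotation by 180 degrees\<close>

lemma rotate180_eq_image: "rotate180 D = (\<lambda>c. (- fst c, - snd c)) ` D"
  unfolding rotate180_def by (rule image_cong) auto

lemma mem_rotate180: "(i, j) \<in> rotate180 D \<longleftrightarrow> (- i, - j) \<in> D"
  unfolding rotate180_eq_image by (auto intro: rev_image_eqI)

lemma finite_rotate180: "finite D \<Longrightarrow> finite (rotate180 D)"
  by (simp add: rotate180_def)

lemma rotate180_rotate180: "rotate180 (rotate180 D) = D"
  by (auto simp: mem_rotate180)

text \<open>Rotating and replacing each entry \<open>v\<close> by \<open>N + 1 - v\<close> reverses the order of the variables.\<close>

lemma schur_rotate180:
  assumes D: "finite D" "order_convex D"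
  shows "schur N x (rotate180 D) = schur N x D"
proof -
  \<comment> \<open>Being the identity outside \<open>{1..N}\<close> makes \<open>r\<close> a
    permutation in the sense of \<open>permutes\<close> and preserves the default entry 0.\<close>
  define r where "r v = (if v \<in> {1..N} then N + 1 - v else v)" for v :: nat
  have rr: "r (r v) = v" for v by (auto simp: r_def)
  have r01: "r v = 0 \<longleftrightarrow> v = 0" "r 0 = 0" for v by (auto simp: r_def)
  have r: "r permutes {1..N}"
    by (rule bij_imp_permutes, rule bij_betw_byWitness[where f'=r]) (auto simp: r_def)
  define g where "g T = (\<lambda>c. r (T (- fst c, - snd c)))" for T :: "cell \<Rightarrow> nat"
  have tab: "g T \<in> tableaux N (rotate180 E)" if "T \<in> tableaux N E" for T E
  proof -
    note maps = that[unfolded tableaux_def, simplified, THEN conjunct1]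
    note loc = that[unfolded tableaux_def, simplified, THEN conjunct2]
    have in_N: "T c \<in> {1..N}" if "c \<in> E" for c using maps_inside[OF maps that] by simp
    have 1: "1 \<le> g T c \<and> g T c \<le> N" if "c \<in> rotate180 E" for c
      using in_N[of "(- fst c, - snd c)"] that by (cases c) (auto simp: mem_rotate180 g_def r_def)
    have 2: "g T c = 0" if "c \<notin> rotate180 E" for c
      using maps_outside[OF maps, of "(- fst c, - snd c)"] that
      by (cases c) (auto simp: mem_rotate180 g_def r01)
    have 3: "g T (i, j) \<le> g T (i, j + 1)" if "(i, j) \<in> rotate180 E" "(i, j + 1) \<in> rotate180 E" for i j
      using that in_N[of "(- i, - j)"] in_N[of "(- i, - j - 1)"]
        locally_strict_rightD[OF loc, of "- i" "- j - 1"]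
      by (auto simp: mem_rotate180 g_def r_def)
    have 4: "g T (i, j) < g T (i + 1, j)" if "(i, j) \<in> rotate180 E" "(i + 1, j) \<in> rotate180 E" for i j
      using that in_N[of "(- i, - j)"] in_N[of "(- i - 1, - j)"]
        locally_strict_downD[OF loc, of "- i - 1" "- j"]
      by (auto simp: mem_rotate180 g_def r_def)
    show ?thesis unfolding tableaux_def using 1 2 3 4 by (blast intro: mapsI locally_strictI)
  qed
  have gg: "g (g T) = T" for T by (simp add: g_def rr fun_eq_iff)
  have "schur N x (rotate180 D) = schur N (x \<circ> r) D"
    unfolding schur_eq_sum_tableaux[OF D(1)] schur_eq_sum_tableaux[OF finite_rotate180[OF D(1)]]
  proof (rule sum.reindex_bij_witness[where i=g and j=g], goal_cases)
    case (2 T)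
    then show ?case using tab[OF 2] by (simp add: rotate180_rotate180)
  next
    case (5 T)
    show ?case unfolding rotate180_eq_image
      by (subst prod.reindex) (auto simp: inj_on_def prod_eq_iff g_def rr)
  qed (use gg tab in auto)
  also have "\<dots> = schur N x D" by (rule schur_permutes[OF D r])
  finally show ?thesis .
qed

subsection \<open>Pairs of paths\<close>

text \<open>
  A filled ribbon, read along increasing content, is a sequence of values each of whose steps is labelled
  by whether it goes up (values decrease strictly) or right (values increase weakly).
\<close>

definition step_ok :: "bool \<Rightarrow> nat \<Rightarrow> nat \<Rightarrow> bool" where
  "step_ok e v w \<longleftrightarrow> (w < v \<longleftrightarrow> e)"

text \<open>
  Two values on one diagonal of a projection, and two on the next diagonal: \<open>v\<close>, \<open>v'\<close> belong to the first
  copy of the ribbon and \<open>w\<close>, \<open>w'\<close> to the second one, which lies southeast of the first if \<open>s\<close> holds and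
  northwest of it otherwise. The last two conditions are violated exactly when the paths can be crossed.
\<close>

definition pair_step_ok :: "bool \<Rightarrow> bool \<Rightarrow> nat \<Rightarrow> nat \<Rightarrow> nat \<Rightarrow> nat \<Rightarrow> bool" where
  "pair_step_ok s e v w v' w' \<longleftrightarrow> step_ok e v v' \<and> step_ok e w w' \<and>
     (if e = s then \<not> step_ok e v w' else \<not> step_ok e w v')"

context
  fixes N :: nat and x :: "nat \<Rightarrow> 'b::comm_ring_1" and e :: "nat \<Rightarrow> bool"
begin

text \<open>The sum runs over the \<open>n\<close> values that follow a value \<open>v\<close> at
  position \<open>m\<close>. The variable of \<open>v\<close> itself is left out, and
  \<open>B\<close> is a weight for the last value, which allows different conditions at the end.
  \<open>pair_sum\<close> does this for two simultaneous paths.\<close>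

fun path_sum :: "(nat \<Rightarrow> 'b) \<Rightarrow> nat \<Rightarrow> nat \<Rightarrow> nat \<Rightarrow> 'b" where
  "path_sum B m 0 v = B v"
| "path_sum B m (Suc n) v = (\<Sum>w=1..N. x w * (of_bool (step_ok (e m) v w) * path_sum B (Suc m) n w))"

fun pair_sum :: "bool \<Rightarrow> (nat \<Rightarrow> nat \<Rightarrow> 'b) \<Rightarrow> nat \<Rightarrow> nat \<Rightarrow> nat \<Rightarrow> nat \<Rightarrow> 'b" where
  "pair_sum s B m 0 v w = B v w"
| "pair_sum s B m (Suc n) v w = (\<Sum>v'=1..N. \<Sum>w'=1..N. x v' * (x w' *
     (of_bool (pair_step_ok s (e m) v w v' w') * pair_sum s B (Suc m) n v' w')))"

text \<open>\<open>C\<close> and \<open>B\<close> ignore the path cells, so these can be summed out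
  from the far end backwards. The cell \<open>z m\<close> stays in \<open>V\<close>, since its value
  is the start of the path.\<close>

lemma weighted_sum_path:
  fixes z :: "nat \<Rightarrow> 'a"
  assumes "finite V" "z m \<in> V" "inj_on z {m..m + n}" "z ` {m + 1..m + n} \<inter> V = {}"
    and "\<And>T c v. c \<in> z ` {m + 1..m + n} \<Longrightarrow> C (T(c := v)) = C T"
    and "\<And>T c v. c \<in> z ` {m + 1..m + n} \<Longrightarrow> B (T(c := v)) = B T"
  shows "weighted_sum N x (V \<union> z ` {m + 1..m + n})
      (\<lambda>T. C T * (\<Prod>j\<in>{m..<m + n}. of_bool (step_ok (e j) (T (z j)) (T (z (j + 1))))) * B T (T (z (m + n))))
    = weighted_sum N x V (\<lambda>T. C T * path_sum (B T) m n (T (z m)))"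
  using assms
proof (induction n arbitrary: m V C)
  case 0
  then show ?case by (simp add: mult.assoc)
next
  case (Suc n)
  let ?ok = "\<lambda>j T. of_bool (step_ok (e j) (T (z j)) (T (z (j + 1)))) :: 'b"
  have range: "{m + 1..m + Suc n} = insert (m + 1) {m + 1 + 1..m + 1 + n}" by auto
  have sets: "V \<union> z ` {m + 1..m + Suc n} = insert (z (m + 1)) V \<union> z ` {m + 1 + 1..m + 1 + n}"
    unfolding range by auto
  have z1: "z (m + 1) \<notin> V" using Suc.prems(4) by (auto simp: disjoint_iff)
  have ne: "z j \<noteq> z i" if "j < i" "m \<le> j" "i \<le> m + Suc n" for i j
    using inj_onD[OF Suc.prems(3), of j i] that by auto
  have prod: "(\<Prod>j\<in>{m..<m + Suc n}. ?ok j T) = ?ok m T * (\<Prod>j\<in>{m + 1..<m + 1 + n}. ?ok j T)" for T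
    by (subst prod.atLeast_Suc_lessThan) auto
  have "weighted_sum N x (V \<union> z ` {m + 1..m + Suc n})
      (\<lambda>T. C T * (\<Prod>j\<in>{m..<m + Suc n}. ?ok j T) * B T (T (z (m + Suc n)))) =
    weighted_sum N x (insert (z (m + 1)) V \<union> z ` {m + 1 + 1..m + 1 + n})
      (\<lambda>T. (C T * ?ok m T) * (\<Prod>j\<in>{m + 1..<m + 1 + n}. ?ok j T) * B T (T (z (m + 1 + n))))"
    unfolding sets prod by (simp add: mult.assoc)
  also have "\<dots> = weighted_sum N x (insert (z (m + 1)) V)
      (\<lambda>T. (C T * ?ok m T) * path_sum (B T) (m + 1) n (T (z (m + 1))))"
  proof (rule Suc.IH)
    show "inj_on z {m + 1..m + 1 + n}" by (rule inj_on_subset[OF Suc.prems(3)]) auto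
    show "z ` {m + 1 + 1..m + 1 + n} \<inter> insert (z (m + 1)) V = {}"
    proof -
      have "z i \<notin> V" "z i \<noteq> z (m + 1)" if "i \<in> {m + 1 + 1..m + 1 + n}" for i
        using that Suc.prems(4) ne[of "m + 1" i] by (auto simp: disjoint_iff)
      then show ?thesis by blast
    qed
    fix T c v assume c: "c \<in> z ` {m + 1 + 1..m + 1 + n}"
    then have c': "c \<in> z ` {m + 1..m + Suc n}" by auto
    have "c \<noteq> z m" "c \<noteq> z (m + 1)"
    proof -
      obtain i where i: "i \<in> {m + 1 + 1..m + 1 + n}" "c = z i" using c by blast
      then show "c \<noteq> z m" "c \<noteq> z (m + 1)" using ne[of m i] ne[of "m + 1" i] by auto
    qed
    then show "C (T(c := v)) * ?ok m (T(c := v)) = C T * ?ok m T"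
      unfolding Suc.prems(5)[OF c'] by simp
    show "B (T(c := v)) = B T" by (rule Suc.prems(6)[OF c'])
  qed (use Suc.prems(1) in auto)
  also have "\<dots> = weighted_sum N x V (\<lambda>T. C T * path_sum (B T) m (Suc n) (T (z m)))"
  proof -
    have c': "z (m + 1) \<in> z ` {m + 1..m + Suc n}" by auto
    show ?thesis
      unfolding weighted_sum_insert[OF Suc.prems(1) z1] Suc.prems(5)[OF c'] Suc.prems(6)[OF c']
      using ne[of m "m + 1"] by (simp add: sum_distrib_left algebra_simps)
  qed
  finally show ?case .
qed

lemma weighted_sum_path_pair:
  fixes z y :: "nat \<Rightarrow> 'a"
  assumes "finite V" "z m \<in> V" "y m \<in> V" "inj_on z {m..m + n}" "inj_on y {m..m + n}"
    and "z ` {m..m + n} \<inter> y ` {m..m + n} = {}"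
    and "z ` {m + 1..m + n} \<inter> V = {}" "y ` {m + 1..m + n} \<inter> V = {}"
    and "\<And>T c v. c \<in> z ` {m + 1..m + n} \<union> y ` {m + 1..m + n} \<Longrightarrow> C (T(c := v)) = C T"
    and "\<And>T c v. c \<in> z ` {m + 1..m + n} \<union> y ` {m + 1..m + n} \<Longrightarrow> B (T(c := v)) = B T"
  shows "weighted_sum N x (V \<union> z ` {m + 1..m + n} \<union> y ` {m + 1..m + n})
      (\<lambda>T. C T * (\<Prod>j\<in>{m..<m + n}.
          of_bool (pair_step_ok s (e j) (T (z j)) (T (y j)) (T (z (j + 1))) (T (y (j + 1)))))
        * B T (T (z (m + n))) (T (y (m + n))))
    = weighted_sum N x V (\<lambda>T. C T * pair_sum s (B T) m n (T (z m)) (T (y m)))"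
  using assms
proof (induction n arbitrary: m V C)
  case 0
  then show ?case by (simp add: mult.assoc)
next
  case (Suc n)
  let ?ok = "\<lambda>j T. of_bool (pair_step_ok s (e j) (T (z j)) (T (y j)) (T (z (j + 1))) (T (y (j + 1)))) :: 'b"
  let ?I = "{m + 1 + 1..m + 1 + n}"
  let ?V = "insert (y (m + 1)) (insert (z (m + 1)) V)"
  have range: "{m + 1..m + Suc n} = insert (m + 1) ?I" by auto
  have sets: "V \<union> z ` {m + 1..m + Suc n} \<union> y ` {m + 1..m + Suc n} = ?V \<union> z ` ?I \<union> y ` ?I"
    unfolding range by auto
  have zV: "z i \<notin> V" "y i \<notin> V" if "m < i" "i \<le> m + Suc n" for i
    using Suc.prems(7,8) that by (auto simp: disjoint_iff)
  have ne: "z j \<noteq> z i" "y j \<noteq> y i" if "j < i" "m \<le> j" "i \<le> m + Suc n" for i j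
    using inj_onD[OF Suc.prems(4), of j i] inj_onD[OF Suc.prems(5), of j i] that by auto
  have zy: "z j \<noteq> y i" if "i \<in> {m..m + Suc n}" "j \<in> {m..m + Suc n}" for i j
    using imageI[OF that(1), of y] imageI[OF that(2), of z] Suc.prems(6) by (metis IntI empty_iff)
  have prod: "(\<Prod>j\<in>{m..<m + Suc n}. ?ok j T) = ?ok m T * (\<Prod>j\<in>{m + 1..<m + 1 + n}. ?ok j T)" for T
    by (subst prod.atLeast_Suc_lessThan) auto
  have "weighted_sum N x (V \<union> z ` {m + 1..m + Suc n} \<union> y ` {m + 1..m + Suc n})
      (\<lambda>T. C T * (\<Prod>j\<in>{m..<m + Suc n}. ?ok j T) * B T (T (z (m + Suc n))) (T (y (m + Suc n)))) =
    weighted_sum N x (?V \<union> z ` ?I \<union> y ` ?I)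
      (\<lambda>T. (C T * ?ok m T) * (\<Prod>j\<in>{m + 1..<m + 1 + n}. ?ok j T)
        * B T (T (z (m + 1 + n))) (T (y (m + 1 + n))))"
    unfolding sets prod by (simp add: mult.assoc)
  also have "\<dots> = weighted_sum N x ?V
      (\<lambda>T. (C T * ?ok m T) * pair_sum s (B T) (m + 1) n (T (z (m + 1))) (T (y (m + 1))))"
  proof (rule Suc.IH)
    show "inj_on z {m + 1..m + 1 + n}" "inj_on y {m + 1..m + 1 + n}"
      by (rule inj_on_subset[OF Suc.prems(4)], simp, rule inj_on_subset[OF Suc.prems(5)], simp)
    show "z ` {m + 1..m + 1 + n} \<inter> y ` {m + 1..m + 1 + n} = {}"
    proof -
      have "z ` {m + 1..m + 1 + n} \<subseteq> z ` {m..m + Suc n}" "y ` {m + 1..m + 1 + n} \<subseteq> y ` {m..m + Suc n}"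
        by (auto intro!: image_mono)
      then show ?thesis using Suc.prems(6) by blast
    qed
    show "z ` ?I \<inter> ?V = {}" "y ` ?I \<inter> ?V = {}"
    proof -
      have "z i \<noteq> y (m + 1)" "z i \<noteq> z (m + 1)" "z i \<notin> V"
        "y i \<noteq> y (m + 1)" "y i \<noteq> z (m + 1)" "y i \<notin> V" if "i \<in> ?I" for i
        using that ne[of "m + 1" i] zV[of i] zy[of "m + 1" i] zy[of i "m + 1"] by auto
      then show "z ` ?I \<inter> ?V = {}" "y ` ?I \<inter> ?V = {}" by blast+
    qed
    fix T c v assume c: "c \<in> z ` ?I \<union> y ` ?I"
    then have c': "c \<in> z ` {m + 1..m + Suc n} \<union> y ` {m + 1..m + Suc n}" by auto
    have "c \<noteq> z m" "c \<noteq> z (m + 1)" "c \<noteq> y m" "c \<noteq> y (m + 1)"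
    proof -
      obtain i where i: "i \<in> ?I" "c = z i \<or> c = y i" using c by blast
      then show "c \<noteq> z m" "c \<noteq> z (m + 1)" "c \<noteq> y m" "c \<noteq> y (m + 1)"
        using ne[of m i] ne[of "m + 1" i] zy[of m i] zy[of i m] zy[of "m + 1" i] zy[of i "m + 1"] by auto
    qed
    then show "C (T(c := v)) * ?ok m (T(c := v)) = C T * ?ok m T"
      unfolding Suc.prems(9)[OF c'] by simp
    show "B (T(c := v)) = B T" by (rule Suc.prems(10)[OF c'])
  qed (use Suc.prems(1) in auto)
  also have "\<dots> = weighted_sum N x V (\<lambda>T. C T * pair_sum s (B T) m (Suc n) (T (z m)) (T (y m)))"
  proof -
    have c': "z (m + 1) \<in> z ` {m + 1..m + Suc n} \<union> y ` {m + 1..m + Suc n}"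
      "y (m + 1) \<in> z ` {m + 1..m + Suc n} \<union> y ` {m + 1..m + Suc n}" by auto
    have fin: "finite (insert (z (m + 1)) V)" using Suc.prems(1) by simp
    have y: "y (m + 1) \<notin> insert (z (m + 1)) V" using zV[of "m + 1"] zy[of "m + 1" "m + 1"] by auto
    have z: "z (m + 1) \<notin> V" using zV[of "m + 1"] by auto
    have neq: "z m \<noteq> z (m + 1)" "y m \<noteq> y (m + 1)" "z m \<noteq> y (m + 1)" "y m \<noteq> z (m + 1)"
      "z (m + 1) \<noteq> y (m + 1)"
      using ne[of m "m + 1"] zy[of "m + 1" m] zy[of m "m + 1"] zy[of "m + 1" "m + 1"] by auto
    note C = Suc.prems(9)[OF c'(1)] Suc.prems(9)[OF c'(2)]
    note B = Suc.prems(10)[OF c'(1)] Suc.prems(10)[OF c'(2)]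
    show ?thesis
      unfolding weighted_sum_insert[OF fin y] weighted_sum_insert[OF Suc.prems(1) z] C B
      using neq neq[THEN not_sym] by (simp add: sum_distrib_left algebra_simps)
  qed
  finally show ?case .
qed

text \<open>The diagonal is assumed to vanish separately because antisymmetry yields only
  \<open>2 * f v v = 0\<close>, and 2 may be a zero divisor in the ring.\<close>

lemma sum_swap_zero:
  fixes f :: "nat \<Rightarrow> nat \<Rightarrow> 'b"
  assumes "\<And>v w. f v w = - f w v" "\<And>v. f v v = 0"
  shows "(\<Sum>v=1..n. \<Sum>w=1..n. f v w) = 0"
proof (induction n)
  case (Suc n)
  have "(\<Sum>v=1..n. f v (Suc n)) = - (\<Sum>w=1..n. f (Suc n) w)"
    unfolding sum_negf[symmetric] by (intro sum.cong refl assms(1))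
  with Suc show ?case by (simp add: sum.distrib assms(2))
qed simp

text \<open>
  The two-by-two Lindstroem-Gessel-Viennot determinant: among pairs of steps that can be crossed,
  exchanging the two targets is an involution under which the determinant changes sign.
\<close>

lemma path_sum_crossing:
  assumes "if s then v < w else w < v"
  shows "path_sum (\<lambda>_. 1) m n v * path_sum (\<lambda>u. of_bool (step_ok s u q)) m n w -
      path_sum (\<lambda>u. of_bool (step_ok s u q)) m n v * path_sum (\<lambda>_. 1) m n w =
    pair_sum s (\<lambda>u u'. of_bool (step_ok s u' q \<and> \<not> step_ok s u q)) m n v w"
  using assms
proof (induction n arbitrary: m v w)
  \<comment> \<open>The order of \<open>v\<close> and \<open>w\<close> makes
    \<open>step_ok s v q\<close> imply \<open>step_ok s w q\<close>, so the difference of the two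
    indicators is itself an indicator.\<close>
  case 0
  then show ?case by (auto simp: step_ok_def split: if_splits)
next
  case (Suc n)
  let ?F = "path_sum (\<lambda>_. 1) (Suc m) n" and ?Q = "path_sum (\<lambda>u. of_bool (step_ok s u q)) (Suc m) n"
  let ?P = "pair_sum s (\<lambda>u u'. of_bool (step_ok s u' q \<and> \<not> step_ok s u q)) (Suc m) n"
  let ?ok = "step_ok (e m)"
  let ?D = "\<lambda>v' w'. x v' * (x w' * (?F v' * ?Q w' - ?Q v' * ?F w'))"
  have "path_sum (\<lambda>_. 1) m (Suc n) v * path_sum (\<lambda>u. of_bool (step_ok s u q)) m (Suc n) w -
      path_sum (\<lambda>u. of_bool (step_ok s u q)) m (Suc n) v * path_sum (\<lambda>_. 1) m (Suc n) w =
      (\<Sum>v'=1..N. \<Sum>w'=1..N. of_bool (?ok v v' \<and> ?ok w w') * ?D v' w')"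
    by (simp only: path_sum.simps sum_product sum_subtractf[symmetric] of_bool_conj)
      (intro sum.cong refl, simp add: algebra_simps)
  also have "\<dots> = (\<Sum>v'=1..N. \<Sum>w'=1..N. of_bool (pair_step_ok s (e m) v w v' w') * ?D v' w') +
      (\<Sum>v'=1..N. \<Sum>w'=1..N. of_bool (?ok v v' \<and> ?ok w w' \<and> \<not> pair_step_ok s (e m) v w v' w') * ?D v' w')"
    unfolding sum.distrib[symmetric]
    by (intro sum.cong refl) (auto simp: pair_step_ok_def)
  also have "(\<Sum>v'=1..N. \<Sum>w'=1..N. of_bool (?ok v v' \<and> ?ok w w' \<and> \<not> pair_step_ok s (e m) v w v' w') * ?D v' w') = 0"
  proof (rule sum_swap_zero)
    fix v' w'
    have "(?ok v v' \<and> ?ok w w' \<and> \<not> pair_step_ok s (e m) v w v' w') \<longleftrightarrow>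
        (?ok v w' \<and> ?ok w v' \<and> \<not> pair_step_ok s (e m) v w w' v')"
      using Suc.prems by (cases s; cases "e m") (auto simp: pair_step_ok_def step_ok_def)
    then show "of_bool (?ok v v' \<and> ?ok w w' \<and> \<not> pair_step_ok s (e m) v w v' w') * ?D v' w' =
        - (of_bool (?ok v w' \<and> ?ok w v' \<and> \<not> pair_step_ok s (e m) v w w' v') * ?D w' v')"
      by (simp only:) (simp add: algebra_simps)
  qed (simp add: algebra_simps)
  also have "(\<Sum>v'=1..N. \<Sum>w'=1..N. of_bool (pair_step_ok s (e m) v w v' w') * ?D v' w') =
      (\<Sum>v'=1..N. \<Sum>w'=1..N. of_bool (pair_step_ok s (e m) v w v' w') * (x v' * (x w' * ?P v' w')))"
  proof (intro sum.cong refl)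
    fix v' w'
    show "of_bool (pair_step_ok s (e m) v w v' w') * ?D v' w' =
        of_bool (pair_step_ok s (e m) v w v' w') * (x v' * (x w' * ?P v' w'))"
    proof (cases "pair_step_ok s (e m) v w v' w'")
      \<comment> \<open>The targets of a pair that cannot be crossed are again strictly ordered, as
        the induction hypothesis demands.\<close>
      case True
      then have "if s then v' < w' else w' < v'"
        by (cases s; cases "e m") (auto simp: pair_step_ok_def step_ok_def)
      then show ?thesis using Suc.IH by simp
    qed simp
  qed
  finally show ?case by (simp add: algebra_simps)
qed

section \<open>Fillings of one or two copies of the ribbon with prescribed neighbours\<close>

definition open_path :: "bool \<Rightarrow> nat \<Rightarrow> nat \<Rightarrow> 'b" where
  "open_path s k q = (case k of 0 \<Rightarrow> 1
     | Suc n \<Rightarrow> \<Sum>b=1..N. x b * path_sum (\<lambda>u. of_bool (step_ok s u q)) 1 n b)"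

definition free_path :: "nat \<Rightarrow> 'b" where
  "free_path k = (case k of 0 \<Rightarrow> 1 | Suc n \<Rightarrow> \<Sum>b=1..N. x b * path_sum (\<lambda>_. 1) 1 n b)"

text \<open>The first copy continues \<open>p\<close> and ends freely, the second begins freely and
  leads to \<open>q\<close>; the negated conditions come from the contacts of \<open>p\<close> with
  the second copy and of the first copy with \<open>q\<close>. For \<open>k = 0\<close> only the
  contact of \<open>p\<close> with \<open>q\<close> is left.\<close>

definition path_pair :: "bool \<Rightarrow> nat \<Rightarrow> nat \<Rightarrow> nat \<Rightarrow> 'b" where
  "path_pair s k p q = (case k of 0 \<Rightarrow> of_bool (\<not> step_ok s p q)
     | Suc n \<Rightarrow> \<Sum>a=1..N. \<Sum>b=1..N. x a * (x b * (of_bool (step_ok s p a \<and> \<not> step_ok s p b) *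
         pair_sum s (\<lambda>u u'. of_bool (step_ok s u' q \<and> \<not> step_ok s u q)) 1 n a b)))"

text \<open>The first cells \<open>a\<close>, \<open>b\<close> of the two paths behave like a pair
  of targets. If both may follow \<open>p\<close>, exchanging them changes the sign of the
  determinant; if only \<open>a\<close> may, then \<open>a\<close> and \<open>b\<close> are strictly
  ordered in the way \<open>path_sum_crossing\<close> needs. This is where the first step must have
  direction \<open>s\<close>.\<close>

lemma path_sum_times_open_path:
  assumes "e 0 = s"
  shows "path_sum (\<lambda>_. 1) 0 k p * open_path s k q =
    path_sum (\<lambda>u. of_bool (step_ok s u q)) 0 k p * free_path k + path_pair s k p q"
proof (cases k)
  case 0
  then show ?thesis by (simp add: open_path_def free_path_def path_pair_def)
next
  case (Suc n)
  let ?F = "path_sum (\<lambda>_. 1) 1 n" and ?Q = "path_sum (\<lambda>u. of_bool (step_ok s u q)) 1 n"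
  let ?P = "pair_sum s (\<lambda>u u'. of_bool (step_ok s u' q \<and> \<not> step_ok s u q)) 1 n"
  let ?ok = "step_ok s p"
  let ?D = "\<lambda>a b. x a * (x b * (?F a * ?Q b - ?Q a * ?F b))"
  have "path_sum (\<lambda>_. 1) 0 k p * open_path s k q -
      path_sum (\<lambda>u. of_bool (step_ok s u q)) 0 k p * free_path k =
      (\<Sum>a=1..N. \<Sum>b=1..N. of_bool (?ok a) * ?D a b)"
    unfolding Suc open_path_def free_path_def assms path_sum.simps nat.case One_nat_def
      sum_product sum_subtractf[symmetric]
    by (intro sum.cong refl, simp add: algebra_simps)
  also have "\<dots> = (\<Sum>a=1..N. \<Sum>b=1..N. of_bool (?ok a \<and> \<not> ?ok b) * ?D a b) +
      (\<Sum>a=1..N. \<Sum>b=1..N. of_bool (?ok a \<and> ?ok b) * ?D a b)"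
    unfolding sum.distrib[symmetric] by (intro sum.cong refl) auto
  also have "(\<Sum>a=1..N. \<Sum>b=1..N. of_bool (?ok a \<and> ?ok b) * ?D a b) = 0"
    by (rule sum_swap_zero) (simp_all add: algebra_simps)
  also have "(\<Sum>a=1..N. \<Sum>b=1..N. of_bool (?ok a \<and> \<not> ?ok b) * ?D a b) = path_pair s k p q"
    unfolding Suc path_pair_def nat.case
  proof (intro sum.cong refl)
    fix a b
    show "of_bool (?ok a \<and> \<not> ?ok b) * ?D a b = x a * (x b * (of_bool (?ok a \<and> \<not> ?ok b) * ?P a b))"
    proof (cases "?ok a \<and> \<not> ?ok b")
      case True
      then have "if s then a < b else b < a" by (auto simp: step_ok_def split: if_splits)
      then show ?thesis using path_sum_crossing[of s a b 1 n q] True by simp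
    qed (auto simp: algebra_simps)
  qed
  finally show ?thesis by (simp add: algebra_simps)
qed

lemma weighted_sum_open_path:
  fixes z :: "nat \<Rightarrow> 'a"
  assumes "finite U" "inj_on z {1..k}" "z ` {1..k} \<inter> U = {}" "d \<in> U"
    and C: "\<And>T c v. c \<in> z ` {1..k} \<Longrightarrow> C (T(c := v)) = C T"
  shows "weighted_sum N x (U \<union> z ` {1..k})
      (\<lambda>T. C T * (\<Prod>j\<in>{1..<k}. of_bool (step_ok (e j) (T (z j)) (T (z (j + 1))))) *
        (if k = 0 then 1 else of_bool (step_ok s (T (z k)) (T d))))
    = weighted_sum N x U (\<lambda>T. C T * open_path s k (T d))"
proof (cases k)
  case (Suc n)
  have I: "{1..k} = insert 1 {1 + 1..1 + n}" using Suc by auto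
  have z1: "z 1 \<notin> U" using assms(3) Suc by (auto simp: disjoint_iff)
  have d: "d \<noteq> z i" if "i \<in> {1..k}" for i
    using imageI[OF that, of z] assms(3,4) by auto
  have "weighted_sum N x (U \<union> z ` {1..k})
      (\<lambda>T. C T * (\<Prod>j\<in>{1..<k}. of_bool (step_ok (e j) (T (z j)) (T (z (j + 1))))) *
        (if k = 0 then 1 else of_bool (step_ok s (T (z k)) (T d)))) =
    weighted_sum N x (insert (z 1) U \<union> z ` {1 + 1..1 + n})
      (\<lambda>T. C T * (\<Prod>j\<in>{1..<1 + n}. of_bool (step_ok (e j) (T (z j)) (T (z (j + 1))))) *
        (\<lambda>T u. of_bool (step_ok s u (T d))) T (T (z (1 + n))))"
    unfolding I using Suc by (simp add: insert_commute)
  also have "\<dots> = weighted_sum N x (insert (z 1) U)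
      (\<lambda>T. C T * path_sum ((\<lambda>T u. of_bool (step_ok s u (T d))) T) 1 n (T (z 1)))"
  proof (rule weighted_sum_path)
    show "inj_on z {1..1 + n}" using assms(2) Suc by simp
    show "z ` {1 + 1..1 + n} \<inter> insert (z 1) U = {}"
    proof -
      have "z i \<noteq> z 1" "z i \<notin> U" if "i \<in> {1 + 1..1 + n}" for i
        using inj_onD[OF assms(2), of i 1] assms(3) that Suc by (auto simp: disjoint_iff)
      then show ?thesis by blast
    qed
    fix T c v assume "c \<in> z ` {1 + 1..1 + n}"
    then obtain i where "i \<in> {1 + 1..1 + n}" and c: "c = z i" by blast
    then have i: "i \<in> {1..k}" "c = z i" using Suc by auto
    show "C (T(c := v)) = C T" using i by (intro C) auto
    show "(\<lambda>u. of_bool (step_ok s u ((T(c := v)) d)) :: 'b) = (\<lambda>u. of_bool (step_ok s u (T d)))"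
      using d[OF i(1)] i(2) by simp
  qed (use assms(1) in auto)
  also have "\<dots> = weighted_sum N x U (\<lambda>T. C T * open_path s k (T d))"
  proof -
    have "C (T(z 1 := v)) = C T" for T v using Suc by (intro C) auto
    then show ?thesis unfolding weighted_sum_insert[OF assms(1) z1]
      using d[of 1] Suc by (simp add: open_path_def sum_distrib_left algebra_simps)
  qed
  finally show ?thesis .
qed (simp add: open_path_def)

lemma weighted_sum_free_path:
  fixes z :: "nat \<Rightarrow> 'a"
  assumes "inj_on z {1..k}"
  shows "weighted_sum N x (z ` {1..k})
      (\<lambda>T. \<Prod>j\<in>{1..<k}. of_bool (step_ok (e j) (T (z j)) (T (z (j + 1))))) = free_path k"
proof (cases k)
  case (Suc n)
  have I: "{1..k} = insert 1 {1 + 1..1 + n}" using Suc by auto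
  have "weighted_sum N x (z ` {1..k})
      (\<lambda>T. \<Prod>j\<in>{1..<k}. of_bool (step_ok (e j) (T (z j)) (T (z (j + 1))))) =
    weighted_sum N x ({z 1} \<union> z ` {1 + 1..1 + n})
      (\<lambda>T. (\<lambda>_. 1) T * (\<Prod>j\<in>{1..<1 + n}. of_bool (step_ok (e j) (T (z j)) (T (z (j + 1))))) *
        (\<lambda>T u. 1) T (T (z (1 + n))))"
    unfolding I using Suc by simp
  also have "\<dots> = weighted_sum N x {z 1} (\<lambda>T. (\<lambda>_. 1) T * path_sum ((\<lambda>T u. 1) T) 1 n (T (z 1)))"
  proof (rule weighted_sum_path)
    show "inj_on z {1..1 + n}" using assms Suc by simp
    show "z ` {1 + 1..1 + n} \<inter> {z 1} = {}"
    proof -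
      have "z i \<noteq> z 1" if "i \<in> {1 + 1..1 + n}" for i
        using inj_onD[OF assms, of i 1] that Suc by auto
      then show ?thesis by blast
    qed
  qed auto
  also have "\<dots> = free_path k"
    using weighted_sum_insert[of "{}" "z 1" N x] Suc by (simp add: weighted_sum_empty free_path_def)
  finally show ?thesis .
qed (simp add: free_path_def weighted_sum_empty)

lemma weighted_sum_path_pair_between:
  fixes z y :: "nat \<Rightarrow> 'a"
  assumes "finite U" "inj_on z {1..k}" "inj_on y {1..k}" "z ` {1..k} \<inter> y ` {1..k} = {}"
    and "z ` {1..k} \<inter> U = {}" "y ` {1..k} \<inter> U = {}" "c0 \<in> U" "d \<in> U"
    and C: "\<And>T c v. c \<in> z ` {1..k} \<union> y ` {1..k} \<Longrightarrow> C (T(c := v)) = C T"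
  shows "weighted_sum N x (U \<union> z ` {1..k} \<union> y ` {1..k})
      (\<lambda>T. C T * (if k = 0 then of_bool (\<not> step_ok s (T c0) (T d)) else
          of_bool (step_ok s (T c0) (T (z 1)) \<and> \<not> step_ok s (T c0) (T (y 1))) *
          (\<Prod>j\<in>{1..<k}. of_bool (pair_step_ok s (e j) (T (z j)) (T (y j)) (T (z (j + 1))) (T (y (j + 1))))) *
          of_bool (step_ok s (T (y k)) (T d) \<and> \<not> step_ok s (T (z k)) (T d))))
    = weighted_sum N x U (\<lambda>T. C T * path_pair s k (T c0) (T d))"
proof (cases k)
  case (Suc n)
  have I: "{1..k} = insert 1 {1 + 1..1 + n}" using Suc by auto
  let ?start = "\<lambda>T. of_bool (step_ok s (T c0) (T (z 1)) \<and> \<not> step_ok s (T c0) (T (y 1))) :: 'b"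
  let ?end = "\<lambda>T u u'. of_bool (step_ok s u' (T d) \<and> \<not> step_ok s u (T d)) :: 'b"
  let ?V = "insert (y 1) (insert (z 1) U)"
  have ne: "z i \<noteq> z j" "y i \<noteq> y j" if "i \<noteq> j" "i \<in> {1..k}" "j \<in> {1..k}" for i j
    using inj_onD[OF assms(2)] inj_onD[OF assms(3)] that by metis+
  have zy: "z i \<noteq> y j" if "i \<in> {1..k}" "j \<in> {1..k}" for i j
    using imageI[OF that(1), of z] imageI[OF that(2), of y] assms(4) by (metis IntI empty_iff)
  have U: "z i \<notin> U" "y i \<notin> U" if "i \<in> {1..k}" for i
    using imageI[OF that, of z] imageI[OF that, of y] assms(5,6) by auto
  have "weighted_sum N x (U \<union> z ` {1..k} \<union> y ` {1..k})
      (\<lambda>T. C T * (if k = 0 then of_bool (\<not> step_ok s (T c0) (T d)) else ?start T *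
          (\<Prod>j\<in>{1..<k}. of_bool (pair_step_ok s (e j) (T (z j)) (T (y j)) (T (z (j + 1))) (T (y (j + 1))))) *
          ?end T (T (z k)) (T (y k)))) =
    weighted_sum N x (?V \<union> z ` {1 + 1..1 + n} \<union> y ` {1 + 1..1 + n})
      (\<lambda>T. (C T * ?start T) *
        (\<Prod>j\<in>{1..<1 + n}. of_bool (pair_step_ok s (e j) (T (z j)) (T (y j)) (T (z (j + 1))) (T (y (j + 1))))) *
        ?end T (T (z (1 + n))) (T (y (1 + n))))"
    unfolding I using Suc by (simp add: insert_commute mult.assoc)
  also have "\<dots> = weighted_sum N x ?V
      (\<lambda>T. (C T * ?start T) * pair_sum s (?end T) 1 n (T (z 1)) (T (y 1)))"
  proof (rule weighted_sum_path_pair)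
    have k: "1 + n = k" using Suc by simp
    have sub: "{1 + 1..1 + n} \<subseteq> {1..k}" using Suc by auto
    show "inj_on z {1..1 + n}" "inj_on y {1..1 + n}" "z ` {1..1 + n} \<inter> y ` {1..1 + n} = {}"
      unfolding k by (fact assms)+
    have 1: "1 \<in> {1..k}" using Suc by simp
    have "z i \<notin> ?V" "y i \<notin> ?V" if "i \<in> {1 + 1..1 + n}" for i
    proof -
      have i: "i \<in> {1..k}" "i \<noteq> 1" using that Suc by auto
      then show "z i \<notin> ?V" "y i \<notin> ?V"
        using ne[OF i(2) i(1) 1] U[OF i(1)] zy[OF i(1) 1] zy[OF 1 i(1)] by auto
    qed
    then show "z ` {1 + 1..1 + n} \<inter> ?V = {}" "y ` {1 + 1..1 + n} \<inter> ?V = {}" by blast+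
    fix T c v assume "c \<in> z ` {1 + 1..1 + n} \<union> y ` {1 + 1..1 + n}"
    then obtain i where i: "i \<in> {1 + 1..1 + n}" "c = z i \<or> c = y i" by blast
    then have i': "i \<in> {1..k}" "i \<noteq> 1" using Suc by auto
    have c: "c \<notin> U" "c \<noteq> z 1" "c \<noteq> y 1"
      using i(2) ne[OF i'(2,1) 1] U[OF i'(1)] zy[OF i'(1) 1] zy[OF 1 i'(1)] by auto
    have "C (T(c := v)) = C T" using i(2) i'(1) by (intro C) auto
    moreover have "c \<noteq> c0" "c \<noteq> d" using c assms(7,8) by auto
    ultimately show "C (T(c := v)) * ?start (T(c := v)) = C T * ?start T" "?end (T(c := v)) = ?end T"
      using c by simp_all
  qed (use assms(1) in auto)
  also have "\<dots> = weighted_sum N x U (\<lambda>T. C T * path_pair s k (T c0) (T d))"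
  proof -
    have 1: "1 \<in> {1..k}" using Suc by simp
    have fin: "finite (insert (z 1) U)" using assms(1) by simp
    have z: "z 1 \<notin> U" and y: "y 1 \<notin> insert (z 1) U" using U[OF 1] zy[OF 1 1] by auto
    have neq: "z 1 \<noteq> c0" "z 1 \<noteq> d" "y 1 \<noteq> c0" "y 1 \<noteq> d" "z 1 \<noteq> y 1"
      using U[OF 1] zy[OF 1 1] assms(7,8) by auto
    have C: "C (T(z 1 := v)) = C T" "C (T(y 1 := v)) = C T" for T v using 1 by (auto intro!: C)
    show ?thesis
      unfolding weighted_sum_insert[OF fin y] weighted_sum_insert[OF assms(1) z] C
      using neq neq[THEN not_sym] Suc by (simp add: path_pair_def sum_distrib_left algebra_simps)
  qed
  finally show ?thesis by simp
qed (simp add: path_pair_def)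

end

subsection \<open>Gluing two diagrams along a ribbon\<close>

lemma content_adjacent: "adjacent c c' \<Longrightarrow> content c' = content c + 1"
  by (auto simp: adjacent_def content_def)

definition edge_ok :: "(cell \<Rightarrow> nat) \<Rightarrow> cell \<Rightarrow> cell \<Rightarrow> bool" where
  "edge_ok T c c' \<longleftrightarrow> (T c' < T c \<longleftrightarrow> fst c' < fst c)"

lemma locally_strict_edge: "locally_strict D T \<longleftrightarrow> (\<forall>c\<in>D. \<forall>c'\<in>D. adjacent c c' \<longrightarrow> edge_ok T c c')"
  by (simp add: locally_strict_def edge_ok_def)

lemma of_bool_Ball:
  "finite A \<Longrightarrow> (of_bool (\<forall>a\<in>A. P a) :: 'b::comm_ring_1) = (\<Prod>a\<in>A. of_bool (P a))"
  by (induction A rule: finite_induct) (simp_all add: of_bool_conj del: of_bool_eq_1_iff of_bool_eq_0_iff)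

text \<open>\<open>z 1, ..., z k\<close> is the common copy of \<omega>; \<open>U1\<close> and
  \<open>U2\<close> are what the two diagrams have before and after it, with \<open>z 0\<close> and
  \<open>z (k + 1)\<close> as the only cells next to it. The equality of \<open>e 0\<close> and
  \<open>e k\<close> lets a diagonally displaced copy stay attached at both ends.\<close>

locale gluing =
  fixes U1 U2 :: diagram and z :: "nat \<Rightarrow> cell" and k :: nat and C :: int
    and e :: "nat \<Rightarrow> bool" and s :: bool
  assumes finite_U1: "finite U1" and finite_U2: "finite U2"
    and z_first: "z 0 \<in> U1" "content (z 0) = C - 1" and z_last: "z (k + 1) \<in> U2"
    and U1_content: "\<And>c. c \<in> U1 \<Longrightarrow> content c < C"
    and U1_unique: "\<And>c. c \<in> U1 \<Longrightarrow> content c = C - 1 \<Longrightarrow> c = z 0"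
    and U2_content: "\<And>c. c \<in> U2 \<Longrightarrow> C + int k \<le> content c"
    and U2_unique: "\<And>c. c \<in> U2 \<Longrightarrow> content c = C + int k \<Longrightarrow> c = z (k + 1)"
    and z_step: "\<And>j. j \<le> k \<Longrightarrow> z (j + 1) = (if e j then (fst (z j) - 1, snd (z j)) else (fst (z j), snd (z j) + 1))"
    and e_first: "e 0 = s" and e_last: "e k = s"
begin

definition shift :: "cell \<Rightarrow> cell" where
  "shift c = (if s then (fst c + 1, snd c + 1) else (fst c - 1, snd c - 1))"

abbreviation y :: "nat \<Rightarrow> cell" where "y j \<equiv> shift (z j)"

lemma content_shift: "content (shift c) = content c"
  by (simp add: shift_def content_def)

lemma bij_shift: "bij shift"
  unfolding shift_def
  by (rule bij_betw_byWitness[where f'="\<lambda>c. if s then (fst c - 1, snd c - 1) else (fst c + 1, snd c + 1)"])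
    auto

lemma shift_eq_iff: "shift c = shift c' \<longleftrightarrow> c = c'"
  by (rule inj_eq[OF bij_is_inj[OF bij_shift]])

lemma content_z: "j \<le> k + 1 \<Longrightarrow> content (z j) = C - 1 + int j"
proof (induction j)
  case (Suc j)
  then show ?case using z_step[of j] by (cases "e j"; simp add: content_def)
qed (simp add: z_first)

lemma adjacent_z: "j \<le> k \<Longrightarrow> adjacent (z j) (z (j + 1))"
  unfolding adjacent_def using z_step[of j] by (cases "e j"; simp)

lemma adjacent_y: "j \<le> k \<Longrightarrow> adjacent (y j) (y (j + 1))"
  unfolding adjacent_def shift_def using z_step[of j] by (cases "e j"; cases s; simp)

lemma edge_ok_z: "j \<le> k \<Longrightarrow> edge_ok T (z j) (z (j + 1)) \<longleftrightarrow> step_ok (e j) (T (z j)) (T (z (j + 1)))"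
  unfolding edge_ok_def step_ok_def using z_step[of j] by (cases "e j"; cases s; simp)

lemma edge_ok_y: "j \<le> k \<Longrightarrow> edge_ok T (y j) (y (j + 1)) \<longleftrightarrow> step_ok (e j) (T (y j)) (T (y (j + 1)))"
  unfolding edge_ok_def step_ok_def shift_def using z_step[of j] by (cases "e j"; cases s; simp)

text \<open>Between consecutive diagonals the two copies touch in exactly one way:
  \<open>z j\<close> meets \<open>y (j + 1)\<close> if the step has direction \<open>s\<close>,
  otherwise \<open>y j\<close> meets \<open>z (j + 1)\<close>. The contact runs in the direction
  opposite to \<open>e j\<close>, hence the negated \<open>step_ok\<close> below.\<close>

lemma adjacent_zy: "j \<le> k \<Longrightarrow> adjacent (z j) (y (j + 1)) \<longleftrightarrow> e j = s"
  unfolding adjacent_def shift_def using z_step[of j] by (cases "e j"; cases s; simp add: prod_eq_iff)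

lemma edge_ok_zy:
  "j \<le> k \<Longrightarrow> e j = s \<Longrightarrow> edge_ok T (z j) (y (j + 1)) \<longleftrightarrow> \<not> step_ok s (T (z j)) (T (y (j + 1)))"
  unfolding edge_ok_def step_ok_def shift_def using z_step[of j] by (cases "e j"; cases s; simp)

lemma adjacent_yz: "j \<le> k \<Longrightarrow> adjacent (y j) (z (j + 1)) \<longleftrightarrow> e j \<noteq> s"
  unfolding adjacent_def shift_def using z_step[of j] by (cases "e j"; cases s; simp add: prod_eq_iff)

lemma edge_ok_yz:
  "j \<le> k \<Longrightarrow> e j \<noteq> s \<Longrightarrow> edge_ok T (y j) (z (j + 1)) \<longleftrightarrow> \<not> step_ok (e j) (T (y j)) (T (z (j + 1)))"
  unfolding edge_ok_def step_ok_def shift_def using z_step[of j] by (cases "e j"; cases s; simp)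

lemma z_eq_iff: "i \<le> k + 1 \<Longrightarrow> j \<le> k + 1 \<Longrightarrow> z i = z j \<longleftrightarrow> i = j"
  using content_z[of i] content_z[of j] by (metis add_left_cancel of_nat_eq_iff)

lemma z_neq_y: "i \<le> k + 1 \<Longrightarrow> j \<le> k + 1 \<Longrightarrow> z i \<noteq> y j"
proof
  assume ij: "i \<le> k + 1" "j \<le> k + 1" and eq: "z i = y j"
  then have "content (z i) = content (z j)" by (simp add: content_shift)
  then have "i = j" using ij content_z by simp
  then show False using eq by (auto simp: shift_def prod_eq_iff split: if_splits)
qed

lemma z_imageD:
  assumes "c \<in> z ` {1..k}"
  shows "C \<le> content c" "content c < C + int k" "\<And>j. content c = C - 1 + int j \<Longrightarrow> c = z j"
proof -
  obtain i where i: "i \<in> {1..k}" "c = z i" using assms by blast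
  then show "C \<le> content c" "content c < C + int k" "\<And>j. content c = C - 1 + int j \<Longrightarrow> c = z j"
    using content_z[of i] by auto
qed

lemma y_imageD:
  assumes "c \<in> y ` {1..k}"
  shows "C \<le> content c" "content c < C + int k" "\<And>j. content c = C - 1 + int j \<Longrightarrow> c = y j"
proof -
  obtain i where i: "i \<in> {1..k}" "c = y i" using assms by blast
  then show "C \<le> content c" "content c < C + int k" "\<And>j. content c = C - 1 + int j \<Longrightarrow> c = y j"
    using content_z[of i] content_shift[of "z i"] by auto
qed

lemma shift_U2_content: "c \<in> shift ` U2 \<Longrightarrow> C + int k \<le> content c"
  and shift_U2_unique: "c \<in> shift ` U2 \<Longrightarrow> content c = C + int k \<Longrightarrow> c = y (k + 1)"
proof -
  assume "c \<in> shift ` U2"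
  then obtain c0 where c0: "c0 \<in> U2" "c = shift c0" by blast
  then show "C + int k \<le> content c" using U2_content[OF c0(1)] content_shift by simp
  show "content c = C + int k \<Longrightarrow> c = y (k + 1)" using U2_unique[OF c0(1)] content_shift c0(2) by simp
qed

lemma disjoint_cells:
  "z ` {1..k} \<inter> U1 = {}" "z ` {1..k} \<inter> U2 = {}" "z ` {1..k} \<inter> shift ` U2 = {}"
  "y ` {1..k} \<inter> U1 = {}" "y ` {1..k} \<inter> shift ` U2 = {}" "U1 \<inter> U2 = {}" "U1 \<inter> shift ` U2 = {}"
  "z ` {1..k} \<inter> y ` {1..k} = {}"
proof -
  have disj: "A \<inter> B = {}" "B \<inter> A = {}"
    if "\<And>c. c \<in> A \<Longrightarrow> content c < m" "\<And>c. c \<in> B \<Longrightarrow> m \<le> content c" for A B m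
  proof -
    { fix c assume "c \<in> A" "c \<in> B"
      then have False using that(1)[of c] that(2)[of c] by simp }
    then show "A \<inter> B = {}" "B \<inter> A = {}" by blast+
  qed
  show "z ` {1..k} \<inter> U1 = {}" by (rule disj(2)[OF U1_content z_imageD(1)])
  show "y ` {1..k} \<inter> U1 = {}" by (rule disj(2)[OF U1_content y_imageD(1)])
  have C: "C \<le> m" if "C + int k \<le> m" for m using that by simp
  show "U1 \<inter> U2 = {}" by (rule disj(1)[OF U1_content C[OF U2_content]])
  show "U1 \<inter> shift ` U2 = {}" by (rule disj(1)[OF U1_content C[OF shift_U2_content]])
  show "z ` {1..k} \<inter> U2 = {}" by (rule disj(1)[OF z_imageD(2) U2_content])
  show "z ` {1..k} \<inter> shift ` U2 = {}" by (rule disj(1)[OF z_imageD(2) shift_U2_content])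
  show "y ` {1..k} \<inter> shift ` U2 = {}" by (rule disj(1)[OF y_imageD(2) shift_U2_content])
  have "z i \<noteq> y j" if "i \<in> {1..k}" "j \<in> {1..k}" for i j
    using z_neq_y[of i j] that by auto
  then show "z ` {1..k} \<inter> y ` {1..k} = {}" by blast
qed

lemma locally_strict_lower:
  "locally_strict (U1 \<union> z ` {1..k}) T \<longleftrightarrow>
    locally_strict U1 T \<and> (\<forall>j\<in>{0..<k}. step_ok (e j) (T (z j)) (T (z (j + 1))))" (is "?L \<longleftrightarrow> ?R")
proof
  assume L: ?L
  have "step_ok (e j) (T (z j)) (T (z (j + 1)))" if "j \<in> {0..<k}" for j
  proof -
    have "z j \<in> U1 \<union> z ` {1..k}" "z (j + 1) \<in> U1 \<union> z ` {1..k}"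
      using that z_first(1) by (cases j; auto)+
    then show ?thesis using L adjacent_z[of j] edge_ok_z[of j T] that by (auto simp: locally_strict_edge)
  qed
  then show ?R using L by (auto simp: locally_strict_edge)
next
  assume R: ?R
  show ?L unfolding locally_strict_edge
  proof (intro ballI impI)
    fix c c' assume c: "c \<in> U1 \<union> z ` {1..k}" "c' \<in> U1 \<union> z ` {1..k}" and adj: "adjacent c c'"
    note ct = content_adjacent[OF adj]
    show "edge_ok T c c'"
    proof (cases "c' \<in> U1")
      case True
      then have "c \<in> U1" using c(1) U1_content[OF True] ct z_imageD(1)[of c] by auto
      then show ?thesis using R True adj by (auto simp: locally_strict_edge)
    next
      case False
      then obtain i where i: "i \<in> {1..k}" "c' = z i" using c by auto
      then obtain j where j: "i = j + 1" by (cases i) auto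
      then have ci: "content c = C - 1 + int j" using ct content_z[of i] i by auto
      have "c = z j"
        using c(1) U1_content[of c] U1_unique[of c] ci z_imageD(3)[of c j] by (cases "j = 0") auto
      then show ?thesis using R i j edge_ok_z[of j T] by auto
    qed
  qed
qed

lemma locally_strict_upper:
  "locally_strict (U2 \<union> z ` {1..k}) T \<longleftrightarrow>
    locally_strict U2 T \<and> (\<forall>j\<in>{1..k}. step_ok (e j) (T (z j)) (T (z (j + 1))))" (is "?L \<longleftrightarrow> ?R")
proof
  assume L: ?L
  have "step_ok (e j) (T (z j)) (T (z (j + 1)))" if "j \<in> {1..k}" for j
  proof -
    have "z j \<in> U2 \<union> z ` {1..k}" "z (j + 1) \<in> U2 \<union> z ` {1..k}"
      using that z_last by (auto, cases "j = k", auto)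
    then show ?thesis using L adjacent_z[of j] edge_ok_z[of j T] that by (auto simp: locally_strict_edge)
  qed
  then show ?R using L by (auto simp: locally_strict_edge)
next
  assume R: ?R
  show ?L unfolding locally_strict_edge
  proof (intro ballI impI)
    fix c c' assume c: "c \<in> U2 \<union> z ` {1..k}" "c' \<in> U2 \<union> z ` {1..k}" and adj: "adjacent c c'"
    note ct = content_adjacent[OF adj]
    show "edge_ok T c c'"
    proof (cases "c \<in> U2")
      case True
      then have "c' \<in> U2" using c(2) U2_content[OF True] ct z_imageD(2)[of c'] by auto
      then show ?thesis using R True adj by (auto simp: locally_strict_edge)
    next
      case False
      then obtain i where i: "i \<in> {1..k}" "c = z i" using c by auto
      then have ci: "content c' = C - 1 + int (i + 1)" using ct content_z[of i] by auto
      have "c' = z (i + 1)"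
        using c(2) U2_content[of c'] U2_unique[of c'] ci z_imageD(3)[of c' "i + 1"] i(1)
        by (cases "i = k") auto
      then show ?thesis using R i edge_ok_z[of i T] by auto
    qed
  qed
qed

lemma locally_strict_middle:
  "locally_strict (z ` {1..k}) T \<longleftrightarrow> (\<forall>j\<in>{1..<k}. step_ok (e j) (T (z j)) (T (z (j + 1))))" (is "?L \<longleftrightarrow> ?R")
proof
  assume L: ?L
  show ?R
  proof
    fix j assume "j \<in> {1..<k}"
    then have "z j \<in> z ` {1..k}" "z (j + 1) \<in> z ` {1..k}" "j \<le> k" by auto
    then show "step_ok (e j) (T (z j)) (T (z (j + 1)))"
      using L adjacent_z[of j] edge_ok_z[of j T] unfolding locally_strict_edge by blast
  qed
next
  assume R: ?R
  show ?L unfolding locally_strict_edge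
  proof (intro ballI impI)
    fix c c' assume c: "c \<in> z ` {1..k}" "c' \<in> z ` {1..k}" and adj: "adjacent c c'"
    then obtain i i' where i: "i \<in> {1..k}" "c = z i" "i' \<in> {1..k}" "c' = z i'" by auto
    then have "i' = i + 1" using content_adjacent[OF adj] content_z[of i] content_z[of i'] by auto
    then show "edge_ok T c c'" using R i edge_ok_z[of i T] by auto
  qed
qed

lemma locally_strict_amalgam:
  "locally_strict (U1 \<union> U2 \<union> z ` {1..k}) T \<longleftrightarrow> locally_strict U1 T \<and> locally_strict U2 T \<and>
    (\<forall>j\<in>{0..k}. step_ok (e j) (T (z j)) (T (z (j + 1))))" (is "?L \<longleftrightarrow> ?R")
proof
  let ?V = "U1 \<union> U2 \<union> z ` {1..k}"
  assume L: ?L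
  have V: "z j \<in> ?V" if "j \<le> k + 1" for j
    using that z_first z_last by (cases "j = 0"; cases "j = k + 1") auto
  have "step_ok (e j) (T (z j)) (T (z (j + 1)))" if "j \<in> {0..k}" for j
  proof -
    have "z j \<in> ?V" "z (j + 1) \<in> ?V" "j \<le> k" using that V[of j] V[of "j + 1"] by simp_all
    then show ?thesis using L adjacent_z[of j] edge_ok_z[of j T] unfolding locally_strict_edge by blast
  qed
  then show ?R using L by (auto simp: locally_strict_edge)
next
  assume R: ?R
  show ?L unfolding locally_strict_edge
  proof (intro ballI impI)
    fix c c' assume c: "c \<in> U1 \<union> U2 \<union> z ` {1..k}" "c' \<in> U1 \<union> U2 \<union> z ` {1..k}" and adj: "adjacent c c'"
    note ct = content_adjacent[OF adj]
    consider (a) "content c' < C" | (b) "C + int k \<le> content c" | (c) "C - 1 \<le> content c" "content c < C + int k"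
      using ct by linarith
    then show "edge_ok T c c'"
    proof cases
      case a
      then have "c \<in> U1" "c' \<in> U1"
        using c ct U2_content[of c] U2_content[of c'] z_imageD(1)[of c] z_imageD(1)[of c'] by auto
      then show ?thesis using R adj by (auto simp: locally_strict_edge)
    next
      case b
      then have "c \<in> U2" "c' \<in> U2"
        using c ct U1_content[of c] U1_content[of c'] z_imageD(2)[of c] z_imageD(2)[of c'] by auto
      then show ?thesis using R adj by (auto simp: locally_strict_edge)
    next
      case c': c
      define j where "j = nat (content c - C + 1)"
      have j: "j \<le> k" "content c = C - 1 + int j" using c' by (auto simp: j_def)
      have "c = z j"
        using c(1) j U1_content[of c] U1_unique[of c] U2_content[of c] z_imageD(3)[of c j] c'
        by (cases "j = 0") auto
      moreover have "c' = z (j + 1)"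
        using c(2) j ct U1_content[of c'] U2_unique[of c'] U2_content[of c'] z_imageD(3)[of c' "j + 1"]
        by (cases "j = k") auto
      ultimately show ?thesis using R j edge_ok_z[of j T] by auto
    qed
  qed
qed

text \<open>\<open>y 0\<close> and \<open>z (k + 1)\<close> are not cells of the projection, whence
  the restrictions \<open>1 \<le> j\<close> and \<open>j < k\<close>. Because of
  \<open>e 0 = e k = s\<close>, the contacts at the two ends are those of \<open>z 0\<close> with
  \<open>y 1\<close> and of \<open>z k\<close> with \<open>y (k + 1)\<close>, all of which are
  present.\<close>

lemma locally_strict_projection:
  "locally_strict (U1 \<union> shift ` U2 \<union> z ` {1..k} \<union> y ` {1..k}) T \<longleftrightarrow>
    locally_strict U1 T \<and> locally_strict (shift ` U2) T \<and>
    (\<forall>j\<in>{0..k}. (j < k \<longrightarrow> step_ok (e j) (T (z j)) (T (z (j + 1)))) \<and>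
      (1 \<le> j \<longrightarrow> step_ok (e j) (T (y j)) (T (y (j + 1)))) \<and>
      (if e j = s then \<not> step_ok (e j) (T (z j)) (T (y (j + 1)))
       else \<not> step_ok (e j) (T (y j)) (T (z (j + 1)))))" (is "?L \<longleftrightarrow> ?R")
proof
  let ?V = "U1 \<union> shift ` U2 \<union> z ` {1..k} \<union> y ` {1..k}"
  assume L: ?L
  have z: "z j \<in> ?V" if "j \<le> k" for j
    using that z_first by (cases "j = 0") auto
  have y: "y j \<in> ?V" if "1 \<le> j" "j \<le> k + 1" for j
    using that z_last by (cases "j = k + 1") auto
  have edge: "edge_ok T c c'" if "c \<in> ?V" "c' \<in> ?V" "adjacent c c'" for c c'
    using L that unfolding locally_strict_edge by blast
  have "(j < k \<longrightarrow> step_ok (e j) (T (z j)) (T (z (j + 1)))) \<and>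
      (1 \<le> j \<longrightarrow> step_ok (e j) (T (y j)) (T (y (j + 1)))) \<and>
      (if e j = s then \<not> step_ok (e j) (T (z j)) (T (y (j + 1)))
       else \<not> step_ok (e j) (T (y j)) (T (z (j + 1))))" if "j \<in> {0..k}" for j
  proof (intro conjI impI)
    have j: "j \<le> k" using that by simp
    show "step_ok (e j) (T (z j)) (T (z (j + 1)))" if "j < k"
      using edge[OF z[of j] z[of "j + 1"] adjacent_z[OF j]] edge_ok_z[OF j] that by auto
    show "step_ok (e j) (T (y j)) (T (y (j + 1)))" if "1 \<le> j"
      using edge[OF y[of j] y[of "j + 1"] adjacent_y[OF j]] edge_ok_y[OF j] that j by auto
    have "j \<noteq> 0" "j \<noteq> k" if "e j \<noteq> s" using that e_first e_last by metis+
    then show "if e j = s then \<not> step_ok (e j) (T (z j)) (T (y (j + 1)))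
       else \<not> step_ok (e j) (T (y j)) (T (z (j + 1)))"
      using edge[OF z[of j] y[of "j + 1"]] adjacent_zy[OF j] edge_ok_zy[OF j, of T]
        edge[OF y[of j] z[of "j + 1"]] adjacent_yz[OF j] edge_ok_yz[OF j, of T] j by auto
  qed
  moreover have "locally_strict U1 T" "locally_strict (shift ` U2) T"
    using L unfolding locally_strict_edge by blast+
  ultimately show ?R by blast
next
  assume R: ?R
  show ?L unfolding locally_strict_edge
  proof (intro ballI impI)
    fix c c' assume c: "c \<in> U1 \<union> shift ` U2 \<union> z ` {1..k} \<union> y ` {1..k}"
        "c' \<in> U1 \<union> shift ` U2 \<union> z ` {1..k} \<union> y ` {1..k}" and adj: "adjacent c c'"
    note ct = content_adjacent[OF adj]
    consider (a) "content c' < C" | (b) "C + int k \<le> content c" | (c) "C - 1 \<le> content c" "content c < C + int k"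
      using ct by linarith
    then show "edge_ok T c c'"
    proof cases
      case a
      then have a': "content c < C" using ct by simp
      have "d \<in> U1" if "d \<in> U1 \<union> shift ` U2 \<union> z ` {1..k} \<union> y ` {1..k}" "content d < C" for d
        using that(1)
      proof (elim UnE)
        assume "d \<in> shift ` U2" then show ?thesis using shift_U2_content[of d] that(2) by simp
      next
        assume "d \<in> z ` {1..k}" then show ?thesis using z_imageD(1) that(2) by fastforce
      next
        assume "d \<in> y ` {1..k}" then show ?thesis using y_imageD(1) that(2) by fastforce
      qed
      then have "c \<in> U1" "c' \<in> U1" using c a a' by blast+
      then show ?thesis using R adj unfolding locally_strict_edge by blast
    next
      case b
      then have b': "C + int k \<le> content c'" using ct by simp
      have "d \<in> shift ` U2" if "d \<in> U1 \<union> shift ` U2 \<union> z ` {1..k} \<union> y ` {1..k}" "C + int k \<le> content d" for d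
        using that(1)
      proof (elim UnE)
        assume "d \<in> U1" then show ?thesis using U1_content[of d] that(2) by simp
      next
        assume "d \<in> z ` {1..k}" then show ?thesis using z_imageD(2) that(2) by fastforce
      next
        assume "d \<in> y ` {1..k}" then show ?thesis using y_imageD(2) that(2) by fastforce
      qed
      then have "c \<in> shift ` U2" "c' \<in> shift ` U2" using c b b' by blast+
      then show ?thesis using R adj unfolding locally_strict_edge by blast
    next
      case c': c
      define j where "j = nat (content c - C + 1)"
      have j: "j \<le> k" "content c = C - 1 + int j" using c' by (auto simp: j_def)
      have 1: "c = z j \<or> c = y j \<and> 1 \<le> j" using c(1)
      proof (elim UnE)
        assume "c \<in> U1"
        then have "j = 0" using U1_content[of c] j by simp
        then show ?thesis using U1_unique[OF \<open>c \<in> U1\<close>] j by simp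
      next
        assume "c \<in> shift ` U2" then show ?thesis using shift_U2_content[of c] j c' by simp
      next
        assume "c \<in> z ` {1..k}" then show ?thesis using z_imageD(3)[of c j] j by simp
      next
        assume "c \<in> y ` {1..k}" then show ?thesis using y_imageD(1)[of c] y_imageD(3)[of c j] j by linarith
      qed
      have 2: "c' = z (j + 1) \<and> j < k \<or> c' = y (j + 1)" using c(2)
      proof (elim UnE)
        assume "c' \<in> U1" then show ?thesis using U1_content[of c'] j ct by simp
      next
        assume c': "c' \<in> shift ` U2"
        then have "j = k" using shift_U2_content[of c'] j ct by simp
        then show ?thesis using shift_U2_unique[OF c'] j ct by simp
      next
        assume "c' \<in> z ` {1..k}" then show ?thesis using z_imageD(2)[of c'] z_imageD(3)[of c' "j + 1"] j ct by simp
      next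
        assume "c' \<in> y ` {1..k}" then show ?thesis using y_imageD(3)[of c' "j + 1"] j ct by simp
      qed
      have Rj: "(j < k \<longrightarrow> step_ok (e j) (T (z j)) (T (z (j + 1)))) \<and>
        (1 \<le> j \<longrightarrow> step_ok (e j) (T (y j)) (T (y (j + 1)))) \<and>
        (if e j = s then \<not> step_ok (e j) (T (z j)) (T (y (j + 1)))
         else \<not> step_ok (e j) (T (y j)) (T (z (j + 1))))"
      proof -
        have "j \<in> {0..k}" using j(1) by simp
        then show ?thesis using R by blast
      qed
      from 1 2 consider "c = z j" "c' = z (j + 1)" "j < k" | "c = y j" "1 \<le> j" "c' = y (j + 1)"
        | "c = z j" "c' = y (j + 1)" | "c = y j" "c' = z (j + 1)" by blast
      then show ?thesis
      proof cases
        case 1 then show ?thesis unfolding 1(1,2) edge_ok_z[OF j(1)] using Rj by blast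
      next
        case 2 then show ?thesis unfolding 2(1,3) edge_ok_y[OF j(1)] using Rj by blast
      next
        case 3
        then have ejs: "e j = s" using adj adjacent_zy[OF j(1)] by blast
        show ?thesis unfolding 3 edge_ok_zy[OF j(1) ejs] using Rj ejs by presburger
      next
        case 4
        then have ejs: "e j \<noteq> s" using adj adjacent_yz[OF j(1)] by blast
        show ?thesis unfolding 4 edge_ok_yz[OF j(1) ejs] using Rj ejs by presburger
      qed
    qed
  qed
qed

lemma inj_on_cells: "inj_on z {0..k + 1}" "inj_on y {0..k + 1}"
proof -
  show z: "inj_on z {0..k + 1}" using z_eq_iff by (intro inj_onI) simp
  show "inj_on y {0..k + 1}" using z_eq_iff by (intro inj_onI) (simp add: shift_eq_iff)
qed

text \<open>The fillings of the two sides are independent and meet only in \<open>G\<close>, a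
  function of the two values next to the ribbon. All terms of the gluing identity take this form, so
  it suffices to compare the functions \<open>G\<close>.\<close>

definition double_sum ::
  "nat \<Rightarrow> (nat \<Rightarrow> 'b::comm_ring_1) \<Rightarrow> diagram \<Rightarrow> cell \<Rightarrow> (nat \<Rightarrow> nat \<Rightarrow> 'b) \<Rightarrow> 'b" where
  "double_sum N x B d G = weighted_sum N x U1 (\<lambda>T. of_bool (locally_strict U1 T) *
     weighted_sum N x B (\<lambda>T'. of_bool (locally_strict B T') * G (T (z 0)) (T' d)))"

lemma weighted_sum_double_sum:
  assumes "finite B" "U1 \<inter> B = {}" "d \<in> B"
  shows "weighted_sum N x (U1 \<union> B)
      (\<lambda>T. of_bool (locally_strict U1 T \<and> locally_strict B T) * G (T (z 0)) (T d)) = double_sum N x B d G"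
proof -
  have cong: "locally_strict D T \<longleftrightarrow> locally_strict D T'" if "\<And>c. c \<in> D \<Longrightarrow> T c = T' c" for D T T'
    using that unfolding locally_strict_def by simp
  show ?thesis
    unfolding double_sum_def weighted_sum_union[OF finite_U1 assms(1,2)] weighted_sum_scale[symmetric]
  proof (intro weighted_sum_cong)
    fix T T' assume T: "T \<in> maps N U1" "T' \<in> maps N B"
    have 1: "T c + T' c = T c" if "c \<in> U1" for c
      using that assms(2) maps_outside[OF T(2), of c] by auto
    have 2: "T c + T' c = T' c" if "c \<in> B" for c
      using that assms(2) maps_outside[OF T(1), of c] by auto
    have "locally_strict U1 (\<lambda>c. T c + T' c) \<longleftrightarrow> locally_strict U1 T"
      "locally_strict B (\<lambda>c. T c + T' c) \<longleftrightarrow> locally_strict B T'"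
      by (intro cong 1, assumption) (intro cong 2, assumption)
    then show "of_bool (locally_strict U1 (\<lambda>c. T c + T' c) \<and> locally_strict B (\<lambda>c. T c + T' c)) *
        G (T (z 0) + T' (z 0)) (T d + T' d) =
      of_bool (locally_strict U1 T) * (of_bool (locally_strict B T') * G (T (z 0)) (T' d))"
      using 1[OF z_first(1)] 2[OF assms(3)] by (simp add: of_bool_conj mult.assoc)
  qed
qed

lemma double_sum_shift: "double_sum N x (shift ` U2) (y (k + 1)) G = double_sum N x U2 (z (k + 1)) G"
proof -
  have inv: "inv shift (shift c) = c" for c by (rule inv_f_f[OF bij_is_inj[OF bij_shift]])
  have "adjacent (shift c) (shift c') \<longleftrightarrow> adjacent c c'" "fst (shift c') < fst (shift c) \<longleftrightarrow> fst c' < fst c" for c c'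
    by (auto simp: adjacent_def shift_def prod_eq_iff)
  then have "locally_strict (shift ` U2) (T \<circ> inv shift) \<longleftrightarrow> locally_strict U2 T" for T
    unfolding locally_strict_def ball_simps comp_def inv by simp
  then show ?thesis unfolding double_sum_def weighted_sum_image[OF bij_shift] by (simp add: inv)
qed

lemma double_sum_mult:
  "weighted_sum N x U1 (\<lambda>T. of_bool (locally_strict U1 T) * F (T (z 0))) *
   weighted_sum N x U2 (\<lambda>T. of_bool (locally_strict U2 T) * G (T (z (k + 1)))) =
   double_sum N x U2 (z (k + 1)) (\<lambda>p q. F p * G q)"
proof -
  let ?S = "weighted_sum N x U2 (\<lambda>T. of_bool (locally_strict U2 T) * G (T (z (k + 1))))"
  have "weighted_sum N x U2 (\<lambda>T'. of_bool (locally_strict U2 T') * (a * G (T' (z (k + 1))))) = a * ?S" for a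
    unfolding weighted_sum_scale[symmetric] by (simp add: algebra_simps)
  then have "double_sum N x U2 (z (k + 1)) (\<lambda>p q. F p * G q) =
      weighted_sum N x U1 (\<lambda>T. ?S * (of_bool (locally_strict U1 T) * F (T (z 0))))"
    unfolding double_sum_def by (simp add: algebra_simps)
  then show ?thesis unfolding weighted_sum_scale by (simp add: mult.commute)
qed

lemma locally_strict_upd: "c \<notin> D \<Longrightarrow> locally_strict D (T(c := v)) \<longleftrightarrow> locally_strict D T"
proof -
  assume "c \<notin> D"
  then have "(T(c := v)) d = T d" if "d \<in> D" for d using that by auto
  then show ?thesis unfolding locally_strict_def by simp
qed

lemma schur_lower:
  "schur N x (U1 \<union> z ` {1..k}) =
    weighted_sum N x U1 (\<lambda>T. of_bool (locally_strict U1 T) * path_sum N x e (\<lambda>_. 1) 0 k (T (z 0)))"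
proof -
  have "schur N x (U1 \<union> z ` {1..k}) = weighted_sum N x (U1 \<union> z ` {0 + 1..0 + k})
      (\<lambda>T. of_bool (locally_strict U1 T) *
        (\<Prod>j\<in>{0..<0 + k}. of_bool (step_ok (e j) (T (z j)) (T (z (j + 1))))) * (\<lambda>T u. 1) T (T (z (0 + k))))"
    unfolding schur_def locally_strict_lower of_bool_conj by (simp add: of_bool_Ball)
  also have "\<dots> = weighted_sum N x U1
      (\<lambda>T. of_bool (locally_strict U1 T) * path_sum N x e ((\<lambda>T u. 1) T) 0 k (T (z 0)))"
  proof (rule weighted_sum_path)
    show "inj_on z {0..0 + k}" by (rule inj_on_subset[OF inj_on_cells(1)]) auto
    fix T c v assume "c \<in> z ` {0 + 1..0 + k}"
    then have "c \<notin> U1" using disjoint_cells(1) by auto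
    then show "(of_bool (locally_strict U1 (T(c := v))) :: 'a) = of_bool (locally_strict U1 T)"
      by (simp add: locally_strict_upd)
  qed (use finite_U1 z_first disjoint_cells(1) in simp_all)
  finally show ?thesis .
qed

lemma schur_upper:
  "schur N x (U2 \<union> z ` {1..k}) =
    weighted_sum N x U2 (\<lambda>T. of_bool (locally_strict U2 T) * open_path N x e s k (T (z (k + 1))))"
proof -
  have ball: "(\<forall>j\<in>{1..k}. P j) \<longleftrightarrow> (\<forall>j\<in>{1..<k}. P j) \<and> (k = 0 \<or> P k)" for P
  proof (cases "k = 0")
    case False
    then have "{1..k} = insert k {1..<k}" by auto
    then show ?thesis using False by auto
  qed simp
  have "schur N x (U2 \<union> z ` {1..k}) = weighted_sum N x (U2 \<union> z ` {1..k})
      (\<lambda>T. of_bool (locally_strict U2 T) *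
        (\<Prod>j\<in>{1..<k}. of_bool (step_ok (e j) (T (z j)) (T (z (j + 1))))) *
        (if k = 0 then 1 else of_bool (step_ok s (T (z k)) (T (z (k + 1))))))"
    unfolding schur_def locally_strict_upper ball of_bool_conj
    by (intro weighted_sum_cong) (simp add: of_bool_Ball e_last)
  also have "\<dots> = weighted_sum N x U2
      (\<lambda>T. of_bool (locally_strict U2 T) * open_path N x e s k (T (z (k + 1))))"
  proof (rule weighted_sum_open_path)
    show "inj_on z {1..k}" by (rule inj_on_subset[OF inj_on_cells(1)]) auto
    fix T c v assume "c \<in> z ` {1..k}"
    then have "c \<notin> U2" using disjoint_cells(2) by auto
    then show "(of_bool (locally_strict U2 (T(c := v))) :: 'a) = of_bool (locally_strict U2 T)"
      by (simp add: locally_strict_upd)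
  qed (use finite_U2 z_last disjoint_cells(2) in simp_all)
  finally show ?thesis .
qed

lemma schur_middle: "schur N x (z ` {1..k}) = free_path N x e k"
proof -
  have "inj_on z {1..k}" by (rule inj_on_subset[OF inj_on_cells(1)]) auto
  then show ?thesis unfolding schur_def locally_strict_middle
    by (simp only: of_bool_Ball weighted_sum_free_path finite_atLeastLessThan)
qed

lemma schur_amalgam:
  "schur N x (U1 \<union> U2 \<union> z ` {1..k}) = double_sum N x U2 (z (k + 1))
    (\<lambda>p q. path_sum N x e (\<lambda>u. of_bool (step_ok s u q)) 0 k p)"
proof -
  have ball: "(\<forall>j\<in>{0..k}. P j) \<longleftrightarrow> (\<forall>j\<in>{0..<k}. P j) \<and> P k" for P
  proof -
    have "{0..k} = insert k {0..<k}" by auto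
    then show ?thesis by auto
  qed
  have "schur N x (U1 \<union> U2 \<union> z ` {1..k}) = weighted_sum N x (U1 \<union> U2 \<union> z ` {0 + 1..0 + k})
      (\<lambda>T. of_bool (locally_strict U1 T \<and> locally_strict U2 T) *
        (\<Prod>j\<in>{0..<0 + k}. of_bool (step_ok (e j) (T (z j)) (T (z (j + 1))))) *
        (\<lambda>T u. of_bool (step_ok s u (T (z (k + 1))))) T (T (z (0 + k))))"
    unfolding schur_def locally_strict_amalgam ball of_bool_conj
    by (simp add: of_bool_Ball e_last mult.assoc)
  also have "\<dots> = weighted_sum N x (U1 \<union> U2) (\<lambda>T. of_bool (locally_strict U1 T \<and> locally_strict U2 T) *
      path_sum N x e ((\<lambda>T u. of_bool (step_ok s u (T (z (k + 1))))) T) 0 k (T (z 0)))"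
  proof (rule weighted_sum_path)
    show "inj_on z {0..0 + k}" by (rule inj_on_subset[OF inj_on_cells(1)]) auto
    show "z ` {0 + 1..0 + k} \<inter> (U1 \<union> U2) = {}" using disjoint_cells(1,2) by auto
    fix T c v assume c: "c \<in> z ` {0 + 1..0 + k}"
    then have c': "c \<notin> U1" "c \<notin> U2" using disjoint_cells(1,2) by auto
    then show "(of_bool (locally_strict U1 (T(c := v)) \<and> locally_strict U2 (T(c := v))) :: 'a) =
        of_bool (locally_strict U1 T \<and> locally_strict U2 T)"
      by (simp add: locally_strict_upd)
    have "c \<noteq> z (k + 1)" using c' z_last by auto
    then show "(\<lambda>u. of_bool (step_ok s u ((T(c := v)) (z (k + 1)))) :: 'a) =
        (\<lambda>u. of_bool (step_ok s u (T (z (k + 1)))))" by simp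
  qed (use finite_U1 finite_U2 z_first in simp_all)
  also have "\<dots> = double_sum N x U2 (z (k + 1))
      (\<lambda>p q. path_sum N x e (\<lambda>u. of_bool (step_ok s u q)) 0 k p)"
    by (rule weighted_sum_double_sum[OF finite_U2 disjoint_cells(6) z_last])
  finally show ?thesis .
qed

lemma schur_projection:
  "schur N x (U1 \<union> shift ` U2 \<union> z ` {1..k} \<union> y ` {1..k}) = double_sum N x U2 (z (k + 1))
    (\<lambda>p q. path_pair N x e s k p q)"
proof -
  let ?pair = "\<lambda>T j. pair_step_ok s (e j) (T (z j)) (T (y j)) (T (z (j + 1))) (T (y (j + 1)))"
  let ?ends = "\<lambda>T. if k = 0 then \<not> step_ok s (T (z 0)) (T (y (k + 1))) else
    (step_ok s (T (z 0)) (T (z 1)) \<and> \<not> step_ok s (T (z 0)) (T (y 1))) \<and>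
    (\<forall>j\<in>{1..<k}. ?pair T j) \<and>
    (step_ok s (T (y k)) (T (y (k + 1))) \<and> \<not> step_ok s (T (z k)) (T (y (k + 1))))"
  have ball: "(\<forall>j\<in>{0..k}. P j) \<longleftrightarrow> P 0 \<and> (\<forall>j\<in>{1..<k}. P j) \<and> P k" for P
  proof -
    have "{0..k} = insert 0 (insert k {1..<k})" by auto
    then show ?thesis by auto
  qed
  have cond: "(\<forall>j\<in>{0..k}. (j < k \<longrightarrow> step_ok (e j) (T (z j)) (T (z (j + 1)))) \<and>
      (1 \<le> j \<longrightarrow> step_ok (e j) (T (y j)) (T (y (j + 1)))) \<and>
      (if e j = s then \<not> step_ok (e j) (T (z j)) (T (y (j + 1)))
       else \<not> step_ok (e j) (T (y j)) (T (z (j + 1))))) \<longleftrightarrow> ?ends T" for T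
    unfolding ball pair_step_ok_def e_first e_last by (cases "k = 0") auto
  have "schur N x (U1 \<union> shift ` U2 \<union> z ` {1..k} \<union> y ` {1..k}) =
    weighted_sum N x (U1 \<union> shift ` U2 \<union> z ` {1..k} \<union> y ` {1..k})
      (\<lambda>T. of_bool (locally_strict U1 T \<and> locally_strict (shift ` U2) T) *
        (if k = 0 then of_bool (\<not> step_ok s (T (z 0)) (T (y (k + 1)))) else
          of_bool (step_ok s (T (z 0)) (T (z 1)) \<and> \<not> step_ok s (T (z 0)) (T (y 1))) *
          (\<Prod>j\<in>{1..<k}. of_bool (?pair T j)) *
          of_bool (step_ok s (T (y k)) (T (y (k + 1))) \<and> \<not> step_ok s (T (z k)) (T (y (k + 1))))))"
    unfolding schur_def locally_strict_projection cond
    by (intro weighted_sum_cong)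
      (simp only: of_bool_Ball[symmetric] of_bool_conj finite_atLeastLessThan mult.assoc split: if_split, simp)
  also have "\<dots> = weighted_sum N x (U1 \<union> shift ` U2)
      (\<lambda>T. of_bool (locally_strict U1 T \<and> locally_strict (shift ` U2) T) *
        path_pair N x e s k (T (z 0)) (T (y (k + 1))))"
  proof (rule weighted_sum_path_pair_between)
    show "inj_on z {1..k}" by (rule inj_on_subset[OF inj_on_cells(1)]) auto
    show "inj_on y {1..k}" by (rule inj_on_subset[OF inj_on_cells(2)]) auto
    show "z ` {1..k} \<inter> (U1 \<union> shift ` U2) = {}" "y ` {1..k} \<inter> (U1 \<union> shift ` U2) = {}"
      using disjoint_cells(1,3,4,5) by auto
    fix T c v assume "c \<in> z ` {1..k} \<union> y ` {1..k}"
    then have "c \<notin> U1" "c \<notin> shift ` U2" using disjoint_cells(1,3,4,5) by auto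
    then show "(of_bool (locally_strict U1 (T(c := v)) \<and> locally_strict (shift ` U2) (T(c := v))) :: 'a) =
        of_bool (locally_strict U1 T \<and> locally_strict (shift ` U2) T)"
      by (simp add: locally_strict_upd)
  qed (use finite_U1 finite_U2 z_first z_last disjoint_cells(8) in simp_all)
  also have "\<dots> = double_sum N x (shift ` U2) (y (k + 1)) (\<lambda>p q. path_pair N x e s k p q)"
    by (rule weighted_sum_double_sum) (use finite_U2 disjoint_cells(7) z_last in auto)
  finally show ?thesis unfolding double_sum_shift .
qed

text \<open>With \<open>p\<close> and \<open>q\<close> the values at \<open>z 0\<close> and
  \<open>z (k + 1)\<close>, the lower diagram contributes a path leaving \<open>p\<close>, the upper
  one a path entering \<open>q\<close>, the amalgam a path from \<open>p\<close> to
  \<open>q\<close>, the ribbon a free path and the projection a pair of paths. Thus this is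
  \<open>path_sum_times_open_path\<close>, summed over the fillings of \<open>U1\<close> and
  \<open>U2\<close>.\<close>

theorem schur_gluing:
  "schur N x (U1 \<union> z ` {1..k}) * schur N x (U2 \<union> z ` {1..k}) =
    schur N x (U1 \<union> U2 \<union> z ` {1..k}) * schur N x (z ` {1..k}) +
    schur N x (U1 \<union> shift ` U2 \<union> z ` {1..k} \<union> y ` {1..k})"
proof -
  have scale: "double_sum N x U2 d (\<lambda>p q. G p q * a) = double_sum N x U2 d G * a" for d G a
  proof -
    have inner: "weighted_sum N x U2 (\<lambda>T'. of_bool (locally_strict U2 T') * (G p (T' d) * a)) =
        a * weighted_sum N x U2 (\<lambda>T'. of_bool (locally_strict U2 T') * G p (T' d))" for p
      unfolding weighted_sum_scale[symmetric] by (simp only: mult_ac)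
    have "double_sum N x U2 d (\<lambda>p q. G p q * a) = weighted_sum N x U1 (\<lambda>T. a * (of_bool (locally_strict U1 T) *
        weighted_sum N x U2 (\<lambda>T'. of_bool (locally_strict U2 T') * G (T (z 0)) (T' d))))"
      unfolding double_sum_def inner by (simp only: mult.left_commute)
    then show ?thesis unfolding weighted_sum_scale double_sum_def by (simp add: mult.commute)
  qed
  have add: "double_sum N x U2 d (\<lambda>p q. G p q + H p q) = double_sum N x U2 d G + double_sum N x U2 d H" for d G H
    unfolding double_sum_def by (simp only: distrib_left weighted_sum_add)
  have "schur N x (U1 \<union> z ` {1..k}) * schur N x (U2 \<union> z ` {1..k}) =
      double_sum N x U2 (z (k + 1)) (\<lambda>p q. path_sum N x e (\<lambda>_. 1) 0 k p * open_path N x e s k q)"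
    unfolding schur_lower schur_upper by (rule double_sum_mult)
  also have "\<dots> = double_sum N x U2 (z (k + 1)) (\<lambda>p q.
      path_sum N x e (\<lambda>u. of_bool (step_ok s u q)) 0 k p * free_path N x e k + path_pair N x e s k p q)"
    by (simp only: path_sum_times_open_path[where e=e and s=s, OF e_first])
  finally show ?thesis
    unfolding schur_middle schur_amalgam schur_projection add scale .
qed

end

subsection \<open>Diagrams described by their diagonals\<close>

definition band :: "int \<Rightarrow> int \<Rightarrow> (int \<Rightarrow> int) \<Rightarrow> (int \<Rightarrow> int) \<Rightarrow> diagram" where
  "band A B l r = {(i, j). A \<le> j - i \<and> j - i \<le> B \<and> l (j - i) \<le> i \<and> i \<le> r (j - i)}"

text \<open>Such a boundary is a northeast lattice path: to reach the next diagonal it moves one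
  column right in the same row or one row up. The column on diagonal \<open>d\<close> is
  \<open>l d + d\<close>.\<close>

definition falling :: "int \<Rightarrow> int \<Rightarrow> (int \<Rightarrow> int) \<Rightarrow> bool" where
  "falling A B l \<longleftrightarrow> (\<forall>d. A \<le> d \<longrightarrow> d < B \<longrightarrow> l (d + 1) = l d \<or> l (d + 1) = l d - 1)"

text \<open>
  A connected skew diagram with contents \<open>A, \<dots>, B\<close>, given by its first and last row on each diagonal.
\<close>

definition lattice_band :: "int \<Rightarrow> int \<Rightarrow> (int \<Rightarrow> int) \<Rightarrow> (int \<Rightarrow> int) \<Rightarrow> bool" where
  "lattice_band A B l r \<longleftrightarrow> A \<le> B \<and> l A = r A \<and> l B = r B \<and>
     (\<forall>d. A \<le> d \<longrightarrow> d \<le> B \<longrightarrow> l d \<le> r d) \<and> falling A B l \<and> falling A B r"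

lemma falling_antimono:
  assumes "falling A B l" "A \<le> d" "d \<le> d'" "d' \<le> B"
  shows "l d' \<le> l d" "l d + d \<le> l d' + d'"
proof -
  have "A \<le> d \<Longrightarrow> d + int n \<le> B \<Longrightarrow> l (d + int n) \<le> l d \<and> l d + d \<le> l (d + int n) + (d + int n)" for n
  proof (induction n)
    case (Suc n)
    then have "l (d + int n + 1) = l (d + int n) \<or> l (d + int n + 1) = l (d + int n) - 1"
      using assms(1) unfolding falling_def by auto
    with Suc show ?case by (auto simp: algebra_simps)
  qed simp
  from this[of "nat (d' - d)"] show "l d' \<le> l d" "l d + d \<le> l d' + d'" using assms by auto
qed

lemma order_convex_band:
  assumes "lattice_band A B l r"
  shows "order_convex (band A B l r)"
  unfolding order_convex_def
proof (intro allI impI)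
  fix i j i' j' m n
  assume p: "(i, j) \<in> band A B l r" and q: "(i', j') \<in> band A B l r"
    and le: "i \<le> m" "m \<le> i'" "j \<le> n" "n \<le> j'"
  have l: "falling A B l" and r: "falling A B r" and eq: "l A = r A" "l B = r B"
    using assms by (auto simp: lattice_band_def)
  note pD = p[unfolded band_def, simplified] and qD = q[unfolded band_def, simplified]
  \<comment> \<open>The only cell of the first diagonal lies weakly left of \<open>(i, j)\<close>
    and weakly below \<open>(i', j')\<close>, so \<open>m \<le> l A\<close> and
    \<open>l A + A \<le> n\<close>. The single cell of the last diagonal gives the other bound in
    the same way.\<close>
  have "A \<le> n - m"
    using falling_antimono(2)[OF l, of A "j - i"] falling_antimono(1)[OF r, of A "j' - i'"] pD qD eq le by linarith
  moreover have "n - m \<le> B"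
    using falling_antimono(1)[OF l, of "j - i" B] falling_antimono(2)[OF r, of "j' - i'" B] pD qD eq le by linarith
  moreover have "l (n - m) \<le> m"
    using falling_antimono(1)[OF l, of "j - i" "n - m"] falling_antimono(2)[OF l, of "n - m" "j - i"] pD le
      calculation by linarith
  moreover have "m \<le> r (n - m)"
    using falling_antimono(2)[OF r, of "j' - i'" "n - m"] falling_antimono(1)[OF r, of "n - m" "j' - i'"] qD le
      calculation by linarith
  ultimately show "(m, n) \<in> band A B l r" by (simp add: band_def)
qed

lemma finite_band: "finite (band A B l r)"
proof -
  have "band A B l r \<subseteq> (\<Union>d\<in>{A..B}. (\<lambda>i. (i, i + d)) ` {l d..r d})"
  proof
    fix c assume "c \<in> band A B l r"
    then show "c \<in> (\<Union>d\<in>{A..B}. (\<lambda>i. (i, i + d)) ` {l d..r d})"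
      by (intro UN_I[of "content c"] image_eqI[of _ _ "fst c"]) (auto simp: band_def content_def)
  qed
  then show ?thesis by (rule finite_subset) auto
qed

text \<open>
  The word \<open>W\<close> lists, relative to its first cell and indexed by content, the rows of the ribbon
  \<open>W 0, \<dots>, W (k - 1)\<close>, together with the row \<open>W (- 1)\<close> of the cell before its top copy and the row
  \<open>W k\<close> of the cell after its bottom copy. The flag \<open>s\<close> tells whether these two extra steps go up,
  that is, whether the outer projection is skew.
\<close>

definition ribbon_word :: "nat \<Rightarrow> (int \<Rightarrow> int) \<Rightarrow> bool \<Rightarrow> bool" where
  "ribbon_word k W s \<longleftrightarrow> W 0 = 0 \<and> falling (- 1) (int k) W \<and>
     (W 0 = W (- 1) - 1 \<longleftrightarrow> s) \<and> (W (int k) = W (int k - 1) - 1 \<longleftrightarrow> s)"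

definition word_ribbon :: "nat \<Rightarrow> (int \<Rightarrow> int) \<Rightarrow> diagram" where
  "word_ribbon k W = (\<lambda>i. (W (int i), W (int i) + int i)) ` {0..<k}"

text \<open>\<open>A + 2 * int k \<le> B\<close> leaves a diagonal free of both copies. Hence gluing
  at one end leaves the data at the other end unchanged, including the extra cell next to the copy
  there.\<close>

definition boundary ::
  "nat \<Rightarrow> (int \<Rightarrow> int) \<Rightarrow> diagram \<Rightarrow> int \<Rightarrow> int \<Rightarrow> int \<Rightarrow> int \<Rightarrow> (int \<Rightarrow> int) \<Rightarrow> (int \<Rightarrow> int) \<Rightarrow> bool" where
  "boundary k W E A B x y l r \<longleftrightarrow> lattice_band A B l r \<and> E = band A B l r \<and> A + 2 * int k \<le> B \<and>
     (\<forall>i. 0 \<le> i \<longrightarrow> i \<le> int k \<longrightarrow> l (A + i) = x + W i \<and> r (A + i) = x + W i) \<and>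
     (\<forall>i. - 1 \<le> i \<longrightarrow> i < int k \<longrightarrow> l (B - int k + 1 + i) = y + W i \<and> r (B - int k + 1 + i) = y + W i)"

lemma boundaryD:
  assumes "boundary k W E A B x y l r"
  shows "lattice_band A B l r" "E = band A B l r" "A + 2 * int k \<le> B"
    "\<And>i. 0 \<le> i \<Longrightarrow> i \<le> int k \<Longrightarrow> l (A + i) = x + W i \<and> r (A + i) = x + W i"
    "\<And>i. - 1 \<le> i \<Longrightarrow> i < int k \<Longrightarrow> l (B - int k + 1 + i) = y + W i \<and> r (B - int k + 1 + i) = y + W i"
  using assms unfolding boundary_def by blast+

text \<open>
  Both copies of the ribbon described by \<open>W\<close> protrude from \<open>E\<close>; their first cells lie in rows \<open>x\<close>
  (bottom copy) and \<open>y\<close> (top copy).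
\<close>

definition linkable :: "nat \<Rightarrow> (int \<Rightarrow> int) \<Rightarrow> diagram \<Rightarrow> int \<Rightarrow> int \<Rightarrow> int \<Rightarrow> int \<Rightarrow> bool" where
  "linkable k W E A B x y \<longleftrightarrow> (\<exists>l r. boundary k W E A B x y l r)"

lemma linkableI:
  assumes "lattice_band A B l r" "E = band A B l r" "A + 2 * int k \<le> B"
    "\<And>i. 0 \<le> i \<Longrightarrow> i \<le> int k \<Longrightarrow> l (A + i) = x + W i \<and> r (A + i) = x + W i"
    "\<And>i. - 1 \<le> i \<Longrightarrow> i < int k \<Longrightarrow> l (B - int k + 1 + i) = y + W i \<and> r (B - int k + 1 + i) = y + W i"
  shows "linkable k W E A B x y"
  unfolding linkable_def boundary_def using assms by (intro exI[of _ l] exI[of _ r]) simp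

lemma linkable_finite: "linkable k W E A B x y \<Longrightarrow> finite E"
  unfolding linkable_def boundary_def using finite_band by blast

lemma linkable_order_convex: "linkable k W E A B x y \<Longrightarrow> order_convex E"
  unfolding linkable_def boundary_def using order_convex_band by blast

lemma translate_band:
  "translate v (band A B l r) = band (A + snd v - fst v) (B + snd v - fst v)
    (\<lambda>d. l (d - (snd v - fst v)) + fst v) (\<lambda>d. r (d - (snd v - fst v)) + fst v)"
proof -
  have "(i, j) \<in> translate v (band A B l r) \<longleftrightarrow> (i, j) \<in> band (A + snd v - fst v) (B + snd v - fst v)
    (\<lambda>d. l (d - (snd v - fst v)) + fst v) (\<lambda>d. r (d - (snd v - fst v)) + fst v)" for i j
  proof -
    have eq: "j - snd v - (i - fst v) = j - i - (snd v - fst v)" by simp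
    show ?thesis unfolding mem_translate band_def mem_Collect_eq case_prod_conv eq by auto
  qed
  then show ?thesis by (auto simp del: split_paired_All)
qed

lemma linkable_translate:
  assumes "linkable k W E A B x y"
  shows "linkable k W (translate v E) (A + snd v - fst v) (B + snd v - fst v) (x + fst v) (y + fst v)"
proof -
  obtain l r where "boundary k W E A B x y l r" using assms unfolding linkable_def by blast
  note lr = boundaryD[OF this]
  let ?q = "snd v - fst v"
  let ?l = "\<lambda>d. l (d - ?q) + fst v" and ?r = "\<lambda>d. r (d - ?q) + fst v"
  have fall: "falling (A + snd v - fst v) (B + snd v - fst v) (\<lambda>d. h (d - ?q) + fst v)" if "falling A B h" for h
    unfolding falling_def
  proof (intro allI impI)
    fix d assume "A + snd v - fst v \<le> d" "d < B + snd v - fst v"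
    then have "h (d - ?q + 1) = h (d - ?q) \<or> h (d - ?q + 1) = h (d - ?q) - 1"
      using that unfolding falling_def by simp
    moreover have eq: "d + 1 - ?q = d - ?q + 1" by simp
    ultimately show "h (d + 1 - ?q) + fst v = h (d - ?q) + fst v \<or> h (d + 1 - ?q) + fst v = h (d - ?q) + fst v - 1"
      unfolding eq by auto
  qed
  have "lattice_band (A + snd v - fst v) (B + snd v - fst v) ?l ?r"
    using lr(1) fall unfolding lattice_band_def by auto
  moreover have "translate v E = band (A + snd v - fst v) (B + snd v - fst v) ?l ?r"
    unfolding lr(2) by (rule translate_band)
  moreover have "?l (A + snd v - fst v + i) = x + fst v + W i \<and> ?r (A + snd v - fst v + i) = x + fst v + W i"
    if "0 \<le> i" "i \<le> int k" for i
  proof -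
    have "A + snd v - fst v + i - ?q = A + i" by simp
    then show ?thesis using lr(4)[OF that] by simp
  qed
  moreover have "?l (B + snd v - fst v - int k + 1 + i) = y + fst v + W i \<and>
      ?r (B + snd v - fst v - int k + 1 + i) = y + fst v + W i" if "- 1 \<le> i" "i < int k" for i
  proof -
    have eq: "B + snd v - fst v - int k + 1 + i - ?q = B - int k + 1 + i" by simp
    show ?thesis unfolding eq using lr(5)[OF that] by auto
  qed
  ultimately show ?thesis unfolding linkable_def boundary_def using lr(3) by (intro exI[of _ ?l] exI[of _ ?r]) simp
qed

section \<open>Two diagrams aligned along a common copy of the ribbon\<close>

definition eps :: "bool \<Rightarrow> int" where "eps s = (if s then 1 else - 1)"

text \<open>The bottom copy in \<open>E2\<close> and the top copy in \<open>E1\<close> start in the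
  same row \<open>x'\<close> and on the same diagonal, so they coincide: the amalgam is the plain
  union, and the projection displaces \<open>E2\<close> diagonally by \<open>eps s\<close>.\<close>

locale aligned =
  fixes k :: nat and W :: "int \<Rightarrow> int" and s :: bool and E1 E2 :: diagram and A B B' x x' y :: int
  assumes word: "ribbon_word k W s"
    and E1: "linkable k W E1 A B x x'" and E2: "linkable k W E2 (B - int k + 1) B' x' y"
begin

definition C :: int where "C = B - int k + 1"

lemma C_le: "C \<le> B + 1" "A + int k < C" "B < B' - int k + 1" "C + 2 * int k \<le> B'" "A \<le> B" "B = C + int k - 1"
  using E1 E2 unfolding linkable_def boundary_def C_def by auto

lemma W_simps: "W 0 = 0" "W (- 1) = (if s then 1 else 0)" "W (int k) = (if s then W (int k - 1) - 1 else W (int k - 1))"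
proof -
  have 0: "W 0 = 0" and f: "falling (- 1) (int k) W" and w: "W 0 = W (- 1) - 1 \<longleftrightarrow> s"
    "W (int k) = W (int k - 1) - 1 \<longleftrightarrow> s"
    using word unfolding ribbon_word_def by blast+
  have "W (- 1 + 1) = W (- 1) \<or> W (- 1 + 1) = W (- 1) - 1"
    "W (int k - 1 + 1) = W (int k - 1) \<or> W (int k - 1 + 1) = W (int k - 1) - 1"
    using f[unfolded falling_def, rule_format, of "- 1"] f[unfolded falling_def, rule_format, of "int k - 1"] by simp_all
  then show "W 0 = 0" "W (- 1) = (if s then 1 else 0)"
    "W (int k) = (if s then W (int k - 1) - 1 else W (int k - 1))"
    using 0 w by auto
qed

lemma linkable_amalgam: "linkable k W (E1 \<union> E2) A B' x y"
proof -
  obtain l1 r1 l2 r2 where b: "boundary k W E1 A B x x' l1 r1" "boundary k W E2 (B - int k + 1) B' x' y l2 r2"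
    using E1 E2 unfolding linkable_def by blast
  note D1 = boundaryD[OF b(1), folded C_def] and D2 = boundaryD[OF b(2), folded C_def]
  note lr = D1(1,2) D2(1,2) D1(4,5) D2(4,5)
  let ?l = "\<lambda>d. if d \<le> B then l1 d else l2 d" and ?r = "\<lambda>d. if d \<le> B then r1 d else r2 d"
  have overlap: "l1 d = l2 d \<and> r1 d = r2 d" if "C \<le> d" "d \<le> B" for d
    using lr(6,7)[of "d - C"] that C_le by simp
  have junction: "W (int k) = W (int k - 1) \<or> W (int k) = W (int k - 1) - 1" using W_simps(3) by auto
  have B1: "C + int k = B + 1" "C + (int k - 1) = B" using C_le by auto
  have ends: "l1 B = x' + W (int k - 1)" "r1 B = x' + W (int k - 1)"
      "l2 (B + 1) = x' + W (int k)" "r2 (B + 1) = x' + W (int k)"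
    using lr(6)[of "int k - 1", unfolded B1] lr(7)[of "int k", unfolded B1] by simp_all
  have fall: "falling A B' (\<lambda>d. if d \<le> B then h1 d else h2 d)"
    if "falling A B h1" "falling C B' h2" "h2 (B + 1) = h1 B \<or> h2 (B + 1) = h1 B - 1" for h1 h2
    unfolding falling_def
  proof (intro allI impI)
    fix d assume d: "A \<le> d" "d < B'"
    consider "d < B" | "d = B" | "B < d" by linarith
    then show "(if d + 1 \<le> B then h1 (d + 1) else h2 (d + 1)) = (if d \<le> B then h1 d else h2 d) \<or>
        (if d + 1 \<le> B then h1 (d + 1) else h2 (d + 1)) = (if d \<le> B then h1 d else h2 d) - 1"
      by cases (use that d C_le in \<open>auto simp: falling_def\<close>)
  qed
  have "lattice_band A B' ?l ?r"
    using lr(1,3) C_le fall[of l1 l2] fall[of r1 r2] junction ends unfolding lattice_band_def by auto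
  moreover have "E1 \<union> E2 = band A B' ?l ?r"
    unfolding lr(2,4) band_def using overlap C_le by auto
  moreover have "A + 2 * int k \<le> B'" using C_le by linarith
  moreover have "?l (A + i) = x + W i \<and> ?r (A + i) = x + W i" if "0 \<le> i" "i \<le> int k" for i
    using lr(5)[OF that] that C_le by simp
  moreover have "?l (B' - int k + 1 + i) = y + W i \<and> ?r (B' - int k + 1 + i) = y + W i"
    if "- 1 \<le> i" "i < int k" for i
    using lr(8)[OF that] that C_le by simp
  ultimately show ?thesis by (rule linkableI)
qed

lemma linkable_projection: "linkable k W (E1 \<union> translate (eps s, eps s) E2) A B' x (y + eps s)"
proof -
  obtain l1 r1 l2 r2 where b: "boundary k W E1 A B x x' l1 r1" "boundary k W E2 (B - int k + 1) B' x' y l2 r2"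
    using E1 E2 unfolding linkable_def by blast
  note D1 = boundaryD[OF b(1), folded C_def] and D2 = boundaryD[OF b(2), folded C_def]
  note lr = D1(1,2) D2(1,2) D1(4,5) D2(4,5)
  text \<open>\<open>long\<close> follows the boundary of \<open>E1\<close> until its end, \<open>short\<close> leaves it as soon as \<open>E2\<close> starts.\<close>
  define long where "long h1 h2 = (\<lambda>d. if d \<le> B then h1 d else h2 d + eps s)" for h1 h2 :: "int \<Rightarrow> int"
  define short where "short h1 h2 = (\<lambda>d. if d < C then h1 d else h2 d + eps s)" for h1 h2 :: "int \<Rightarrow> int"
  \<comment> \<open>For true \<open>s\<close> the displaced \<open>E2\<close> lies southeast: the
    upper boundary stays with \<open>E1\<close> as long as possible and the lower one leaves it at
    once. Otherwise the roles are exchanged.\<close>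
  define l where "l = (if s then long l1 l2 else short l1 l2)"
  define r where "r = (if s then short r1 r2 else long r1 r2)"
  have overlap: "l1 d = x' + W (d - C)" "r1 d = x' + W (d - C)" "l2 d = x' + W (d - C)" "r2 d = x' + W (d - C)"
    if "C \<le> d" "d \<le> B" for d
    using lr(6,7)[of "d - C"] that C_le by simp_all
  have B1: "C + int k = B + 1" "C + (int k - 1) = B" "C + - 1 = C - 1" "C + 0 = C" using C_le by auto
  have ends: "l1 B = x' + W (int k - 1)" "r1 B = x' + W (int k - 1)"
      "l2 (B + 1) = x' + W (int k)" "r2 (B + 1) = x' + W (int k)"
      "l1 (C - 1) = x' + W (- 1)" "r1 (C - 1) = x' + W (- 1)" "l2 C = x'" "r2 C = x'"
    using lr(6)[of "int k - 1", unfolded B1] lr(7)[of "int k", unfolded B1] lr(6)[of "- 1", unfolded B1]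
      lr(7)[of 0, unfolded B1] W_simps(1) by simp_all
  \<comment> \<open>At each junction the displacement by \<open>eps s\<close> turns the up step of
    the word into a right step, or the right step into an up step. Both are admissible, and this is
    where the direction of the two extra letters matters.\<close>
  have fall: "falling A B' (if s then long h1 h2 else short h1 h2)" "falling A B' (if s then short h1 h2 else long h1 h2)"
    if h: "falling A B h1" "falling C B' h2" "h1 B = x' + W (int k - 1)" "h2 (B + 1) = x' + W (int k)"
      "h1 (C - 1) = x' + W (- 1)" "h2 C = x'" for h1 h2
  proof -
    have "falling A B' (long h1 h2)"
      unfolding falling_def
    proof (intro allI impI)
      fix d assume d: "A \<le> d" "d < B'"
      consider "d < B" | "d = B" | "B < d" by linarith
      then show "long h1 h2 (d + 1) = long h1 h2 d \<or> long h1 h2 (d + 1) = long h1 h2 d - 1"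
        by cases (use h d C_le W_simps(3) in \<open>auto simp: falling_def long_def eps_def\<close>)
    qed
    moreover have "falling A B' (short h1 h2)"
      unfolding falling_def
    proof (intro allI impI)
      fix d assume d: "A \<le> d" "d < B'"
      consider "d < C - 1" | "d = C - 1" | "C \<le> d" by linarith
      then show "short h1 h2 (d + 1) = short h1 h2 d \<or> short h1 h2 (d + 1) = short h1 h2 d - 1"
        by cases (use h d C_le W_simps(2) in \<open>auto simp: falling_def short_def eps_def\<close>)
    qed
    ultimately show "falling A B' (if s then long h1 h2 else short h1 h2)" "falling A B' (if s then short h1 h2 else long h1 h2)"
      by auto
  qed
  have le12: "l1 d \<le> r1 d" if "A \<le> d" "d \<le> B" for d using lr(1) that unfolding lattice_band_def by blast
  have le22: "l2 d \<le> r2 d" if "C \<le> d" "d \<le> B'" for d using lr(3) that unfolding lattice_band_def by blast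
  have "l d \<le> r d" if d: "A \<le> d" "d \<le> B'" for d
  proof -
    consider "d < C" | "C \<le> d" "d \<le> B" | "B < d" by linarith
    then show ?thesis
      unfolding l_def r_def long_def short_def eps_def
      by cases (use d C_le le12[of d] le22[of d] overlap[of d] in auto)
  qed
  moreover have "l A = r A" "l B' = r B'"
    using lr(1,3) C_le by (auto simp: l_def r_def long_def short_def lattice_band_def)
  moreover have ff: "falling A B l1" "falling A B r1" "falling C B' l2" "falling C B' r2"
    using lr(1,3) by (simp_all add: lattice_band_def)
  have "falling A B' l" "falling A B' r"
    unfolding l_def r_def
    by (rule fall(1)[OF ff(1,3) ends(1,3,5,7)], rule fall(2)[OF ff(2,4) ends(2,4,6,8)])
  ultimately have "lattice_band A B' l r"
    using C_le \<open>falling A B' l\<close> \<open>falling A B' r\<close> unfolding lattice_band_def by auto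
  moreover have "E1 \<union> translate (eps s, eps s) E2 = band A B' l r"
  proof -
    have "(i, j) \<in> E1 \<union> translate (eps s, eps s) E2 \<longleftrightarrow> (i, j) \<in> band A B' l r" for i j
    proof -
      have c: "j - eps s - (i - eps s) = j - i" by simp
      consider "j - i < C" | "C \<le> j - i" "j - i \<le> B" | "B < j - i" by linarith
      then show ?thesis
        unfolding Un_iff mem_translate lr(2,4) band_def mem_Collect_eq case_prod_conv fst_conv snd_conv c
          l_def r_def long_def short_def
        unfolding eps_def by cases (use C_le overlap[of "j - i"] in auto)
    qed
    then show ?thesis by (auto simp del: split_paired_All)
  qed
  moreover have "A + 2 * int k \<le> B'" using C_le by linarith
  moreover have "l (A + i) = x + W i \<and> r (A + i) = x + W i" if "0 \<le> i" "i \<le> int k" for i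
    using lr(5)[OF that] that C_le by (simp add: l_def r_def long_def short_def)
  moreover have "l (B' - int k + 1 + i) = y + eps s + W i \<and> r (B' - int k + 1 + i) = y + eps s + W i"
    if "- 1 \<le> i" "i < int k" for i
    using lr(8)[OF that] that C_le by (simp add: l_def r_def long_def short_def)
  ultimately show ?thesis by (rule linkableI)
qed

text \<open>The index is one more than the position in the word: indices 1 to \<open>k\<close> are
  the common copy, index 0 is the cell of \<open>E1\<close> before it and index \<open>k + 1\<close>
  the cell of \<open>E2\<close> after it.\<close>

definition cell_at :: "nat \<Rightarrow> cell" where
  "cell_at j = (x' + W (int j - 1), x' + W (int j - 1) + C + (int j - 1))"

definition U1 :: diagram where "U1 = {c \<in> E1. content c < C}"
definition U2 :: diagram where "U2 = {c \<in> E2. C + int k \<le> content c}"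

lemma cell_at_lower: "(i, j) \<in> E1 \<Longrightarrow> j - i = C + (int m - 1) \<Longrightarrow> m \<le> k \<Longrightarrow> (i, j) = cell_at m"
  and cell_at_in_E1: "m \<le> k \<Longrightarrow> cell_at m \<in> E1"
  and cell_at_upper: "(i, j) \<in> E2 \<Longrightarrow> j - i = C + (int m - 1) \<Longrightarrow> 1 \<le> m \<Longrightarrow> m \<le> k + 1 \<Longrightarrow> (i, j) = cell_at m"
  and cell_at_in_E2: "1 \<le> m \<Longrightarrow> m \<le> k + 1 \<Longrightarrow> cell_at m \<in> E2"
proof -
  obtain l1 r1 l2 r2 where b: "boundary k W E1 A B x x' l1 r1" "boundary k W E2 (B - int k + 1) B' x' y l2 r2"
    using E1 E2 unfolding linkable_def by blast
  note D1 = boundaryD[OF b(1), folded C_def] and D2 = boundaryD[OF b(2), folded C_def]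
  note lr = D1(1,2) D2(1,2) D1(4,5) D2(4,5)
  show "(i, j) = cell_at m" if "(i, j) \<in> E1" "j - i = C + (int m - 1)" "m \<le> k"
    using that lr(6)[of "int m - 1"] unfolding lr(2) by (auto simp: band_def cell_at_def)
  show "(i, j) = cell_at m" if "(i, j) \<in> E2" "j - i = C + (int m - 1)" "1 \<le> m" "m \<le> k + 1"
    using that lr(7)[of "int m - 1"] unfolding lr(4) by (auto simp: band_def cell_at_def)
  have ct: "x' + W (int m - 1) + C + (int m - 1) - (x' + W (int m - 1)) = C + (int m - 1)" by simp
  show "cell_at m \<in> E1" if "m \<le> k"
    using that lr(6)[of "int m - 1"] C_le unfolding lr(2) band_def cell_at_def mem_Collect_eq case_prod_conv ct by simp
  show "cell_at m \<in> E2" if "1 \<le> m" "m \<le> k + 1"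
    using that lr(7)[of "int m - 1"] C_le unfolding lr(4) band_def cell_at_def mem_Collect_eq case_prod_conv ct by simp
qed

lemma content_cell_at: "content (cell_at m) = C + (int m - 1)"
  by (simp add: cell_at_def content_def)

lemma content_E1: "c \<in> E1 \<Longrightarrow> content c < C + int k" and content_E2: "c \<in> E2 \<Longrightarrow> C \<le> content c"
  using E1 E2 C_le unfolding linkable_def boundary_def band_def content_def C_def by auto

lemma E1_eq: "E1 = U1 \<union> cell_at ` {1..k}"
proof (intro set_eqI iffI)
  fix c assume c: "c \<in> E1"
  show "c \<in> U1 \<union> cell_at ` {1..k}"
  proof (cases "content c < C")
    case False
    let ?m = "nat (content c - C + 1)"
    have "content c < C + int k" using content_E1[OF c] .
    then have "c = cell_at ?m" "?m \<in> {1..k}"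
      using False cell_at_lower[of "fst c" "snd c" ?m] c by (auto simp: content_def)
    then show ?thesis by blast
  qed (use c in \<open>simp add: U1_def\<close>)
qed (use cell_at_in_E1 in \<open>auto simp: U1_def\<close>)

lemma E2_eq: "E2 = U2 \<union> cell_at ` {1..k}"
proof (intro set_eqI iffI)
  fix c assume c: "c \<in> E2"
  show "c \<in> U2 \<union> cell_at ` {1..k}"
  proof (cases "C + int k \<le> content c")
    case False
    let ?m = "nat (content c - C + 1)"
    have "C \<le> content c" using content_E2[OF c] .
    then have "c = cell_at ?m" "?m \<in> {1..k}"
      using False cell_at_upper[of "fst c" "snd c" ?m] c by (auto simp: content_def)
    then show ?thesis by blast
  qed (use c in \<open>simp add: U2_def\<close>)
qed (use cell_at_in_E2 in \<open>auto simp: U2_def\<close>)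

lemma gluing: "gluing U1 U2 cell_at k C (\<lambda>j. W (int j) = W (int j - 1) - 1) s"
proof (rule gluing.intro)
  show "finite U1" "finite U2"
    using linkable_finite[OF E1] linkable_finite[OF E2] by (auto simp: U1_def U2_def)
  show "cell_at 0 \<in> U1" "cell_at (k + 1) \<in> U2" "content (cell_at 0) = C - 1"
    using cell_at_in_E1[of 0] cell_at_in_E2[of "k + 1"] by (auto simp: U1_def U2_def content_cell_at)
  show "content c < C" if "c \<in> U1" for c using that by (simp add: U1_def)
  show "C + int k \<le> content c" if "c \<in> U2" for c using that by (simp add: U2_def)
  show "c = cell_at 0" if "c \<in> U1" "content c = C - 1" for c
    using that cell_at_lower[of "fst c" "snd c" 0] by (simp add: U1_def content_def)
  show "c = cell_at (k + 1)" if "c \<in> U2" "content c = C + int k" for c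
    using that cell_at_upper[of "fst c" "snd c" "k + 1"] by (simp add: U2_def content_def)
  show "cell_at (j + 1) = (if W (int j) = W (int j - 1) - 1 then (fst (cell_at j) - 1, snd (cell_at j))
      else (fst (cell_at j), snd (cell_at j) + 1))" if "j \<le> k" for j
  proof -
    have f: "falling (- 1) (int k) W" using word unfolding ribbon_word_def by blast
    have "W (int j) = W (int j - 1) \<or> W (int j) = W (int j - 1) - 1"
      using f[unfolded falling_def, rule_format, of "int j - 1"] that by simp
    then show ?thesis by (auto simp: cell_at_def)
  qed
  show "(W (int 0) = W (int 0 - 1) - 1) = s" "(W (int k) = W (int k - 1) - 1) = s"
    by (cases s; simp add: W_simps)+
qed

lemma schur_word_ribbon: "schur N t (cell_at ` {1..k}) = schur N t (word_ribbon k W)"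
proof -
  have "cell_at ` {1..k} = translate (x', x' + C) (word_ribbon k W)"
  proof -
    have "{1..k} = Suc ` {0..<k}" by (simp add: atLeastLessThanSuc_atLeastAtMost)
    then show ?thesis unfolding translate_eq_image word_ribbon_def
      by (simp only: image_image) (intro image_cong refl, simp add: cell_at_def)
  qed
  then show ?thesis by (simp add: schur_translate)
qed

lemma schur_linking:
  "schur N t E1 * schur N t E2 = schur N t (E1 \<union> E2) * schur N t (word_ribbon k W) +
     schur N t (E1 \<union> translate (eps s, eps s) E2)"
proof -
  interpret gluing U1 U2 cell_at k C "\<lambda>j. W (int j) = W (int j - 1) - 1" s by (rule gluing)
  have shift: "translate (eps s, eps s) X = shift ` X" for X
    unfolding translate_eq_image shift_def eps_def by (cases s) simp_all
  have am: "E1 \<union> E2 = U1 \<union> U2 \<union> cell_at ` {1..k}"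
    using E1_eq E2_eq by blast
  have "shift ` E2 = shift ` (U2 \<union> cell_at ` {1..k})" by (rule arg_cong[OF E2_eq])
  then have pr: "E1 \<union> translate (eps s, eps s) E2 =
      U1 \<union> shift ` U2 \<union> cell_at ` {1..k} \<union> (\<lambda>j. shift (cell_at j)) ` {1..k}"
    unfolding shift image_Un image_image using E1_eq by blast
  have "schur N t E1 = schur N t (U1 \<union> cell_at ` {1..k})" "schur N t E2 = schur N t (U2 \<union> cell_at ` {1..k})"
    by (rule arg_cong[OF E1_eq], rule arg_cong[OF E2_eq])
  then show ?thesis
    unfolding am pr schur_word_ribbon[symmetric] using schur_gluing[of N t] by simp
qed

end

subsection \<open>Ribbon Schur functions and complete homogeneous ones\<close>

definition row :: "nat \<Rightarrow> diagram" where
  "row n = (\<lambda>j. (0, int j)) ` {0..<n}"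

lemma finite_row: "finite (row n)" by (simp add: row_def)

lemma mem_row: "(i, j) \<in> row n \<longleftrightarrow> i = 0 \<and> 0 \<le> j \<and> j < int n"
proof -
  have "(0, j) \<in> row n" if "0 \<le> j" "j < int n"
    unfolding row_def by (rule image_eqI[of _ _ "nat j"]) (use that in auto)
  then show ?thesis by (auto simp: row_def)
qed

lemma row_Suc: "row (Suc n) = insert (0, int n) (row n)"
  by (auto simp: row_def atLeastLessThanSuc)

lemma schur_row_0: "schur N x (row 0) = 1"
  by (simp add: schur_def row_def weighted_sum_empty locally_strict_def)

lemma schur_row_no_values: "schur 0 x (row (Suc n)) = 0"
proof -
  have "T \<notin> tableaux 0 (row (Suc n))" for T
    using maps_inside[of T 0 "row (Suc n)" "(0, 0)"] by (auto simp: tableaux_def mem_row)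
  then have "tableaux 0 (row (Suc n)) = {}" by blast
  then show ?thesis by (simp add: schur_eq_sum_tableaux finite_row)
qed

lemma tableau_row_le:
  assumes "T \<in> tableaux N (row n)" "i \<le> j" "j < n"
  shows "T (0, int i) \<le> T (0, int j)"
  using assms(2,3)
proof (induction j rule: dec_induct)
  case (step j)
  have "T (0, int j) \<le> T (0, int j + 1)"
    by (rule locally_strict_rightD[of "row n"]) (use assms(1) step in \<open>auto simp: tableaux_def mem_row\<close>)
  then show ?case using step by (simp add: add.commute)
qed simp

text \<open>Entries of a row increase weakly, so the value \<open>Suc N\<close> is used exactly if
  it stands in the last cell. Removing that cell yields the second summand.\<close>

lemma schur_row_Suc:
  "schur (Suc N) x (row (Suc n)) = schur N x (row (Suc n)) + x (Suc N) * schur (Suc N) x (row n)"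
proof -
  let ?c = "(0, int n)"
  define A where "A = {T \<in> tableaux (Suc N) (row (Suc n)). T ?c = Suc N}"
  have c: "?c \<notin> row n" "?c \<in> row (Suc n)" by (auto simp: mem_row)
  have "T \<in> tableaux N (row (Suc n))" if T: "T \<in> tableaux (Suc N) (row (Suc n))" "T ?c \<noteq> Suc N" for T
  proof -
    have m: "T \<in> maps (Suc N) (row (Suc n))" using T(1) by (simp add: tableaux_def)
    have "T ?c \<le> N" using maps_inside[OF m c(2)] T(2) by auto
    then have "T d \<le> N" if d: "d \<in> row (Suc n)" for d
    proof -
      obtain j where "d = (0, int j)" "j \<le> n" using d by (auto simp: row_def)
      then show ?thesis using tableau_row_le[OF T(1), of j n] \<open>T ?c \<le> N\<close> by simp
    qed
    then show ?thesis using T(1) m by (auto simp: tableaux_def intro!: mapsI dest: maps_inside maps_outside)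
  qed
  moreover have "tableaux N (row (Suc n)) \<subseteq> tableaux (Suc N) (row (Suc n)) - A"
    using maps_inside[of _ N "row (Suc n)" ?c] c
    by (force simp: tableaux_def A_def intro!: mapsI dest: maps_inside maps_outside)
  ultimately have split: "tableaux (Suc N) (row (Suc n)) = tableaux N (row (Suc n)) \<union> A"
    "tableaux N (row (Suc n)) \<inter> A = {}"
    by (auto simp: A_def)
  have fin: "finite (tableaux M (row m))" for M m
    by (simp add: tableaux_def finite_maps finite_row)
  have "(\<Sum>T\<in>A. \<Prod>d\<in>row (Suc n). x (T d)) = (\<Sum>T\<in>tableaux (Suc N) (row n). x (Suc N) * (\<Prod>d\<in>row n. x (T d)))"
  proof (rule sum.reindex_bij_witness[where j="\<lambda>T. T(?c := 0)" and i="\<lambda>T. T(?c := Suc N)"], goal_cases)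
    case (1 T) then show ?case by (auto simp: A_def)
  next
    case (2 T)
    then have T: "T \<in> maps (Suc N) (row (Suc n))" "locally_strict (row (Suc n)) T" by (auto simp: A_def tableaux_def)
    have "T(?c := 0) \<in> maps (Suc N) (row n)"
      using T(1) c maps_inside[OF T(1)] maps_outside[OF T(1)] by (intro mapsI) (auto simp: row_Suc)
    moreover have "locally_strict (row n) T" using T(2) by (auto simp: locally_strict_def row_Suc)
    moreover have "locally_strict (row n) (T(?c := 0)) \<longleftrightarrow> locally_strict (row n) T"
      unfolding locally_strict_def by (intro ball_cong refl) (use c in auto)
    ultimately show ?case by (simp add: tableaux_def)
  next
    case (3 T)
    then have "T ?c = 0" using c by (auto simp: tableaux_def dest: maps_outside)
    then show ?case by (simp add: fun_upd_idem)
  next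
    case (4 T)
    then have T: "T \<in> maps (Suc N) (row n)" "locally_strict (row n) T" by (auto simp: tableaux_def)
    have "T(?c := Suc N) \<in> maps (Suc N) (row (Suc n))"
      using maps_inside[OF T(1)] maps_outside[OF T(1)] by (intro mapsI) (auto simp: row_Suc)
    moreover have "locally_strict (row (Suc n)) (T(?c := Suc N))"
    proof (rule locally_strictI)
      fix i j
      assume ij: "(i, j) \<in> row (Suc n)" "(i, j + 1) \<in> row (Suc n)"
      then have i: "(i, j) \<in> row n" "(i, j) \<noteq> ?c" by (auto simp: mem_row)
      show "(T(?c := Suc N)) (i, j) \<le> (T(?c := Suc N)) (i, j + 1)"
      proof (cases "(i, j + 1) = ?c")
        case True
        then show ?thesis using i maps_inside[OF T(1) i(1)] by auto
      next
        case False
        then have "(i, j + 1) \<in> row n" using ij by (auto simp: mem_row)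
        then show ?thesis using i False locally_strict_rightD[OF T(2) i(1)] by auto
      qed
    next
      fix i j
      assume "(i, j) \<in> row (Suc n)" "(i + 1, j) \<in> row (Suc n)"
      then show "(T(?c := Suc N)) (i, j) < (T(?c := Suc N)) (i + 1, j)" by (simp add: mem_row)
    qed
    ultimately show ?case by (simp add: A_def tableaux_def)
  next
    case (5 T)
    have "(\<Prod>d\<in>row n. x (if d = ?c then 0 else T d)) = (\<Prod>d\<in>row n. x (T d))"
      by (rule prod.cong) (use c in auto)
    then show ?case using 5 c by (simp add: row_Suc finite_row A_def fun_upd_def)
  qed
  then show ?thesis
    using fin split(2) unfolding schur_eq_sum_tableaux[OF finite_row] split(1)
    by (subst sum.union_disjoint) (auto simp: A_def sum_distrib_left)
qed

unbundle fps_syntax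

text \<open>The complete homogeneous generating function is the reciprocal of the product of the
  \<open>1 - y i t\<close>; by \<open>schur_row_Suc\<close> the factor of a new variable cancels its
  contribution.\<close>

lemma row_generating_function:
  fixes y :: "nat \<Rightarrow> complex"
  shows "Abs_fps (\<lambda>n. schur N y (row n)) * fps_of_poly (\<Prod>i=1..N. [:1, - y i:]) = 1"
proof (induction N)
  case 0
  have "schur 0 y (row n) = (if n = 0 then 1 else 0)" for n
    by (cases n) (simp_all add: schur_row_0 schur_row_no_values)
  then show ?case by (simp add: fps_eq_iff)
next
  case (Suc N)
  let ?F = "\<lambda>N. Abs_fps (\<lambda>n. schur N y (row n))"
  have "?F (Suc N) * fps_of_poly [:1, - y (Suc N):] = ?F N"
  proof (rule fps_ext)
    fix n
    have "(?F (Suc N) * fps_of_poly [:1, - y (Suc N):]) $ n =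
        ?F (Suc N) $ n - y (Suc N) * (?F (Suc N) * fps_X) $ n"
      by (simp add: fps_of_poly_linear' algebra_simps fps_mult_left_const_nth)
    then show "(?F (Suc N) * fps_of_poly [:1, - y (Suc N):]) $ n = ?F N $ n"
      by (cases n) (simp_all add: schur_row_0 schur_row_Suc fps_X_mult_right_nth)
  qed
  then have "?F (Suc N) * fps_of_poly (\<Prod>i=1..Suc N. [:1, - y i:]) = ?F N * fps_of_poly (\<Prod>i=1..N. [:1, - y i:])"
    by (simp add: prod.nat_ivl_Suc' fps_of_poly_mult mult.assoc[symmetric] del: mult_pCons_left mult_pCons_right)
  then show ?case using Suc by simp
qed

text \<open>The constant coefficient 1 excludes the root 0, so the factor of a root \<open>z\<close>
  can be normalised to \<open>1 - t / z\<close>.\<close>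

lemma complex_poly_linear_factors:
  fixes g :: "complex poly"
  assumes "coeff g 0 = 1"
  shows "\<exists>(N::nat) y. g = (\<Prod>i=1..N. [:1, - y i:])"
  using assms
proof (induction "degree g" arbitrary: g)
  case 0
  then have "[:coeff g 0:] = g" by (intro degree_0_id) simp
  then have "g = 1" using 0 by (simp add: one_pCons)
  then show ?case by (intro exI[of _ 0]) simp
next
  case (Suc n)
  then have "\<not> constant (poly g)" by (simp add: constant_degree)
  then obtain z where z: "poly g z = 0" using fundamental_theorem_of_algebra by blast
  have z0: "z \<noteq> 0" using z Suc.prems by (auto simp: poly_0_coeff_0)
  obtain q where q: "g = [:- z, 1:] * q" using z by (auto simp: poly_eq_0_iff_dvd elim: dvdE)
  define g' where "g' = smult (- z) q"
  have g: "g = [:1, - (1 / z):] * g'"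
    using z0 by (simp add: q g'_def field_simps)
  have "g' \<noteq> 0" using g Suc.prems by auto
  then have "degree g = Suc (degree g')" unfolding g by (subst degree_mult_eq) (use z0 in auto)
  moreover have "coeff g' 0 = 1" using Suc.prems unfolding g by (simp add: mult_pCons_left)
  ultimately obtain N y where y: "g' = (\<Prod>i=(1::nat)..N. [:1, - y i:])" using Suc.hyps by fastforce
  have "(\<Prod>i=1..N. [:1, - (y(Suc N := 1 / z)) i:]) = (\<Prod>i=1..N. [:1, - y i:])"
    by (intro prod.cong refl) auto
  then have "g = (\<Prod>i=1..Suc N. [:1, - (y(Suc N := 1 / z)) i:])"
    unfolding g y by (simp only: prod.nat_ivl_Suc' fun_upd_same)
  then show ?case by blast
qed

text \<open>The reciprocal of the series with coefficients
  \<open>1, \<phi> 1, \<phi> 2, ...\<close>, truncated after degree \<open>M\<close>, is a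
  polynomial with constant term 1. Its linear factors provide the \<open>y i\<close>, and the
  truncation does not affect coefficients up to degree \<open>M\<close>.\<close>

lemma rows_surjective:
  fixes \<phi> :: "nat \<Rightarrow> complex"
  shows "\<exists>N y. \<forall>n\<in>{1..M}. schur N y (row n) = \<phi> n"
proof -
  define F where "F = Abs_fps (\<lambda>n. if n = 0 then 1 else \<phi> n)"
  define g where "g = truncate_fps (Suc M) (inverse F)"
  have F0: "F $ 0 = 1" by (simp add: F_def)
  have gi: "fps_of_poly g $ i = inverse F $ i" if "i \<le> M" for i
    using that by (simp add: g_def)
  have "coeff g 0 = 1" using gi[of 0] F0 by simp
  then obtain N y where y: "g = (\<Prod>i=(1::nat)..N. [:1, - y i:])" using complex_poly_linear_factors by blast
  let ?H = "Abs_fps (\<lambda>n. schur N y (row n))"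
  have one: "(?H * inverse F) $ i = 1 $ i" if "i \<le> M" for i
  proof -
    have "(?H * inverse F) $ i = (?H * fps_of_poly g) $ i"
      unfolding fps_mult_nth by (intro sum.cong refl) (use that gi in auto)
    then show ?thesis using row_generating_function[of N y] unfolding y by simp
  qed
  have "schur N y (row n) = \<phi> n" if n: "n \<in> {1..M}" for n
  proof -
    have "inverse F * F = 1" by (rule inverse_mult_eq_1) (simp add: F0)
    then have "?H $ n = (?H * inverse F * F) $ n" unfolding mult.assoc by (simp only: mult_1_right)
    also have "\<dots> = (1 * F) $ n"
      unfolding fps_mult_nth[of _ F] by (intro sum.cong refl) (use one n in auto)
    finally show ?thesis using n by (simp add: F_def)
  qed
  then show ?thesis by blast
qed

lemma composition_append_single: "composition (\<beta> @ [m]) \<longleftrightarrow> (\<forall>b\<in>set \<beta>. 0 < b) \<and> 0 < m"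
  by (auto simp: composition_def)

text \<open>The product rule for a ribbon and a row: the row is either placed above the last cell of
  the ribbon or prolongs its last row.\<close>

definition ribbon_recursion :: "(nat \<Rightarrow> 'b::comm_ring_1) \<Rightarrow> (nat list \<Rightarrow> 'b) \<Rightarrow> bool" where
  "ribbon_recursion H R \<longleftrightarrow> (\<forall>n>0. R [n] = H n) \<and>
     (\<forall>\<beta> m n. composition (\<beta> @ [m]) \<longrightarrow> 0 < n \<longrightarrow>
        R (\<beta> @ [m]) * H n = R (\<beta> @ [m, n]) + R (\<beta> @ [m + n]))"

text \<open>Solved for \<open>R (\<beta> @ [m, n])\<close>, the recursion refers only to
  compositions with fewer parts and no larger sum, so \<open>H\<close> enters only up to
  \<open>M\<close>.\<close>

lemma ribbon_recursion_unique:
  assumes "ribbon_recursion H R" "ribbon_recursion H' R'" "\<forall>n\<in>{1..M}. H n = H' n"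
    and "composition \<alpha>" "sum_list \<alpha> \<le> M"
  shows "R \<alpha> = R' \<alpha>"
  using assms(4,5)
proof (induction "length \<alpha>" arbitrary: \<alpha> rule: less_induct)
  case less
  obtain \<gamma> n where \<alpha>: "\<alpha> = \<gamma> @ [n]" using less.prems(1) by (metis composition_def rev_exhaust)
  have n: "0 < n" "n \<le> M" using less.prems unfolding \<alpha> composition_append_single by auto
  show ?case
  proof (cases \<gamma> rule: rev_cases)
    case Nil
    then show ?thesis using n assms(1-3) unfolding \<alpha> ribbon_recursion_def by simp
  next
    case (snoc \<beta> m)
    have comp: "composition (\<beta> @ [m])" "composition (\<beta> @ [m + n])"
      using less.prems(1) unfolding \<alpha> snoc by (auto simp: composition_def)
    have IH: "R (\<beta> @ [m]) = R' (\<beta> @ [m])" "R (\<beta> @ [m + n]) = R' (\<beta> @ [m + n])"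
      by (rule less.hyps; use comp less.prems(2) in \<open>simp add: \<alpha> snoc\<close>)+
    have "R (\<beta> @ [m]) * H n = R (\<beta> @ [m, n]) + R (\<beta> @ [m + n])"
      "R' (\<beta> @ [m]) * H' n = R' (\<beta> @ [m, n]) + R' (\<beta> @ [m + n])" "H n = H' n"
      using assms(1-3) comp n unfolding ribbon_recursion_def by (blast, blast, simp)
    then show ?thesis using IH unfolding \<alpha> snoc by simp
  qed
qed

text \<open>\<open>\<beta> @ [m + n]\<close> has one part fewer than
  \<open>\<beta> @ [m, n]\<close>, so a power indexed by the length absorbs the factor
  \<open>a\<close>.\<close>

lemma ribbon_recursion_scale:
  fixes R :: "nat list \<Rightarrow> complex"
  assumes "a \<noteq> 0" and R: "\<And>n. 0 < n \<Longrightarrow> R [n] = H n"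
    and rec: "\<And>\<beta> m n. composition (\<beta> @ [m]) \<Longrightarrow> 0 < n \<Longrightarrow>
      R (\<beta> @ [m]) * H n = R (\<beta> @ [m, n]) + R (\<beta> @ [m + n]) * a"
  shows "ribbon_recursion (\<lambda>n. H n / a) (\<lambda>\<alpha>. R \<alpha> / a ^ length \<alpha>)"
  unfolding ribbon_recursion_def
proof (intro conjI allI impI)
  fix \<beta> and m n :: nat assume "composition (\<beta> @ [m])" "0 < n"
  from rec[OF this] have "R (\<beta> @ [m, n]) = R (\<beta> @ [m]) * H n - R (\<beta> @ [m + n]) * a" by simp
  then show "R (\<beta> @ [m]) / a ^ length (\<beta> @ [m]) * (H n / a) =
      R (\<beta> @ [m, n]) / a ^ length (\<beta> @ [m, n]) + R (\<beta> @ [m + n]) / a ^ length (\<beta> @ [m + n])"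
    using assms(1) by (simp add: field_simps)
qed (use R in simp)

text \<open>A constant \<open>H = c\<close> leads to \<open>c * (c - 1) ^ (l - 1)\<close> for
  \<open>l\<close> parts; 3 is the least positive integer \<open>c\<close> for which this value
  determines \<open>l\<close>.\<close>

lemma ribbon_recursion_three:
  "ribbon_recursion (\<lambda>_. 3) (\<lambda>\<alpha>. 3 * 2 ^ (length \<alpha> - 1) :: complex)"
  unfolding ribbon_recursion_def by simp

text \<open>
  Equivalent ribbons have equally many rows: if all complete homogeneous functions take the value \<open>3\<close>,
  a ribbon Schur function with \<open>l\<close> rows takes the value \<open>3 \<cdot> 2\<^bsup>l - 1\<^esup>\<close>.
\<close>

lemma ribbon_recursion_transfer:
  fixes R :: "nat list \<Rightarrow> complex" and rib :: "nat list \<Rightarrow> diagram"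
  assumes rib: "\<And>N y. ribbon_recursion (\<lambda>n. schur N y (row n)) (\<lambda>\<alpha>. schur N (y :: nat \<Rightarrow> complex) (rib \<alpha>))"
    and eq: "\<And>N y. schur N (y :: nat \<Rightarrow> complex) (rib \<alpha>) = schur N y (rib \<alpha>')"
    and comp: "composition \<alpha>" "composition \<alpha>'"
    and "a \<noteq> 0" "\<And>n. 0 < n \<Longrightarrow> R [n] = H n"
    and "\<And>\<beta> m n. composition (\<beta> @ [m]) \<Longrightarrow> 0 < n \<Longrightarrow>
      R (\<beta> @ [m]) * H n = R (\<beta> @ [m, n]) + R (\<beta> @ [m + n]) * a"
  shows "R \<alpha> = R \<alpha>'"
proof -
  let ?M = "max (sum_list \<alpha>) (sum_list \<alpha>')"
  \<comment> \<open>Any solution \<open>Q\<close> of the recursion agrees, on compositions of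
    bounded size, with ribbon Schur functions at a point \<open>y\<close> realising
    \<open>G\<close>; so it cannot distinguish equivalent ribbons.\<close>
  have transfer: "Q \<alpha> = Q \<alpha>'" if Q: "ribbon_recursion G Q" for G :: "nat \<Rightarrow> complex" and Q
  proof -
    obtain N y where y: "\<forall>n\<in>{1..?M}. schur N y (row n) = G n" using rows_surjective by blast
    show ?thesis
      using ribbon_recursion_unique[OF rib[of N y] Q y comp(1)] ribbon_recursion_unique[OF rib[of N y] Q y comp(2)] eq
      by simp
  qed
  have "(2 :: complex) ^ (length \<alpha> - 1) = 2 ^ (length \<alpha>' - 1)"
    using transfer[OF ribbon_recursion_three] by simp
  then have "of_nat (2 ^ (length \<alpha> - 1)) = (of_nat (2 ^ (length \<alpha>' - 1)) :: complex)" by simp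
  then have "length \<alpha> - 1 = length \<alpha>' - 1" by (simp only: of_nat_eq_iff) simp
  then have "length \<alpha> = length \<alpha>'" using comp by (cases \<alpha>; cases \<alpha>') (auto simp: composition_def)
  then show ?thesis
    using transfer[OF ribbon_recursion_scale[OF assms(5-7)]] assms(5) by simp
qed

text \<open>Both families share \<open>H\<close> and \<open>a\<close>, so uniqueness of the scaled
  recursion compares them directly.\<close>

lemma ribbon_recursion_determines:
  fixes R R' :: "nat list \<Rightarrow> complex"
  assumes "a \<noteq> 0" "\<And>n. 0 < n \<Longrightarrow> R [n] = H n" "\<And>n. 0 < n \<Longrightarrow> R' [n] = H n"
    and "\<And>\<beta> m n. composition (\<beta> @ [m]) \<Longrightarrow> 0 < n \<Longrightarrow>
      R (\<beta> @ [m]) * H n = R (\<beta> @ [m, n]) + R (\<beta> @ [m + n]) * a"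
    and "\<And>\<beta> m n. composition (\<beta> @ [m]) \<Longrightarrow> 0 < n \<Longrightarrow>
      R' (\<beta> @ [m]) * H n = R' (\<beta> @ [m, n]) + R' (\<beta> @ [m + n]) * a"
    and "composition \<alpha>"
  shows "R \<alpha> = R' \<alpha>"
  using ribbon_recursion_unique[OF ribbon_recursion_scale[of a R H, OF assms(1,2,4)]
      ribbon_recursion_scale[of a R' H, OF assms(1,3,5)] _ assms(6) order_refl] assms(1) by simp

subsection \<open>Skew Schur functions and their values\<close>

lemma weight_eq_0: "finite D \<Longrightarrow> weight D T v = 0 \<longleftrightarrow> v \<notin> T ` D"
  unfolding weight_def by (auto simp: card_eq_0_iff)

lemma tableaux_iff_column_strict:
  assumes "finite D" "order_convex D"
  shows "T \<in> tableaux N D \<longleftrightarrow> column_strict_filling D T \<and> (\<forall>v>N. weight D T v = 0)"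
proof -
  have "(\<forall>v>N. weight D T v = 0) \<longleftrightarrow> (\<forall>c\<in>D. T c \<le> N)"
    unfolding weight_eq_0[OF assms(1)] by (auto simp: not_le[symmetric])
  then show ?thesis
    unfolding column_strict_filling_iff_locally_strict[OF assms(2)] tableaux_def
    by (auto simp: Suc_le_eq intro!: mapsI dest: maps_inside maps_outside)
qed

lemma prod_eq_prod_weight:
  assumes "finite D" "T \<in> tableaux N D"
  shows "(\<Prod>c\<in>D. f (T c)) = (\<Prod>v=1..N. f v ^ weight D T v)"
proof -
  have "T ` D \<subseteq> {1..N}" using assms(2) by (auto simp: tableaux_def dest: maps_inside)
  then have "(\<Prod>c\<in>D. f (T c)) = (\<Prod>v=1..N. \<Prod>c\<in>{c \<in> D. T c = v}. f (T c))"
    by (rule prod.group[OF assms(1) finite_atLeastAtMost, symmetric])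
  also have "\<dots> = (\<Prod>v=1..N. f v ^ weight D T v)"
    unfolding weight_def by (intro prod.cong refl) simp
  finally show ?thesis .
qed

lemma skew_schur_eq_card_tableaux:
  assumes "finite D" "order_convex D" "\<forall>v>N. m v = 0"
  shows "skew_schur D m = card {T \<in> tableaux N D. weight D T = m}"
  unfolding skew_schur_def tableaux_iff_column_strict[OF assms(1,2)]
  using assms(3) by (intro arg_cong[of _ _ card]) auto

lemma schur_eq_if_skew_equiv:
  assumes D: "finite D" "order_convex D" and E: "finite E" "order_convex E" and "D \<sim>\<^sub>s E"
  shows "schur N x D = schur N x E"
proof -
  \<comment> \<open>A common index set for both expansions; an exponent vector that does not occur
    for one of the diagrams has coefficient 0 there.\<close>
  define W where "W = weight D ` tableaux N D \<union> weight E ` tableaux N E"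
  have fin: "finite (tableaux N D)" "finite (tableaux N E)"
    using D(1) E(1) by (auto simp: tableaux_def finite_maps)
  have W: "\<forall>v>N. m v = 0" if "m \<in> W" for m
    using that by (auto simp: W_def tableaux_iff_column_strict D E)
  have *: "schur N x F = (\<Sum>m\<in>W. of_nat (skew_schur F m) * (\<Prod>v=1..N. x v ^ m v))"
    if F: "finite F" "order_convex F" "finite (tableaux N F)" "weight F ` tableaux N F \<subseteq> W" for F
  proof -
    have "schur N x F = (\<Sum>T\<in>tableaux N F. \<Prod>v=1..N. x v ^ weight F T v)"
      unfolding schur_eq_sum_tableaux[OF F(1)] by (intro sum.cong refl prod_eq_prod_weight F(1))
    also have "\<dots> = (\<Sum>m\<in>W. \<Sum>T\<in>{T \<in> tableaux N F. weight F T = m}. \<Prod>v=1..N. x v ^ weight F T v)"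
      by (rule sum.group[symmetric]) (use F fin in \<open>auto simp: W_def\<close>)
    also have "\<dots> = (\<Sum>m\<in>W. of_nat (skew_schur F m) * (\<Prod>v=1..N. x v ^ m v))"
    proof (intro sum.cong refl)
      fix m assume m: "m \<in> W"
      show "(\<Sum>T\<in>{T \<in> tableaux N F. weight F T = m}. \<Prod>v=1..N. x v ^ weight F T v) =
          of_nat (skew_schur F m) * (\<Prod>v=1..N. x v ^ m v)"
        unfolding skew_schur_eq_card_tableaux[OF F(1,2) W[OF m]] by simp
    qed
    finally show ?thesis .
  qed
  show ?thesis
    using *[OF D fin(1)] *[OF E fin(2)] \<open>D \<sim>\<^sub>s E\<close> by (auto simp: W_def skew_equiv_def)
qed

lemma digits_unique:
  fixes a b :: "nat \<Rightarrow> nat"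
  assumes "\<And>v. a v < M" "\<And>v. b v < M" "(\<Sum>v<n. a v * M ^ v) = (\<Sum>v<n. b v * M ^ v)" "v < n"
  shows "a v = b v"
  using assms(3,4)
proof (induction n arbitrary: v)
  case (Suc n)
  have lt: "(\<Sum>v<n. c v * M ^ v) < M ^ n" if "\<And>v. c v < M" for c :: "nat \<Rightarrow> nat"
  proof (induction n)
    case (Suc n)
    have "(\<Sum>v<Suc n. c v * M ^ v) < M ^ n + c n * M ^ n" using Suc by simp
    also have "\<dots> = Suc (c n) * M ^ n" by simp
    also have "\<dots> \<le> M * M ^ n" by (intro mult_le_mono1) (use that[of n] in simp)
    finally show ?case by simp
  qed simp
  have div: "(x + c * b) div b = c" if "x < b" for x b c :: nat using that by simp
  have "((\<Sum>v<n. a v * M ^ v) + a n * M ^ n) div M ^ n = a n" "((\<Sum>v<n. b v * M ^ v) + b n * M ^ n) div M ^ n = b n"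
    by (rule div, rule lt, rule assms(1), rule div, rule lt, rule assms(2))
  then have "a n = b n" using Suc.prems(1) by simp
  then show ?case using Suc by (cases "v = n") auto
qed simp

text \<open>
  Kronecker substitution: for large \<open>M\<close> the values at \<open>x\<^sub>v = t\<^bsup>M\<^sup>v\<^esup>\<close> determine all coefficients.
\<close>

lemma skew_equiv_if_schur_eq:
  assumes D: "finite D" "order_convex D" and E: "finite E" "order_convex E"
    and eq: "\<And>N f. N0 \<le> N \<Longrightarrow> (\<And>v. 0 < f v) \<Longrightarrow>
      schur N (\<lambda>v. of_nat (f v) :: complex) D = schur N (\<lambda>v. of_nat (f v)) E"
  shows "D \<sim>\<^sub>s E"
  unfolding skew_equiv_def
proof
  fix m
  show "skew_schur D m = skew_schur E m"
  proof (cases "\<exists>N. (\<forall>v>N. m v = 0) \<and> m 0 = 0")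
    \<comment> \<open>An exponent vector with infinite support, or with a nonzero exponent at the
      value 0, is not the weight of any filling of a finite diagram.\<close>
    case False
    have none: "\<not> (column_strict_filling F T \<and> weight F T = m)" if "finite F" for F T
    proof
      assume T: "column_strict_filling F T \<and> weight F T = m"
      then have "weight F T 0 = 0"
        unfolding weight_eq_0[OF that] column_strict_filling_def by force
      moreover have "weight F T v = 0" if "v > Max (insert 0 (T ` F))" for v
        unfolding weight_eq_0[OF \<open>finite F\<close>] using that \<open>finite F\<close> by (metis Max_ge finite_imageI finite_insert insertI2 not_le)
      ultimately show False using False T by blast
    qed
    have "{T. column_strict_filling F T \<and> weight F T = m} = {}" if "finite F" for F
      using none[OF that] by blast
    then show ?thesis unfolding skew_schur_def by (simp only: D(1) E(1))
  next
    case True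
    then obtain N1 where N1: "\<forall>v>N1. m v = 0" and m0: "m 0 = 0" by blast
    define N where "N = max N0 N1"
    \<comment> \<open>The base exceeds every digit that can occur: weights of \<open>D\<close> and
      \<open>E\<close> are bounded by the numbers of cells, and \<open>m\<close> by its
      maximum.\<close>
    define M where "M = Suc (card D + card E + Max (m ` {0..N}))"
    have mN: "\<forall>v>N. m v = 0" using N1 by (simp add: N_def)
    have mM: "m v < M" for v
    proof (cases "v \<le> N")
      case True
      then have "m v \<le> Max (m ` {0..N})" by (intro Max_ge) auto
      then show ?thesis by (simp add: M_def)
    qed (use mN in \<open>simp add: M_def\<close>)
    define ex where "ex w = (\<Sum>v<Suc N. w v * M ^ v)" for w :: "nat \<Rightarrow> nat"
    define P where "P F = (\<Sum>T\<in>tableaux N F. monom (1::complex) (ex (weight F T)))" for F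
    have w: "weight F T v < M" "weight F T 0 = 0" if "T \<in> tableaux N F" "finite F" "order_convex F" "card F < M" for F T v
    proof -
      have "weight F T v \<le> card F" unfolding weight_def using that(2) by (intro card_mono) auto
      then show "weight F T v < M" using that(4) by simp
      show "weight F T 0 = 0"
        using that(1) unfolding weight_eq_0[OF that(2)] tableaux_iff_column_strict[OF that(2,3)] column_strict_filling_def
        by force
    qed
    have card: "card D < M" "card E < M" by (simp_all add: M_def)
    have val: "poly (P F) (of_nat t) = schur N (\<lambda>v. of_nat (t ^ (M ^ v))) F"
      if F: "finite F" "order_convex F" "card F < M" for F t
    proof -
      have *: "(\<Prod>v=1..N. of_nat (t ^ (M ^ v)) ^ weight F T v :: complex) = of_nat t ^ ex (weight F T)"
        if T: "T \<in> tableaux N F" for T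
      proof -
        have "{..<Suc N} = insert 0 {1..N}" by auto
        then have "ex (weight F T) = (\<Sum>v=1..N. M ^ v * weight F T v)"
          unfolding ex_def using w(2)[OF T F] by (simp add: mult.commute)
        then show ?thesis by (simp add: power_sum power_mult)
      qed
      show ?thesis
        unfolding P_def poly_sum poly_monom schur_eq_sum_tableaux[OF F(1)]
      proof (intro sum.cong refl)
        fix T assume T: "T \<in> tableaux N F"
        show "1 * of_nat t ^ ex (weight F T) = (\<Prod>c\<in>F. of_nat (t ^ (M ^ T c)) :: complex)"
          unfolding prod_eq_prod_weight[OF F(1) T, of "\<lambda>v. of_nat (t ^ (M ^ v))"] *[OF T] by simp
      qed
    qed
    \<comment> \<open>Positive integers \<open>t\<close> keep all variables positive, as
      \<open>eq\<close> demands, and already are infinitely many zeros.\<close>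
    have "poly (P D - P E) (of_nat t) = 0" if "t \<in> {1..}" for t
      using eq[of N "\<lambda>v. t ^ (M ^ v)"] that val[OF D card(1)] val[OF E card(2)] by (simp add: N_def)
    then have "of_nat ` {1..} \<subseteq> {z. poly (P D - P E) z = 0}" by blast
    moreover have "infinite (of_nat ` {1..} :: complex set)"
      by (subst finite_image_iff) (auto simp: inj_on_def infinite_Ici)
    ultimately have "P D - P E = 0" using poly_roots_finite finite_subset by blast
    then have "coeff (P D) (ex m) = coeff (P E) (ex m)" by simp
    moreover have "coeff (P F) (ex m) = of_nat (skew_schur F m)"
      if F: "finite F" "order_convex F" "card F < M" for F
    proof -
      have fin: "finite (tableaux N F)" using F(1) by (simp add: tableaux_def finite_maps)
      have "ex (weight F T) = ex m \<longleftrightarrow> weight F T = m" if T: "T \<in> tableaux N F" for T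
      proof
        assume "ex (weight F T) = ex m"
        then have "weight F T v = m v" if "v < Suc N" for v
          using digits_unique[of "weight F T" M m "Suc N" v] w(1)[OF T F] mM that unfolding ex_def by blast
        moreover have "weight F T v = m v" if "v > N" for v
          using T mN that F by (simp add: tableaux_iff_column_strict)
        ultimately show "weight F T = m" by (metis less_Suc_eq not_less_eq ext)
      qed simp
      then have "coeff (P F) (ex m) = (\<Sum>T\<in>tableaux N F. if weight F T = m then 1 else 0)"
        unfolding P_def coeff_sum by (intro sum.cong refl) simp
      also have "\<dots> = of_nat (card {T \<in> tableaux N F. weight F T = m})"
        using fin by (simp add: sum.inter_filter[symmetric])
      finally show ?thesis using skew_schur_eq_card_tableaux[OF F(1,2) mN] by simp
    qed
    ultimately show ?thesis using D E card by simp
  qed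
qed

text \<open>At positive integers every tableau contributes a positive integer, so nothing cancels.
  This licenses the division by the Schur function of \<omega>.\<close>

lemma schur_positive:
  assumes D: "finite D" and f: "\<And>v. 0 < f v" and T: "T \<in> tableaux N D"
  shows "schur N (\<lambda>v. of_nat (f v) :: complex) D \<noteq> 0"
proof -
  have fin: "finite (tableaux N D)" using D by (simp add: tableaux_def finite_maps)
  have "0 < (\<Sum>T\<in>tableaux N D. \<Prod>c\<in>D. f (T c))"
    by (rule sum_pos2[OF fin T]) (use f in \<open>auto intro: prod_pos\<close>)
  moreover have "schur N (\<lambda>v. of_nat (f v) :: complex) D = of_nat (\<Sum>T\<in>tableaux N D. \<Prod>c\<in>D. f (T c))"
    by (simp add: schur_eq_sum_tableaux[OF D])
  ultimately show ?thesis by (metis of_nat_eq_0_iff less_irrefl)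
qed

lemma tableaux_nonempty:
  assumes "finite D"
  shows "\<exists>N0. \<forall>N\<ge>N0. tableaux N D \<noteq> {}"
proof -
  define a where "a = Min (fst ` D)"
  \<comment> \<open>The entry is the number of the row, counted from the top: constant along rows
    and strictly increasing down columns.\<close>
  define T where "T c = (if c \<in> D then nat (fst c - a) + 1 else 0)" for c
  have a: "a \<le> i" if "(i, j) \<in> D" for i j
    unfolding a_def using assms that by (intro Min_le) force+
  have "T \<in> tableaux N D" if N: "Max (insert 0 (T ` D)) \<le> N" for N
  proof -
    have "T c \<le> N" if "c \<in> D" for c using N assms that by simp
    then show ?thesis unfolding tableaux_def using a
      by (auto simp: T_def intro!: mapsI locally_strictI)
  qed
  then show ?thesis by blast
qed

subsection \<open>Skew diagrams, protrusion and projection\<close>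

lemma cell_set_eqI:
  fixes X Y :: diagram
  assumes "\<And>i j. (i, j) \<in> X \<longleftrightarrow> (i, j) \<in> Y"
  shows "X = Y"
proof (rule set_eqI)
  fix c :: cell
  show "c \<in> X \<longleftrightarrow> c \<in> Y" using assms[of "fst c" "snd c"] by simp
qed

lemma lower_set_nat:
  fixes S :: "nat set"
  assumes "finite S" "\<And>i j. j \<in> S \<Longrightarrow> i \<le> j \<Longrightarrow> i \<in> S"
  shows "S = {..<card S}"
proof (cases "S = {}")
  case False
  then have "S = {..Max S}" using Max_in[OF assms(1) False] Max_ge[OF assms(1)] assms(2) by auto
  then show ?thesis by (metis card_atMost lessThan_Suc_atMost)
qed simp

lemma finite_ferrers: "partition lam \<Longrightarrow> finite (ferrers lam)"
proof -
  assume "partition lam"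
  then have "finite {i. lam i \<noteq> 0}" by (simp add: partition_def)
  moreover have "ferrers lam \<subseteq> (\<Union>i\<in>{i. lam i \<noteq> 0}. (\<lambda>j. (int i, int j)) ` {..<lam i})"
  proof
    fix c assume "c \<in> ferrers lam"
    then obtain i j where "c = (int i, int j)" "j < lam i" unfolding ferrers_def by blast
    then show "c \<in> (\<Union>i\<in>{i. lam i \<noteq> 0}. (\<lambda>j. (int i, int j)) ` {..<lam i})"
      by (intro UN_I[of i]) auto
  qed
  ultimately show ?thesis by (auto intro: finite_subset)
qed

lemma mem_ferrers: "(i, j) \<in> ferrers lam \<longleftrightarrow> 0 \<le> i \<and> 0 \<le> j \<and> nat j < lam (nat i)"
proof
  assume "0 \<le> i \<and> 0 \<le> j \<and> nat j < lam (nat i)"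
  then have "(i, j) = (int (nat i), int (nat j))" "nat j < lam (nat i)" by auto
  then show "(i, j) \<in> ferrers lam" unfolding ferrers_def by blast
qed (auto simp: ferrers_def)

lemma ferrers_lower:
  assumes "partition lam" "(i, j) \<in> ferrers lam" "0 \<le> i'" "i' \<le> i" "0 \<le> j'" "j' \<le> j"
  shows "(i', j') \<in> ferrers lam"
proof -
  have "lam (nat i) \<le> lam (nat i')"
    using assms(1) unfolding partition_def antimono_def by (meson assms(4) nat_mono)
  then show ?thesis using assms(2-) unfolding mem_ferrers by auto
qed

lemma lower_set_is_ferrers:
  assumes "finite P" "P \<subseteq> {(i, j). 0 \<le> i \<and> 0 \<le> j}"
    and lower: "\<And>i j i' j'. (i, j) \<in> P \<Longrightarrow> 0 \<le> i' \<Longrightarrow> i' \<le> i \<Longrightarrow> 0 \<le> j' \<Longrightarrow> j' \<le> j \<Longrightarrow> (i', j') \<in> P"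
  shows "\<exists>lam. partition lam \<and> ferrers lam = P"
proof -
  define S where "S i = {j. (int i, int j) \<in> P}" for i
  have fin: "finite (S i)" for i
    unfolding S_def by (rule finite_inverse_image[OF assms(1), of "\<lambda>j. (int i, int j)", simplified vimage_def])
      (simp add: inj_on_def)
  have S: "S i = {..<card (S i)}" for i
    by (rule lower_set_nat[OF fin]) (auto simp: S_def intro: lower)
  let ?lam = "\<lambda>i. card (S i)"
  have "S i' \<subseteq> S i" if "i \<le> i'" for i i' using that by (auto simp: S_def intro: lower)
  then have "antimono ?lam" by (auto intro!: antimonoI card_mono fin)
  moreover have "finite {i. ?lam i \<noteq> 0}"
  proof (rule finite_subset)
    show "{i. ?lam i \<noteq> 0} \<subseteq> (\<lambda>c. nat (fst c)) ` P"
    proof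
      fix i assume "i \<in> {i. ?lam i \<noteq> 0}"
      then have "S i \<noteq> {}" by auto
      then obtain j where "(int i, int j) \<in> P" unfolding S_def by blast
      then show "i \<in> (\<lambda>c. nat (fst c)) ` P" by (rule rev_image_eqI) simp
    qed
  qed (use assms(1) in simp)
  moreover have "ferrers ?lam = P"
  proof -
    have "(i, j) \<in> ferrers ?lam \<longleftrightarrow> (i, j) \<in> P" for i j
    proof -
      have "nat j < ?lam (nat i) \<longleftrightarrow> nat j \<in> S (nat i)" using S[of "nat i"] by blast
      then show ?thesis using assms(2) unfolding mem_ferrers S_def by auto
    qed
    then show ?thesis by (rule cell_set_eqI)
  qed
  ultimately show ?thesis by (auto simp: partition_def)
qed

lemma skew_diagram_iff: "skew_diagram D \<longleftrightarrow> finite D \<and> order_convex D"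
proof
  assume "skew_diagram D"
  then obtain lam mu v where D: "partition lam" "partition mu" "D = translate v (ferrers lam - ferrers mu)"
    unfolding skew_diagram_def by blast
  have "order_convex D"
    unfolding order_convex_def
  proof (intro allI impI)
    fix i j i' j' m n
    assume *: "(i, j) \<in> D" "(i', j') \<in> D" "i \<le> m" "m \<le> i'" "j \<le> n" "n \<le> j'"
    let ?m = "m - fst v" and ?n = "n - snd v"
    have in1: "(i - fst v, j - snd v) \<in> ferrers lam" "(i - fst v, j - snd v) \<notin> ferrers mu"
      and in2: "(i' - fst v, j' - snd v) \<in> ferrers lam"
      using *(1,2) unfolding D mem_translate by auto
    have pos: "0 \<le> i - fst v" "0 \<le> j - snd v" using in1(1) unfolding mem_ferrers by auto
    have "(?m, ?n) \<in> ferrers lam" by (rule ferrers_lower[OF D(1) in2]) (use pos * in auto)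
    moreover have "(?m, ?n) \<notin> ferrers mu"
      using ferrers_lower[OF D(2), of ?m ?n "i - fst v" "j - snd v"] pos in1(2) * by auto
    ultimately show "(m, n) \<in> D" unfolding D mem_translate by simp
  qed
  moreover have "finite D" unfolding D by (intro finite_translate finite_Diff finite_ferrers D)
  ultimately show "finite D \<and> order_convex D" by simp
next
  assume "finite D \<and> order_convex D"
  then have fin: "finite D" and conv: "order_convex D" by auto
  define a where "a = Min (fst ` D)"
  define b where "b = Min (snd ` D)"
  have ab: "a \<le> i" "b \<le> j" if "(i, j) \<in> D" for i j
    unfolding a_def b_def using fin that by (force intro!: Min_le)+
  define X where "X = translate (- a, - b) D"
  have finX: "finite X" unfolding X_def using fin by (rule finite_translate)
  have X: "(i, j) \<in> X \<longleftrightarrow> (i + a, j + b) \<in> D" for i j unfolding X_def mem_translate by simp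
  \<comment> \<open>The outer partition is the northwest closure of \<open>X\<close> in the
    quadrant; the inner one consists of its cells that have no cell of \<open>X\<close> weakly
    northwest of them. Order convexity says that the difference is \<open>X\<close>.\<close>
  define P where "P = {(i, j). 0 \<le> i \<and> 0 \<le> j \<and> (\<exists>(i', j')\<in>X. i \<le> i' \<and> j \<le> j')}"
  define Q where "Q = {(i, j). (i, j) \<in> P \<and> \<not> (\<exists>(i', j')\<in>X. i' \<le> i \<and> j' \<le> j)}"
  have "P \<subseteq> (\<Union>(i', j')\<in>X. {0..i'} \<times> {0..j'})" by (auto simp: P_def)
  then have finP: "finite P" by (rule finite_subset) (use finX in auto)
  have "\<exists>lam. partition lam \<and> ferrers lam = P"
    by (rule lower_set_is_ferrers[OF finP]) (auto simp: P_def, (blast intro: order_trans)+)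
  then obtain lam where lam: "partition lam" "ferrers lam = P" by blast
  have "\<exists>mu. partition mu \<and> ferrers mu = Q"
  proof (rule lower_set_is_ferrers)
    show "finite Q" by (rule finite_subset[OF _ finP]) (auto simp: Q_def)
    show "Q \<subseteq> {(i, j). 0 \<le> i \<and> 0 \<le> j}" by (auto simp: Q_def P_def)
    fix i j i' j' :: int
    assume *: "(i, j) \<in> Q" "0 \<le> i'" "i' \<le> i" "0 \<le> j'" "j' \<le> j"
    have "(i, j) \<in> P" and no: "\<not> (\<exists>(a, b)\<in>X. a \<le> i \<and> b \<le> j)" using *(1) by (auto simp: Q_def)
    then have "(i', j') \<in> P" using ferrers_lower[OF lam(1), of i j i' j'] *(2-5) lam(2) by simp
    moreover have "\<not> (\<exists>(a, b)\<in>X. a \<le> i' \<and> b \<le> j')"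
    proof
      assume "\<exists>(a, b)\<in>X. a \<le> i' \<and> b \<le> j'"
      then obtain a b where "(a, b) \<in> X" "a \<le> i'" "b \<le> j'" by blast
      then have "(a, b) \<in> X" "a \<le> i" "b \<le> j" using *(3,5) by auto
      then show False using no by blast
    qed
    ultimately show "(i', j') \<in> Q" unfolding Q_def by simp
  qed
  then obtain mu where mu: "partition mu" "ferrers mu = Q" by blast
  have "P - Q = X"
  proof -
    have "(i, j) \<in> P - Q \<longleftrightarrow> (i, j) \<in> X" for i j
    proof
      assume "(i, j) \<in> P - Q"
      then obtain i1 j1 i2 j2 where "(i1, j1) \<in> X" "i \<le> i1" "j \<le> j1" "(i2, j2) \<in> X" "i2 \<le> i" "j2 \<le> j"
        unfolding P_def Q_def by auto
      then show "(i, j) \<in> X"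
        using order_convexD[OF conv, of "i2 + a" "j2 + b" "i1 + a" "j1 + b" "i + a" "j + b"] by (simp add: X)
    next
      assume "(i, j) \<in> X"
      moreover from this have "0 \<le> i" "0 \<le> j" using ab[of "i + a" "j + b"] unfolding X by auto
      ultimately show "(i, j) \<in> P - Q" unfolding P_def Q_def by blast
    qed
    then show ?thesis by (rule cell_set_eqI)
  qed
  then have "D = translate (a, b) (ferrers lam - ferrers mu)"
    unfolding lam mu by (simp add: X_def translate_translate translate_0)
  moreover have "ferrers mu \<subseteq> ferrers lam" unfolding lam mu by (auto simp: Q_def)
  ultimately show "skew_diagram D" unfolding skew_diagram_def using lam(1) mu(1) by blast
qed

section \<open>Boundaries of connected skew diagrams\<close>

lemma connected_diagonals:
  assumes "order_convex D" "connected_diagram D" "c \<in> D" "content c \<le> d" "c' \<in> D" "d < content c'"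
  shows "\<exists>i. (i, i + d) \<in> D \<and> ((i, i + d + 1) \<in> D \<or> (i - 1, i + d) \<in> D)"
proof -
  define D1 where "D1 = {c \<in> D. content c \<le> d}"
  define D2 where "D2 = {c \<in> D. d < content c}"
  have "c \<in> D1" "c' \<in> D2" using assms(3-6) by (auto simp: D1_def D2_def)
  then have "\<not> is_disjoint_union D D1 D2" using assms(2) unfolding connected_diagram_def by blast
  moreover have "D = D1 \<union> D2" by (auto simp: D1_def D2_def)
  \<comment> \<open>Cutting by content is no disjoint union, so some cell beyond the cut is not
    strictly northeast of some cell before it. Convexity then gives a row or a column that crosses
    from diagonal \<open>d\<close> to the next.\<close>
  ultimately obtain i j i' j' where ij: "(i, j) \<in> D" "(i', j') \<in> D" "j - i \<le> d" "d < j' - i'" "\<not> (i' < i \<and> j < j')"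
    unfolding is_disjoint_union_def D1_def D2_def content_def by auto
  show ?thesis
  proof (cases "i \<le> i'")
    case True
    have "(i, i + d) \<in> D" "(i, i + d + 1) \<in> D"
      by (rule order_convexD[OF assms(1) ij(1,2)]; use True ij in linarith)+
    then show ?thesis by blast
  next
    case False
    then have "j' \<le> j" using ij by linarith
    have "(j' - d, j') \<in> D" "(j' - d - 1, j') \<in> D"
      by (rule order_convexD[OF assms(1) ij(2,1)]; use False \<open>j' \<le> j\<close> ij in linarith)+
    then show ?thesis by (intro exI[of _ "j' - d"]) simp
  qed
qed

text \<open>Connectedness links consecutive diagonals, so none in between is empty; convexity
  restricts the extreme rows to lattice steps.\<close>

lemma connected_skew_band:
  assumes "finite D" "order_convex D" "connected_diagram D" "D \<noteq> {}"
  shows "\<exists>A B l r. lattice_band A B l r \<and> D = band A B l r"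
proof -
  let ?ct = "content ` D"
  define A where "A = Min ?ct"
  define B where "B = Max ?ct"
  define S where "S d = {i. (i, i + d) \<in> D}" for d
  define l where "l d = Min (S d)" for d
  define r where "r d = Max (S d)" for d
  have ct: "finite ?ct" "?ct \<noteq> {}" using assms by auto
  have A: "A \<le> j - i" and B: "j - i \<le> B" if "(i, j) \<in> D" for i j
    unfolding A_def B_def using ct(1) that by (auto intro!: Min_le Max_ge rev_image_eqI simp: content_def)
  obtain cA cB where cA: "cA \<in> D" "content cA = A" and cB: "cB \<in> D" "content cB = B"
    using Min_in[OF ct] Max_in[OF ct] unfolding A_def B_def by auto
  have fin: "finite (S d)" for d
    unfolding S_def by (rule finite_inverse_image[OF assms(1), of "\<lambda>i. (i, i + d)", simplified vimage_def])
      (simp add: inj_on_def)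
  have link: "\<exists>i. i \<in> S d \<and> (i \<in> S (d + 1) \<or> i - 1 \<in> S (d + 1))" if "A \<le> d" "d < B" for d
    using connected_diagonals[OF assms(2,3) cA(1) _ cB(1), of d] that cA(2) cB(2)
    by (auto simp: S_def algebra_simps)
  have ne: "S d \<noteq> {}" if "A \<le> d" "d \<le> B" for d
  proof (cases "d < B")
    case True then show ?thesis using link[of d] that by auto
  next
    case False
    then have "d = B" using that by simp
    then have "fst cB \<in> S d" using cB by (cases cB) (auto simp: S_def content_def)
    then show ?thesis by blast
  qed
  have lr: "l d \<in> S d" "r d \<in> S d" "l d \<le> r d" if "A \<le> d" "d \<le> B" for d
    unfolding l_def r_def using Min_in[OF fin ne[OF that]] Max_in[OF fin ne[OF that]] fin by auto
  have bd: "l d \<le> i" "i \<le> r d" if "i \<in> S d" for i d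
    unfolding l_def r_def using Min_le[OF fin that] Max_ge[OF fin that] .
  have conv: "m \<in> S d'" if "i \<in> S d1" "i' \<in> S d2" "i \<le> m" "m \<le> i'" "i + d1 \<le> m + d'" "m + d' \<le> i' + d2"
    for i i' m d1 d2 d'
    using order_convexD[OF assms(2), of i "i + d1" i' "i' + d2" m "m + d'"] that unfolding S_def by simp
  have AB: "A \<le> B" using A[of "fst cB" "snd cB"] cB by (simp add: content_def)
  have "D = band A B l r"
  proof -
    have "(i, j) \<in> D \<longleftrightarrow> (i, j) \<in> band A B l r" for i j
    proof
      assume "(i, j) \<in> D"
      then show "(i, j) \<in> band A B l r"
        using A[of i j] B[of i j] bd[of i "j - i"] by (simp add: band_def S_def)
    next
      assume *: "(i, j) \<in> band A B l r"
      then have "i \<in> S (j - i)"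
        by (intro conv[OF lr(1) lr(2), of "j - i" "j - i"]) (auto simp: band_def)
      then show "(i, j) \<in> D" by (simp add: S_def)
    qed
    then show ?thesis by (rule cell_set_eqI)
  qed
  moreover have "lattice_band A B l r"
    unfolding lattice_band_def falling_def
  proof (intro conjI allI impI)
    show "A \<le> B" by (rule AB)
    \<comment> \<open>Two cells on the first diagonal would force the southwest corner of their
      rectangle into \<open>D\<close>, on a diagonal before the first. The last diagonal is treated
      with the northeast corner.\<close>
    show "l A = r A"
    proof (rule ccontr)
      assume "l A \<noteq> r A"
      then have "l A < r A" using lr[of A] AB by simp
      then have "r A \<in> S (A - (r A - l A))"
        by (intro conv[OF lr(1) lr(2), of A A]) (use AB in auto)
      then show False using A[of "r A" "r A + (A - (r A - l A))"] \<open>l A < r A\<close> by (simp add: S_def)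
    qed
    show "l B = r B"
    proof (rule ccontr)
      assume "l B \<noteq> r B"
      then have "l B < r B" using lr[of B] AB by simp
      then have "l B \<in> S (B + (r B - l B))"
        by (intro conv[OF lr(1) lr(2), of B B]) (use AB in auto)
      then show False using B[of "l B" "l B + (B + (r B - l B))"] \<open>l B < r B\<close> by (simp add: S_def)
    qed
    show "l d \<le> r d" if "A \<le> d" "d \<le> B" for d using lr[OF that] by simp
    fix d assume d: "A \<le> d" "d < B"
    then have d1: "A \<le> d" "d \<le> B" "A \<le> d + 1" "d + 1 \<le> B" by auto
    note lrd = lr[OF d1(1,2)] and lrd1 = lr[OF d1(3,4)]
    obtain i e where i: "i \<in> S d" "e \<in> S (d + 1)" "e = i \<or> e = i - 1" using link[OF d] by blast
    note bi = bd[OF i(1)] and be = bd[OF i(2)]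
    have "l d - 1 \<le> l (d + 1)"
    proof (rule ccontr)
      assume *: "\<not> ?thesis"
      have "l (d + 1) + 1 \<in> S d"
        by (rule conv[OF lrd1(1) lrd(1)]) (use * in auto)
      then show False using bd(1)[of "l (d + 1) + 1" d] * by simp
    qed
    moreover have "l (d + 1) \<le> l d"
    proof (cases "e \<le> l d")
      case False
      have "l d \<in> S (d + 1)" by (rule conv[OF lrd(1) i(2)]) (use False in auto)
      then show ?thesis by (rule bd)
    qed (use be in simp)
    ultimately show "l (d + 1) = l d \<or> l (d + 1) = l d - 1" by linarith
    have "r (d + 1) \<le> r d"
    proof (rule ccontr)
      assume *: "\<not> ?thesis"
      have "r d + 1 \<in> S d"
        by (rule conv[OF lrd(2) lrd1(2)]) (use * in auto)
      then show False using bd(2)[of "r d + 1" d] by simp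
    qed
    moreover have "r d - 1 \<le> r (d + 1)"
    proof (cases "r d - 1 \<le> e")
      case False
      have "r d - 1 \<in> S (d + 1)" by (rule conv[OF i(2) lrd(2)]) (use False in auto)
      then show ?thesis by (rule bd)
    qed (use be in simp)
    ultimately show "r (d + 1) = r d \<or> r (d + 1) = r d - 1" by linarith
  qed
  ultimately show ?thesis by blast
qed

lemma content_band:
  assumes "lattice_band A B l r"
  shows "content ` band A B l r = {A..B}"
proof
  show "{A..B} \<subseteq> content ` band A B l r"
  proof
    fix d assume "d \<in> {A..B}"
    then have "(l d, l d + d) \<in> band A B l r" using assms by (auto simp: lattice_band_def band_def)
    then show "d \<in> content ` band A B l r" by (rule rev_image_eqI) (simp add: content_def)
  qed
qed (auto simp: band_def content_def)

section \<open>Copies of the ribbon inside a band\<close>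

lemma ne_part_contents:
  assumes "content ` D = {A..B}"
  shows "ne_part k D = {c \<in> D. B - int k < content c}"
  unfolding ne_part_def
proof (intro Collect_cong conj_cong refl)
  fix c assume "c \<in> D"
  then have "content c \<in> {A..B}" using assms by blast
  then have eq: "{d \<in> {A..B}. content c < d} = {content c<..B}" by auto
  show "(card {d \<in> content ` D. content c < d} < k) = (B - int k < content c)"
    using \<open>content c \<in> {A..B}\<close> unfolding assms eq by auto
qed

lemma sw_part_contents:
  assumes "content ` D = {A..B}"
  shows "sw_part k D = {c \<in> D. content c < A + int k}"
  unfolding sw_part_def
proof (intro Collect_cong conj_cong refl)
  fix c assume "c \<in> D"
  then have "content c \<in> {A..B}" using assms by blast
  then have eq: "{d \<in> {A..B}. d < content c} = {A..<content c}" by auto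
  show "(card {d \<in> content ` D. d < content c} < k) = (content c < A + int k)"
    using \<open>content c \<in> {A..B}\<close> unfolding assms eq by auto
qed

lemma translate_inj:
  assumes "translate v X = translate w X" "finite X" "X \<noteq> {}"
  shows "v = w"
proof -
  have "Min (fst ` translate v X) = Min (fst ` X) + fst v" "Min (snd ` translate v X) = Min (snd ` X) + snd v" for v
    using Min_add_commute[of X fst "fst v"] Min_add_commute[of X snd "snd v"] assms(2,3)
    unfolding translate_eq_image image_image fst_conv snd_conv by simp_all
  from this[of v] this[of w] show ?thesis unfolding assms(1) by (simp add: prod_eq_iff)
qed

lemma word_ribbon_parts:
  assumes "linkable k W E A B x y"
  shows "sw_part k E = translate (x, x + A) (word_ribbon k W)"
    and "ne_part k E = translate (y, y + (B - int k + 1)) (word_ribbon k W)"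
proof -
  obtain l r where "boundary k W E A B x y l r" using assms unfolding linkable_def by blast
  note lr = boundaryD[OF this]
  have ct: "content ` E = {A..B}" unfolding lr(2) by (rule content_band[OF lr(1)])
  have wr: "(i, j) \<in> translate (a, a + d) (word_ribbon k W) \<longleftrightarrow>
      d \<le> j - i \<and> j - i < d + int k \<and> i = a + W (j - i - d)" for i j a d
  proof -
    have "(i - a, j - (a + d)) \<in> word_ribbon k W \<longleftrightarrow> (\<exists>m<k. i = a + W (int m) \<and> j = i + d + int m)"
      unfolding word_ribbon_def by auto
    also have "\<dots> \<longleftrightarrow> d \<le> j - i \<and> j - i < d + int k \<and> i = a + W (j - i - d)"
    proof
      assume "d \<le> j - i \<and> j - i < d + int k \<and> i = a + W (j - i - d)"
      then show "\<exists>m<k. i = a + W (int m) \<and> j = i + d + int m"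
        by (intro exI[of _ "nat (j - i - d)"]) auto
    qed auto
    finally show ?thesis by (simp add: mem_translate)
  qed
  have "(i, j) \<in> sw_part k E \<longleftrightarrow> (i, j) \<in> translate (x, x + A) (word_ribbon k W)" for i j
    using lr(3) lr(4)[of "j - i - A"] unfolding sw_part_contents[OF ct] wr
    unfolding content_def lr(2) band_def by auto
  then show "sw_part k E = translate (x, x + A) (word_ribbon k W)" by (rule cell_set_eqI)
  have "(i, j) \<in> ne_part k E \<longleftrightarrow> (i, j) \<in> translate (y, y + (B - int k + 1)) (word_ribbon k W)" for i j
    using lr(3) lr(5)[of "j - i - (B - int k + 1)"] unfolding ne_part_contents[OF ct] wr
    unfolding content_def lr(2) band_def by auto
  then show "ne_part k E = translate (y, y + (B - int k + 1)) (word_ribbon k W)" by (rule cell_set_eqI)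
qed

lemma attach_linkable:
  assumes "linkable k W E1 A1 B1 x1 y1" "linkable k W E2 A2 B2 x2 y2" "card \<omega> = k" "0 < k"
  shows "attach \<omega> u E1 E2 = E1 \<union>
    translate (fst u + (y1 - x2), snd u + (y1 - x2) + (B1 - int k + 1 - A2)) E2"
proof -
  let ?X = "word_ribbon k W"
  let ?v = "(fst u + (y1 - x2), snd u + (y1 - x2) + (B1 - int k + 1 - A2))"
  have "finite ?X" "?X \<noteq> {}" using assms(4) by (auto simp: word_ribbon_def)
  then have "translate v (sw_part k E2) = translate u (ne_part k E1) \<longleftrightarrow> v = ?v" for v
    unfolding word_ribbon_parts(1)[OF assms(2)] word_ribbon_parts(2)[OF assms(1)] translate_translate
    by (auto simp: algebra_simps dest!: translate_inj) (auto simp: prod_eq_iff)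
  then show ?thesis unfolding attach_def assms(3) by simp
qed

text \<open>The two copies of the first cell of \<omega> are opposite corners of a two-by-two
  square. By convexity its southwest corner belongs to the union; it lies on a diagonal where only
  \<open>E1\<close> has cells, so it is the cell before the top copy, which gives
  \<open>W (- 1)\<close>. The northeast corner at the last cell gives
  \<open>W (int k)\<close>.\<close>

lemma projection_word:
  assumes E: "linkable k W E1 A1 B1 x1 y1" "linkable k W E2 A2 B2 x2 y2" and k: "0 < k" and W: "W 0 = 0"
    and e: "e = 1 \<or> e = - 1"
    and conv: "order_convex (E1 \<union> translate (e + (y1 - x2), e + (y1 - x2) + (B1 - int k + 1 - A2)) E2)"
  shows "W (- 1) = (if e = 1 then 1 else 0) \<and> W (int k) = (if e = 1 then W (int k - 1) - 1 else W (int k - 1))"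
proof -
  let ?v = "(e + (y1 - x2), e + (y1 - x2) + (B1 - int k + 1 - A2))"
  let ?C = "B1 - int k + 1"
  obtain l1 r1 where "boundary k W E1 A1 B1 x1 y1 l1 r1" using E(1) unfolding linkable_def by blast
  note b1 = boundaryD[OF this]
  obtain l2 r2 where "boundary k W E2 A2 B2 x2 y2 l2 r2" using E(2) unfolding linkable_def by blast
  note b2 = boundaryD[OF this]
  have E1: "(i, j) \<in> E1 \<longleftrightarrow> i = y1 + W m" if "j - i = ?C + m" "- 1 \<le> m" "m < int k" for i j m
    using b1(5)[of m] b1(3) that unfolding b1(2) band_def by auto
  have E1': "(i, j) \<notin> E1" if "B1 < j - i" for i j using that unfolding b1(2) band_def by auto
  have E2: "(i, j) \<in> translate ?v E2 \<longleftrightarrow> i = y1 + e + W m" if "j - i = ?C + m" "0 \<le> m" "m \<le> int k" for i j m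
  proof -
    have eq: "j - snd ?v - (i - fst ?v) = A2 + m" using that by simp
    show ?thesis
      using b2(4)[of m] b2(3) that unfolding b2(2) mem_translate band_def mem_Collect_eq case_prod_conv eq by auto
  qed
  have E2': "(i, j) \<notin> translate ?v E2" if "j - i < ?C" for i j
    using that unfolding b2(2) mem_translate band_def by auto
  let ?U = "E1 \<union> translate ?v E2"
  let ?z = "(y1, y1 + ?C)" and ?zk = "(y1 + W (int k - 1), y1 + W (int k - 1) + ?C + (int k - 1))"
  have z: "?z \<in> ?U" using E1[of "y1 + ?C" y1 0] W k by simp
  have zs: "(y1 + e, y1 + e + ?C) \<in> ?U" using E2[of "y1 + e + ?C" "y1 + e" 0] W by simp
  have zk: "?zk \<in> ?U" using E1[of "snd ?zk" "fst ?zk" "int k - 1"] k by simp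
  have zks: "(y1 + e + W (int k - 1), y1 + e + W (int k - 1) + ?C + (int k - 1)) \<in> ?U"
    using E2[of "y1 + e + W (int k - 1) + ?C + (int k - 1)" "y1 + e + W (int k - 1)" "int k - 1"] k by simp
  define a where "a = (if e = 1 then y1 + 1 else y1)"
  define b where "b = (if e = 1 then y1 + W (int k - 1) else y1 - 1 + W (int k - 1))"
  have "(a, a + ?C - 1) \<in> ?U"
    using order_convexD[OF conv z zs, of a "a + ?C - 1"] order_convexD[OF conv zs z, of a "a + ?C - 1"] e
    by (auto simp: a_def)
  then have "a = y1 + W (- 1)"
    using E1[of "a + ?C - 1" a "- 1"] E2'[of "a + ?C - 1" a] by simp
  moreover have "(b, b + ?C + int k) \<in> ?U"
    using order_convexD[OF conv zk zks, of b "b + ?C + int k"] order_convexD[OF conv zks zk, of b "b + ?C + int k"] e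
    by (auto simp: b_def)
  then have "b = y1 + e + W (int k)"
    using E2[of "b + ?C + int k" b "int k"] E1'[of "b + ?C + int k" b] by simp
  ultimately show ?thesis using e by (auto simp: a_def b_def)
qed

lemma linkable_decompose:
  assumes D: "skew_diagram D" "connected_diagram D" and "ribbon \<omega>"
    and top: "protrudes_top \<omega> D" and bot: "protrudes_bottom \<omega> D" and sep: "copies_separated \<omega> D"
  shows "\<exists>W A B x y. linkable (card \<omega>) W D A B x y \<and> W 0 = 0 \<and> falling (- 1) (int (card \<omega>)) W \<and> 0 < card \<omega>"
proof -
  let ?k = "card \<omega>"
  have om: "finite \<omega>" "\<omega> \<noteq> {}" using assms(3) unfolding ribbon_def skew_diagram_iff by auto
  then have k: "0 < ?k" by (simp add: card_gt_0_iff)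
  have D': "finite D" "order_convex D" using D(1) unfolding skew_diagram_iff by auto
  have "D \<noteq> {}" using sep unfolding copies_separated_def by auto
  then obtain A B l r where band: "lattice_band A B l r" "D = band A B l r"
    using connected_skew_band[OF D' D(2)] by blast
  have ct: "content ` D = {A..B}" unfolding band(2) by (rule content_band[OF band(1)])
  note ne = ne_part_contents[OF ct] and sw = sw_part_contents[OF ct]
  have mem: "(i, j) \<in> D \<longleftrightarrow> A \<le> j - i \<and> j - i \<le> B \<and> l (j - i) \<le> i \<and> i \<le> r (j - i)" for i j
    unfolding band(2) band_def by simp
  have lr: "l d \<le> r d" if "A \<le> d" "d \<le> B" for d using band(1) that unfolding lattice_band_def by blast
  have AB: "A + 2 * int ?k \<le> B"
  proof -
    obtain d where d: "d \<in> {A..B}" "{c \<in> D. content c = d} \<inter> ne_part ?k D = {}"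
      "{c \<in> D. content c = d} \<inter> sw_part ?k D = {}"
      using sep unfolding copies_separated_def ct by blast
    then obtain c where "c \<in> D" "content c = d" using ct by (metis imageE)
    then have "\<not> B - int ?k < d" "\<not> d < A + int ?k" using d(2,3) unfolding ne sw by blast+
    then show ?thesis by linarith
  qed
  \<comment> \<open>Two cells on one diagonal of an order-convex set complete to a two-by-two block,
    which a ribbon excludes. This is applied to the extreme \<open>card \<omega> + 1\<close>
    diagonals and so covers the cell next to each copy.\<close>
  have no_square: "l d = r d" if d: "A \<le> d" "d \<le> B" and F: "ribbon {c \<in> D. P (content c)}" "P d" for d P
  proof (rule ccontr)
    let ?F = "{c \<in> D. P (content c)}"
    assume "l d \<noteq> r d"
    then have "l d + 1 \<le> r d" using lr[OF d] by simp
    then have c: "(l d, l d + d) \<in> ?F" "(l d + 1, l d + d + 1) \<in> ?F" using d F(2) by (auto simp: mem content_def)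
    have "order_convex ?F" using F(1) unfolding ribbon_def skew_diagram_iff by blast
    from order_convexD[OF this c] have "(l d + 1, l d + d) \<in> ?F" "(l d, l d + d + 1) \<in> ?F" by auto
    then have "{(l d, l d + d), (l d, l d + d + 1), (l d + 1, l d + d), (l d + 1, l d + d + 1)} \<subseteq> ?F" using c by blast
    then show False using F(1) unfolding ribbon_def by blast
  qed
  have low: "l d = r d" if "A \<le> d" "d \<le> A + int ?k" for d
    by (rule no_square[of d "\<lambda>d. d < A + int (?k + 1)"])
      (use that AB bot in \<open>auto simp: protrudes_bottom_def sw\<close>)
  have high: "l d = r d" if "B - int ?k \<le> d" "d \<le> B" for d
    by (rule no_square[of d "\<lambda>d. B - int (?k + 1) < d"])
      (use that AB top in \<open>auto simp: protrudes_top_def ne\<close>)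
  obtain t1 t2 where shift: "ne_part ?k D = translate (t1, t2) (sw_part ?k D)"
  proof -
    obtain v w where "ne_part ?k D = translate v \<omega>" "sw_part ?k D = translate w \<omega>"
      using top bot unfolding protrudes_top_def protrudes_bottom_def by blast
    then have "ne_part ?k D = translate (fst v - fst w, snd v - snd w) (sw_part ?k D)"
      by (simp add: translate_translate)
    then show ?thesis by (rule that)
  qed
  have move: "A \<le> d \<Longrightarrow> d < A + int ?k \<Longrightarrow> B - int ?k < d + (t2 - t1) \<and> d + (t2 - t1) \<le> B \<and>
      l (d + (t2 - t1)) = l d + t1" for d
  proof -
    assume d: "A \<le> d" "d < A + int ?k"
    then have "(l d, l d + d) \<in> sw_part ?k D"
      unfolding sw using lr[of d] AB by (auto simp: mem content_def)
    then have "(l d + t1, l d + d + t2) \<in> ne_part ?k D"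
      unfolding shift mem_translate by simp
    then have *: "(l d + t1, l d + d + t2) \<in> D" "B - int ?k < l d + d + t2 - (l d + t1)"
      unfolding ne by (auto simp: content_def)
    have "l d + d + t2 - (l d + t1) = d + (t2 - t1)" by simp
    then show "B - int ?k < d + (t2 - t1) \<and> d + (t2 - t1) \<le> B \<and> l (d + (t2 - t1)) = l d + t1"
      using * high[of "d + (t2 - t1)"] unfolding mem by auto
  qed
  \<comment> \<open>The displacement carries \<open>k\<close> consecutive contents starting at
    \<open>A\<close> into the last \<open>k\<close> contents, so the two extreme ones determine
    it.\<close>
  have q: "t2 - t1 = B - int ?k + 1 - A"
    using move[of A] move[of "A + int ?k - 1"] k by simp
  \<comment> \<open>The letter at -1 is read off at the top copy, all others at the bottom copy;
    \<open>move\<close> shows that both copies agree on the letters from 0 to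
    \<open>k - 1\<close>.\<close>
  define W where "W i = (if i < 0 then l (B - int ?k) - l (B - int ?k + 1) else l (A + i) - l A)" for i
  have top_eq: "l (B - int ?k + 1 + i) = l (B - int ?k + 1) + W i" if "- 1 \<le> i" "i < int ?k" for i
  proof (cases "i < 0")
    case True
    then have "i = - 1" using that by simp
    then show ?thesis by (simp add: W_def)
  next
    case False
    have eq: "A + i + (t2 - t1) = B - int ?k + 1 + i" "A + (t2 - t1) = B - int ?k + 1" using q by auto
    have "l (B - int ?k + 1 + i) = l (A + i) + t1" "l (B - int ?k + 1) = l A + t1"
      using move[of "A + i", unfolded eq] move[of A, unfolded eq] that False k by auto
    then show ?thesis using False by (simp add: W_def)
  qed
  have "linkable ?k W D A B (l A) (l (B - int ?k + 1))"
  proof (rule linkableI[OF band AB])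
    show "l (A + i) = l A + W i \<and> r (A + i) = l A + W i" if "0 \<le> i" "i \<le> int ?k" for i
      using low[of "A + i"] that by (simp add: W_def)
    show "l (B - int ?k + 1 + i) = l (B - int ?k + 1) + W i \<and> r (B - int ?k + 1 + i) = l (B - int ?k + 1) + W i"
      if "- 1 \<le> i" "i < int ?k" for i
      using top_eq[OF that] high[of "B - int ?k + 1 + i"] that by simp
  qed
  moreover have "W 0 = 0" by (simp add: W_def)
  moreover have "falling (- 1) (int ?k) W"
    unfolding falling_def
  proof (intro allI impI)
    fix i assume i: "- 1 \<le> i" "i < int ?k"
    have f: "falling A B l" using band(1) unfolding lattice_band_def by blast
    show "W (i + 1) = W i \<or> W (i + 1) = W i - 1"
    proof (cases "i < 0")
      case True
      then have "i = - 1" using i by simp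
      then show ?thesis using f[unfolded falling_def, rule_format, of "B - int ?k"] AB k by (auto simp: W_def)
    next
      case False
      then show ?thesis
        using f[unfolded falling_def, rule_format, of "A + i"] AB i by (auto simp: W_def algebra_simps)
    qed
  qed
  ultimately show ?thesis using k by blast
qed

subsection \<open>Amalgamated compositions\<close>

locale word =
  fixes k :: nat and W :: "int \<Rightarrow> int" and s :: bool
  assumes ribbon_word: "ribbon_word k W s"
begin

text \<open>\<open>p\<close> is the row displacement and \<open>q\<close> the content displacement
  that bring the bottom copy in \<open>E2\<close> onto the top copy in \<open>E1\<close>; the column
  displacement is therefore \<open>p + q\<close>.\<close>

lemma linking:
  assumes E1: "linkable k W E1 A1 B1 x1 y1" and E2: "linkable k W E2 A2 B2 x2 y2"
    and p: "p = y1 - x2" and q: "q = B1 - int k + 1 - A2"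
  shows "linkable k W (E1 \<union> translate (p, p + q) E2) A1 (B2 + q) x1 (y2 + p)"
    and "linkable k W (E1 \<union> translate (eps s + p, eps s + p + q) E2) A1 (B2 + q) x1 (y2 + p + eps s)"
    and "schur N t E1 * schur N t E2 = schur N t (E1 \<union> translate (p, p + q) E2) * schur N t (word_ribbon k W) +
      schur N t (E1 \<union> translate (eps s + p, eps s + p + q) E2)"
proof -
  let ?E2 = "translate (p, p + q) E2"
  have E2': "linkable k W ?E2 (B1 - int k + 1) (B2 + q) y1 (y2 + p)"
  proof -
    have "A2 + snd (p, p + q) - fst (p, p + q) = B1 - int k + 1" "B2 + snd (p, p + q) - fst (p, p + q) = B2 + q"
      "x2 + fst (p, p + q) = y1" "y2 + fst (p, p + q) = y2 + p"
      using p q by simp_all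
    then show ?thesis using linkable_translate[OF E2, of "(p, p + q)"] by (simp only:)
  qed
  interpret aligned k W s E1 ?E2 A1 B1 "B2 + q" x1 y1 "y2 + p"
    by (rule aligned.intro[OF ribbon_word E1 E2'])
  show "linkable k W (E1 \<union> translate (p, p + q) E2) A1 (B2 + q) x1 (y2 + p)" by (rule linkable_amalgam)
  show "linkable k W (E1 \<union> translate (eps s + p, eps s + p + q) E2) A1 (B2 + q) x1 (y2 + p + eps s)"
    using linkable_projection unfolding translate_translate by (simp add: add.assoc)
  show "schur N t E1 * schur N t E2 = schur N t (E1 \<union> translate (p, p + q) E2) * schur N t (word_ribbon k W) +
      schur N t (E1 \<union> translate (eps s + p, eps s + p + q) E2)"
    using schur_linking[of N t] unfolding translate_translate by (simp add: schur_translate add.assoc)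
qed

lemma amalg_linkable:
  assumes "linkable k W E1 A1 B1 x1 y1" "linkable k W E2 A2 B2 x2 y2" "card \<omega> = k" "0 < k"
    and p: "p = y1 - x2" and q: "q = B1 - int k + 1 - A2"
  shows "amalg \<omega> E1 E2 = E1 \<union> translate (p, p + q) E2"
  unfolding amalg_def attach_linkable[OF assms(1-4)] p q by simp

text \<open>\<open>proj\<close> decides by testing the outer projection. That one is skew exactly
  for true \<open>s\<close>: one direction constructs its boundaries, the other reads the direction
  off the word with \<open>projection_word\<close>.\<close>

lemma proj_linkable:
  assumes E: "linkable k W E1 A1 B1 x1 y1" "linkable k W E2 A2 B2 x2 y2" and k: "card \<omega> = k" "0 < k"
    and p: "p = y1 - x2" and q: "q = B1 - int k + 1 - A2"
  shows "proj \<omega> E1 E2 = E1 \<union> translate (eps s + p, eps s + p + q) E2"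
proof -
  have out: "outer_proj \<omega> E1 E2 = E1 \<union> translate (1 + (y1 - x2), 1 + (y1 - x2) + (B1 - int k + 1 - A2)) E2"
    and inn: "inner_proj \<omega> E1 E2 = E1 \<union> translate (- 1 + (y1 - x2), - 1 + (y1 - x2) + (B1 - int k + 1 - A2)) E2"
    unfolding outer_proj_def inner_proj_def attach_linkable[OF E k] fst_conv snd_conv by (rule refl)+
  have "skew_diagram (outer_proj \<omega> E1 E2) \<longleftrightarrow> s"
  proof
    assume s
    then have "outer_proj \<omega> E1 E2 = E1 \<union> translate (eps s + p, eps s + p + q) E2"
      unfolding out p q eps_def by simp
    then show "skew_diagram (outer_proj \<omega> E1 E2)"
      using linking(2)[OF E p q] linkable_finite linkable_order_convex unfolding skew_diagram_iff by metis
  next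
    assume "skew_diagram (outer_proj \<omega> E1 E2)"
    then have "order_convex (outer_proj \<omega> E1 E2)" unfolding skew_diagram_iff by blast
    then have "W (- 1) = 1"
      using projection_word[OF E k(2) _ _, of 1] ribbon_word unfolding out ribbon_word_def by simp
    then show s using ribbon_word unfolding ribbon_word_def by auto
  qed
  then show ?thesis unfolding proj_def out inn p q eps_def by simp
qed

end

locale chain = word +
  fixes \<omega> D :: diagram and A B x y :: int
  assumes k_pos: "0 < k" and card: "card \<omega> = k" and D: "linkable k W D A B x y"
begin

text \<open>All these products are unions of translates whose displacements add up, so the
  bracketing is immaterial, even when amalgamation is mixed with projection.\<close>

lemma amalg_assoc:
  assumes E: "linkable k W E1 A1 B1 x1 y1" "linkable k W E2 A2 B2 x2 y2" "linkable k W E3 A3 B3 x3 y3"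
  shows "amalg \<omega> (amalg \<omega> E1 E2) E3 = amalg \<omega> E1 (amalg \<omega> E2 E3)"
    and "amalg \<omega> (proj \<omega> E1 E2) E3 = proj \<omega> E1 (amalg \<omega> E2 E3)"
proof -
  note l12 = linking(1)[OF E(1,2) refl refl, folded amalg_linkable[OF E(1,2) card k_pos refl refl]]
    and p12 = linking(2)[OF E(1,2) refl refl, folded proj_linkable[OF E(1,2) card k_pos refl refl]]
    and l23 = linking(1)[OF E(2,3) refl refl, folded amalg_linkable[OF E(2,3) card k_pos refl refl]]
  show "amalg \<omega> (amalg \<omega> E1 E2) E3 = amalg \<omega> E1 (amalg \<omega> E2 E3)"
    unfolding amalg_linkable[OF l12 E(3) card k_pos refl refl] amalg_linkable[OF E(1) l23 card k_pos refl refl]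
    unfolding amalg_linkable[OF E(1,2) card k_pos refl refl] amalg_linkable[OF E(2,3) card k_pos refl refl]
    by (simp add: translate_Un translate_translate Un_assoc algebra_simps)
  show "amalg \<omega> (proj \<omega> E1 E2) E3 = proj \<omega> E1 (amalg \<omega> E2 E3)"
    unfolding amalg_linkable[OF p12 E(3) card k_pos refl refl] proj_linkable[OF E(1) l23 card k_pos refl refl]
    unfolding proj_linkable[OF E(1,2) card k_pos refl refl] amalg_linkable[OF E(2,3) card k_pos refl refl]
    by (simp add: translate_Un translate_translate Un_assoc algebra_simps)
qed

abbreviation power :: "nat \<Rightarrow> diagram" where "power n \<equiv> amalg_power \<omega> D n"

lemma power_1: "power (Suc 0) = D" and power_Suc: "power (Suc (Suc n)) = amalg \<omega> (power (Suc n)) D"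
  by (simp_all add: amalg_power_def)

text \<open>The description by equally spaced translates of \<open>D\<close> makes it visible that
  powers are compatible with rotation.\<close>

lemma power_linkable:
  "linkable k W (power (Suc n)) A (B + int n * (B - int k + 1 - A)) x (y + int n * (y - x)) \<and>
    power (Suc n) = (\<Union>i\<in>{0..n}. translate (int i * (y - x), int i * (y - x) + int i * (B - int k + 1 - A)) D)"
proof (induction n)
  case 0
  then show ?case using D by (simp add: power_1 translate_0)
next
  case (Suc n)
  let ?p = "int (Suc n) * (y - x)" and ?q = "int (Suc n) * (B - int k + 1 - A)"
  note IH = conjunct1[OF Suc.IH] conjunct2[OF Suc.IH]
  have p: "?p = y + int n * (y - x) - x" and q: "?q = B + int n * (B - int k + 1 - A) - int k + 1 - A"
    by (simp_all add: algebra_simps)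
  note am = amalg_linkable[OF IH(1) D card k_pos p q, folded power_Suc]
  have "linkable k W (power (Suc (Suc n))) A (B + ?q) x (y + ?p)"
    unfolding am by (rule linking(1)[OF IH(1) D p q])
  moreover have "{0..Suc n} = insert (Suc n) {0..n}" by auto
  then have "power (Suc (Suc n)) = (\<Union>i\<in>{0..Suc n}. translate (int i * (y - x), int i * (y - x) + int i * (B - int k + 1 - A)) D)"
    unfolding am by (subst IH(2)) (simp add: Un_commute)
  ultimately show ?case by blast
qed

lemma power_linkable': "0 < n \<Longrightarrow> \<exists>B' y'. linkable k W (power n) A B' x y'"
  by (cases n) (use power_linkable in blast)+

lemma power_add:
  assumes "0 < m" "0 < n"
  shows "amalg \<omega> (power m) (power n) = power (m + n)"
  using assms(2)
proof (induction n rule: nat_induct_non_zero)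
  case 1
  obtain m' where "m = Suc m'" using assms(1) by (cases m) auto
  then show ?case using power_Suc[of m'] by (simp add: power_1)
next
  case (Suc n)
  obtain n' where n: "n = Suc n'" using Suc.hyps by (cases n) auto
  obtain m' where m: "m = Suc m'" using assms(1) by (cases m) auto
  obtain Bm ym Bn yn where "linkable k W (power m) A Bm x ym" "linkable k W (power n) A Bn x yn"
    using power_linkable'[OF assms(1)] power_linkable'[OF Suc.hyps] by blast
  from amalg_assoc(1)[OF this D] show ?case
    using Suc.IH power_Suc[of n'] power_Suc[of "m' + n"] by (simp add: n m)
qed

lemma comp_single: "amalg_comp [n] \<omega> D = power n"
  by (simp add: amalg_comp_def)

lemma comp_append: "\<beta> \<noteq> [] \<Longrightarrow> amalg_comp (\<beta> @ [n]) \<omega> D = proj \<omega> (amalg_comp \<beta> \<omega> D) (power n)"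
  by (cases \<beta>) (simp_all add: amalg_comp_def)

lemma comp_linkable: "composition \<alpha> \<Longrightarrow> \<exists>B' y'. linkable k W (amalg_comp \<alpha> \<omega> D) A B' x y'"
proof (induction \<alpha> rule: rev_induct)
  case (snoc n \<beta>)
  have n: "0 < n" using snoc.prems by (simp add: composition_def)
  show ?case
  proof (cases "\<beta> = []")
    case True
    then show ?thesis using power_linkable'[OF n] by (simp add: comp_single)
  next
    case False
    then have "composition \<beta>" using snoc.prems by (simp add: composition_def)
    then obtain B1 y1 B2 y2 where E: "linkable k W (amalg_comp \<beta> \<omega> D) A B1 x y1" "linkable k W (power n) A B2 x y2"
      using snoc.IH power_linkable'[OF n] by blast
    show ?thesis
      using linking(2)[OF E refl refl] unfolding comp_append[OF False] proj_linkable[OF E card k_pos refl refl] by blast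
  qed
qed (simp add: composition_def)

text \<open>Amalgamation acts on the last block alone and merges with it. This identifies the
  amalgam term of the gluing identity as the composition with parts \<open>m\<close> and
  \<open>n\<close> merged.\<close>

lemma comp_amalg_power:
  assumes "composition (\<beta> @ [m])" "0 < n"
  shows "amalg \<omega> (amalg_comp (\<beta> @ [m]) \<omega> D) (power n) = amalg_comp (\<beta> @ [m + n]) \<omega> D"
proof (cases "\<beta> = []")
  case True
  then show ?thesis using assms power_add[of m n] by (simp add: comp_single composition_def)
next
  case False
  have "composition \<beta>" "0 < m" using assms(1) False by (auto simp: composition_def)
  then obtain B1 y1 B2 y2 B3 y3 where E: "linkable k W (amalg_comp \<beta> \<omega> D) A B1 x y1"
    "linkable k W (power m) A B2 x y2" "linkable k W (power n) A B3 x y3"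
    using comp_linkable power_linkable' assms(2) by meson
  show ?thesis
    unfolding comp_append[OF False] amalg_assoc(2)[OF E] power_add[OF \<open>0 < m\<close> assms(2)] ..
qed

lemma comp_recursion:
  assumes "composition (\<beta> @ [m])" "0 < n"
  shows "schur N t (amalg_comp (\<beta> @ [m]) \<omega> D) * schur N t (power n) =
    schur N t (amalg_comp (\<beta> @ [m, n]) \<omega> D) + schur N t (amalg_comp (\<beta> @ [m + n]) \<omega> D) * schur N t (word_ribbon k W)"
proof -
  obtain B1 y1 B2 y2 where E: "linkable k W (amalg_comp (\<beta> @ [m]) \<omega> D) A B1 x y1" "linkable k W (power n) A B2 x y2"
    using comp_linkable[OF assms(1)] power_linkable'[OF assms(2)] by blast
  show ?thesis
    using linking(3)[OF E refl refl, of N t]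
    unfolding amalg_linkable[OF E card k_pos refl refl, symmetric] proj_linkable[OF E card k_pos refl refl, symmetric]
      comp_amalg_power[OF assms]
    using comp_append[of "\<beta> @ [m]" n] by simp
qed

end

section \<open>Ribbons as the case of an empty word\<close>

lemma linkable_row: "0 < n \<Longrightarrow> linkable 0 (\<lambda>_. 0) (row n) 0 (int n - 1) 0 0"
  by (rule linkableI[of _ _ "\<lambda>_. 0" "\<lambda>_. 0"])
    (auto simp: lattice_band_def falling_def band_def mem_row intro!: cell_set_eqI)

text \<open>With an empty ribbon, amalgamation puts a row to the right of the last cell, and the
  displacement to the northwest moves it above that cell. So false \<open>s\<close> turns the gluing
  identity into the product rule for ribbons.\<close>

interpretation ribbon: word 0 "\<lambda>_. 0" False
  by unfold_locales (simp add: ribbon_word_def falling_def)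

lemma ribbon_of_single: "ribbon_of [n] = row n"
  by (rule cell_set_eqI) (auto simp: ribbon_of_def mem_row intro!: exI[of _ "nat _"])

lemma ribbon_of_append:
  "ribbon_of (\<beta> @ [n]) = ribbon_of \<beta> \<union>
    translate (- int (length \<beta>), int (sum_list \<beta>) - int (length \<beta>)) (row n)"
proof -
  have sum: "(\<Sum>i<length \<beta>. int (\<beta> ! i) - 1) = int (sum_list \<beta>) - int (length \<beta>)"
    by (induction \<beta> rule: rev_induct) (simp_all add: nth_append)
  have pre: "(\<Sum>i<r. int ((\<beta> @ [n]) ! i) - 1) = (\<Sum>i<r. int (\<beta> ! i) - 1)" if "r \<le> length \<beta>" for r
    using that by (intro sum.cong refl) (simp add: nth_append)
  have "ribbon_of (\<beta> @ [n]) = {(- int r, (\<Sum>i<r. int ((\<beta> @ [n]) ! i) - 1) + int j) | r j. r < length \<beta> \<and> j < (\<beta> @ [n]) ! r} \<union>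
      {(- int (length \<beta>), (\<Sum>i<length \<beta>. int ((\<beta> @ [n]) ! i) - 1) + int j) | j. j < n}"
    unfolding ribbon_of_def by (auto simp: less_Suc_eq nth_append split: if_splits)
  also have "{(- int r, (\<Sum>i<r. int ((\<beta> @ [n]) ! i) - 1) + int j) | r j. r < length \<beta> \<and> j < (\<beta> @ [n]) ! r} = ribbon_of \<beta>"
    unfolding ribbon_of_def by (intro Collect_cong ex_cong1) (auto simp: pre nth_append)
  also have "{(- int (length \<beta>), (\<Sum>i<length \<beta>. int ((\<beta> @ [n]) ! i) - 1) + int j) | j. j < n} =
      translate (- int (length \<beta>), int (sum_list \<beta>) - int (length \<beta>)) (row n)"
    unfolding pre[OF order_refl] sum translate_eq_image row_def image_image by auto
  finally show ?thesis .
qed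

lemma linkable_ribbon:
  "composition \<alpha> \<Longrightarrow> linkable 0 (\<lambda>_. 0) (ribbon_of \<alpha>) 0 (int (sum_list \<alpha>) - 1) 0 (1 - int (length \<alpha>))"
proof (induction \<alpha> rule: rev_induct)
  case (snoc n \<beta>)
  have n: "0 < n" using snoc.prems by (simp add: composition_def)
  show ?case
  proof (cases "\<beta> = []")
    case True
    then show ?thesis using linkable_row[OF n] by (simp add: ribbon_of_single)
  next
    case False
    then have "composition \<beta>" using snoc.prems by (simp add: composition_def)
    from ribbon.linking(2)[OF snoc.IH[OF this] linkable_row[OF n] refl refl]
    show ?thesis unfolding ribbon_of_append by (simp add: eps_def algebra_simps)
  qed
qed (simp add: composition_def)

lemma ribbon_recursion_ribbon_of:
  "ribbon_recursion (\<lambda>n. schur N t (row n)) (\<lambda>\<alpha>. schur N t (ribbon_of \<alpha>))"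
  unfolding ribbon_recursion_def
proof (intro conjI allI impI)
  fix \<beta> and m n :: nat assume comp: "composition (\<beta> @ [m])" and n: "0 < n"
  let ?l = "int (length \<beta>)" and ?S = "int (sum_list \<beta>)"
  have rows: "row m \<union> translate (0, int m) (row n) = row (m + n)"
    by (rule cell_set_eqI) (auto simp: mem_translate mem_row)
  have "ribbon_of (\<beta> @ [m + n]) = ribbon_of \<beta> \<union> translate (- ?l, ?S - ?l) (row m \<union> translate (0, int m) (row n))"
    unfolding ribbon_of_append rows ..
  then have "ribbon_of (\<beta> @ [m + n]) = ribbon_of (\<beta> @ [m]) \<union> translate (- ?l, - ?l + (?S + int m)) (row n)"
    unfolding translate_Un translate_translate ribbon_of_append by (simp add: Un_assoc algebra_simps)
  moreover have "ribbon_of (\<beta> @ [m, n]) = ribbon_of (\<beta> @ [m]) \<union> translate (- 1 - ?l, - 1 - ?l + (?S + int m)) (row n)"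
    using ribbon_of_append[of "\<beta> @ [m]" n] by (simp add: algebra_simps)
  moreover have "schur N t (word_ribbon 0 (\<lambda>_. 0)) = 1"
    using schur_row_0[of N t] by (simp add: row_def word_ribbon_def)
  ultimately show "schur N t (ribbon_of (\<beta> @ [m])) * schur N t (row n) =
      schur N t (ribbon_of (\<beta> @ [m, n])) + schur N t (ribbon_of (\<beta> @ [m + n]))"
    using ribbon.linking(3)[OF linkable_ribbon[OF comp] linkable_row[OF n], of "- ?l" "?S + int m" N t]
    by (simp add: eps_def add.commute)
qed (simp add: ribbon_of_single)

section \<open>Rotation of the word and of linkable diagrams\<close>

definition reversed_word :: "nat \<Rightarrow> (int \<Rightarrow> int) \<Rightarrow> int \<Rightarrow> int" where
  "reversed_word k W i = W (int k - 1) - W (int k - 1 - i)"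

text \<open>Rotation reverses the reading order: the letters at -1 and \<open>k\<close> trade
  places, and an up step remains an up step, so the flag survives. The constant
  \<open>W (int k - 1)\<close> normalises the new first letter to 0.\<close>

lemma ribbon_word_reversed: "ribbon_word k W s \<Longrightarrow> ribbon_word k (reversed_word k W) s"
proof -
  assume W: "ribbon_word k W s"
  have "falling (- 1) (int k) (reversed_word k W)"
    unfolding falling_def
  proof (intro allI impI)
    fix i assume i: "- 1 \<le> i" "i < int k"
    have f: "falling (- 1) (int k) W" using W unfolding ribbon_word_def by blast
    have eq: "int k - 1 - (i + 1) = int k - 2 - i" "int k - 2 - i + 1 = int k - 1 - i" by auto
    show "reversed_word k W (i + 1) = reversed_word k W i \<or> reversed_word k W (i + 1) = reversed_word k W i - 1"
      using f[unfolded falling_def, rule_format, of "int k - 2 - i"] i unfolding reversed_word_def eq by auto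
  qed
  then show ?thesis using W unfolding ribbon_word_def reversed_word_def by (auto simp: algebra_simps)
qed

text \<open>Rotation negates rows and contents, so the two boundaries and the two copies trade
  places. The first cell of the new bottom copy is the image of the last cell of the old top copy,
  which lies in row \<open>y + W (int k - 1)\<close>.\<close>

lemma linkable_rotate180:
  assumes "linkable k W D A B x y"
  shows "linkable k (reversed_word k W) (rotate180 D) (- B) (- A) (- y - W (int k - 1)) (- x - W (int k - 1))"
proof -
  obtain l r where "boundary k W D A B x y l r" using assms unfolding linkable_def by blast
  note lr = boundaryD[OF this]
  let ?l = "\<lambda>d. - r (- d)" and ?r = "\<lambda>d. - l (- d)"
  have fall: "falling (- B) (- A) (\<lambda>d. - h (- d))" if "falling A B h" for h
    unfolding falling_def
  proof (intro allI impI)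
    fix d assume d: "- B \<le> d" "d < - A"
    have eq: "- (d + 1) = - d - 1" by simp
    show "- h (- (d + 1)) = - h (- d) \<or> - h (- (d + 1)) = - h (- d) - 1"
      using that[unfolded falling_def, rule_format, of "- d - 1"] d unfolding eq by auto
  qed
  show ?thesis
  proof (rule linkableI)
    show "lattice_band (- B) (- A) ?l ?r"
      using lr(1) fall unfolding lattice_band_def by auto
    show "rotate180 D = band (- B) (- A) ?l ?r"
    proof (rule cell_set_eqI)
      fix i j :: int
      have eq: "- j - - i = - (j - i)" by simp
      show "(i, j) \<in> rotate180 D \<longleftrightarrow> (i, j) \<in> band (- B) (- A) ?l ?r"
        unfolding lr(2) mem_rotate180 band_def mem_Collect_eq case_prod_conv eq by auto
    qed
    show "- B + 2 * int k \<le> - A" using lr(3) by simp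
    fix i
    have eq: "- (- B + i) = B - int k + 1 + (int k - 1 - i)" "- (- A - int k + 1 + i) = A + (int k - 1 - i)" by auto
    show "?l (- B + i) = - y - W (int k - 1) + reversed_word k W i \<and>
        ?r (- B + i) = - y - W (int k - 1) + reversed_word k W i" if "0 \<le> i" "i \<le> int k"
      unfolding eq reversed_word_def using lr(5)[of "int k - 1 - i"] that by simp
    show "?l (- A - int k + 1 + i) = - x - W (int k - 1) + reversed_word k W i \<and>
        ?r (- A - int k + 1 + i) = - x - W (int k - 1) + reversed_word k W i" if "- 1 \<le> i" "i < int k"
      unfolding eq reversed_word_def using lr(4)[of "int k - 1 - i"] that by simp
  qed
qed

lemma rotate180_translate: "rotate180 (translate v X) = translate (- fst v, - snd v) (rotate180 X)"
  by (rule cell_set_eqI) (simp add: mem_rotate180 mem_translate)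

lemma rotate180_UN: "rotate180 (\<Union>i\<in>I. F i) = (\<Union>i\<in>I. rotate180 (F i))"
  unfolding rotate180_def by (rule image_UN)

lemma translate_UN: "translate v (\<Union>i\<in>I. F i) = (\<Union>i\<in>I. translate v (F i))"
  unfolding translate_def by (rule image_UN)

lemma word_ribbon_band:
  assumes "ribbon_word k W s" "0 < k"
  shows "lattice_band 0 (int k - 1) W W" "word_ribbon k W = band 0 (int k - 1) W W"
proof -
  show "lattice_band 0 (int k - 1) W W"
    using assms unfolding lattice_band_def ribbon_word_def falling_def by auto
  show "word_ribbon k W = band 0 (int k - 1) W W"
  proof (rule cell_set_eqI)
    fix i j
    show "(i, j) \<in> word_ribbon k W \<longleftrightarrow> (i, j) \<in> band 0 (int k - 1) W W"
    proof
      assume *: "(i, j) \<in> band 0 (int k - 1) W W"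
      then show "(i, j) \<in> word_ribbon k W"
        unfolding word_ribbon_def by (intro image_eqI[of _ _ "nat (j - i)"]) (auto simp: band_def)
    qed (auto simp: word_ribbon_def band_def)
  qed
qed

lemma schur_word_ribbon_reversed:
  assumes W: "ribbon_word k W s" "0 < k"
  shows "schur N t (word_ribbon k (reversed_word k W)) = schur N t (word_ribbon k W)"
proof -
  have "word_ribbon k (reversed_word k W) = translate (W (int k - 1), W (int k - 1) + (int k - 1)) (rotate180 (word_ribbon k W))"
  proof -
    have "bij_betw (\<lambda>i. k - 1 - i) {0..<k} {0..<k}"
      by (rule bij_betw_byWitness[where f'="\<lambda>i. k - 1 - i"]) auto
    then have "{0..<k} = (\<lambda>i. k - 1 - i) ` {0..<k}" by (simp add: bij_betw_def)
    then have "word_ribbon k (reversed_word k W) = (\<lambda>i. (reversed_word k W (int i), reversed_word k W (int i) + int i)) ` (\<lambda>i. k - 1 - i) ` {0..<k}"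
      unfolding word_ribbon_def by simp
    then show ?thesis
      unfolding word_ribbon_def[of k W] translate_eq_image rotate180_eq_image image_image
      by (simp only:) (intro image_cong refl; auto simp: reversed_word_def of_nat_diff)
  qed
  then show ?thesis
    using word_ribbon_band[OF W] by (simp add: schur_translate schur_rotate180 finite_band order_convex_band)
qed

theorem theorem7p22:
  fixes \<alpha> \<alpha>' :: "nat list" and D \<omega> :: diagram
  assumes "composition \<alpha>" and "composition \<alpha>'"
    and "ribbon_of \<alpha> \<sim>\<^sub>s ribbon_of \<alpha>'"
    and "skew_diagram D" and "connected_diagram D"
    and "ribbon \<omega>"
    and "protrudes_top \<omega> D" and "protrudes_bottom \<omega> D"
    and "proj_defined \<omega> D D"
    and "copies_separated \<omega> D"
  shows "amalg_comp \<alpha>' \<omega> D \<sim>\<^sub>s amalg_comp \<alpha> \<omega> D \<and>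
    amalg_comp \<alpha> \<omega> D \<sim>\<^sub>s amalg_comp \<alpha> (rotate180 \<omega>) (rotate180 D)"
proof -
  define k where "k = card \<omega>"
  obtain W A B x y where D: "linkable k W D A B x y" and W0: "W 0 = 0" and fall: "falling (- 1) (int k) W" and k: "0 < k"
    using linkable_decompose[OF assms(4-8,10)] unfolding k_def by blast
  \<comment> \<open>Whichever projection of \<open>D\<close> onto itself is skew fixes the direction
    of both extra steps, and these directions agree.\<close>
  have "\<exists>s. ribbon_word k W s"
  proof -
    obtain e :: int where e: "e = 1 \<or> e = - 1" "skew_diagram (attach \<omega> (e, e) D D)"
      using assms(9) unfolding proj_defined_def outer_proj_def inner_proj_def by blast
    then have "order_convex (D \<union> translate (e + (y - x), e + (y - x) + (B - int k + 1 - A)) D)"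
      unfolding attach_linkable[OF D D k_def[symmetric] k] skew_diagram_iff by simp
    from projection_word[OF D D k W0 e(1) this] show ?thesis
      using W0 fall unfolding ribbon_word_def by (intro exI[of _ "e = 1"]) auto
  qed
  then obtain s where W: "ribbon_word k W s" by blast
  let ?W = "reversed_word k W" and ?D = "rotate180 D" and ?\<omega> = "rotate180 \<omega>"
  have card: "card ?\<omega> = k"
    unfolding k_def rotate180_eq_image by (rule card_image) (auto simp: inj_on_def prod_eq_iff)
  interpret c: chain k W s \<omega> D A B x y
    by unfold_locales (use W k D in \<open>simp_all add: k_def\<close>)
  interpret r: chain k ?W s ?\<omega> ?D "- B" "- A" "- y - W (int k - 1)" "- x - W (int k - 1)"
    by unfold_locales (use ribbon_word_reversed[OF W] k card linkable_rotate180[OF D] in simp_all)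
  \<comment> \<open>The power consists of translates by the multiples 0 to \<open>n'\<close> of one
    vector. Rotation maps the multiple \<open>i\<close> to \<open>n' - i\<close>, up to a common
    translation, so rotating a power of \<open>D\<close> gives a translate of the power of the
    rotated \<open>D\<close>.\<close>
  have power: "schur N t (r.power n) = schur N t (c.power n)" if n0: "0 < n" for N n and t :: "nat \<Rightarrow> complex"
  proof -
    obtain n' where n: "n = Suc n'" using n0 by (cases n) auto
    let ?p = "y - x" and ?q = "B - int k + 1 - A"
    have eq: "- x - W (int k - 1) - (- y - W (int k - 1)) = ?p" "- A - int k + 1 - - B = ?q" by auto
    have "bij_betw (\<lambda>i. n' - i) {0..n'} {0..n'}"
      by (rule bij_betw_byWitness[where f'="\<lambda>i. n' - i"]) auto
    then have mirror: "{0..n'} = (\<lambda>i. n' - i) ` {0..n'}" by (simp add: bij_betw_def)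
    have "r.power n = (\<Union>i\<in>{0..n'}. translate (int i * ?p, int i * ?p + int i * ?q) ?D)"
      unfolding n using r.power_linkable[of n'] unfolding eq by blast
    also have "\<dots> = (\<Union>i\<in>{0..n'}. translate (int (n' - i) * ?p, int (n' - i) * ?p + int (n' - i) * ?q) ?D)"
      by (subst mirror) simp
    also have "\<dots> = (\<Union>i\<in>{0..n'}. translate (int n' * ?p, int n' * ?p + int n' * ?q)
        (rotate180 (translate (int i * ?p, int i * ?p + int i * ?q) D)))"
    proof (intro SUP_cong refl)
      fix i assume "i \<in> {0..n'}"
      then have "int (n' - i) = int n' - int i" by (simp add: of_nat_diff)
      then show "translate (int (n' - i) * ?p, int (n' - i) * ?p + int (n' - i) * ?q) ?D =
          translate (int n' * ?p, int n' * ?p + int n' * ?q) (rotate180 (translate (int i * ?p, int i * ?p + int i * ?q) D))"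
        unfolding rotate180_translate translate_translate fst_conv snd_conv by (simp add: algebra_simps)
    qed
    also have "\<dots> = translate (int n' * ?p, int n' * ?p + int n' * ?q) (rotate180 (c.power n))"
      unfolding n conjunct2[OF c.power_linkable[of n']] rotate180_UN translate_UN ..
    finally show ?thesis
      using c.power_linkable'[OF n0] linkable_finite linkable_order_convex
      by (metis schur_translate schur_rotate180)
  qed
  have skew: "finite (amalg_comp \<beta> \<omega> D)" "order_convex (amalg_comp \<beta> \<omega> D)"
    "finite (amalg_comp \<beta> ?\<omega> ?D)" "order_convex (amalg_comp \<beta> ?\<omega> ?D)" if "composition \<beta>" for \<beta>
    using c.comp_linkable[OF that] r.comp_linkable[OF that] linkable_finite linkable_order_convex by blast+
  have fin: "finite (word_ribbon k W)" by (simp add: word_ribbon_def)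
  \<comment> \<open>Enough values must be available for the ribbon to have a filling at all;
    otherwise its Schur function is 0 and cannot be divided by.\<close>
  obtain N0 where N0: "\<And>N. N0 \<le> N \<Longrightarrow> tableaux N (word_ribbon k W) \<noteq> {}"
    using tableaux_nonempty[OF fin] by blast
  have pos: "schur N (\<lambda>v. of_nat (f v) :: complex) (word_ribbon k W) \<noteq> 0" if "N0 \<le> N" "\<And>v. 0 < f v" for N f
    using N0[OF that(1)] schur_positive[OF fin, of f _ N, OF that(2)] by blast
  have "amalg_comp \<alpha>' \<omega> D \<sim>\<^sub>s amalg_comp \<alpha> \<omega> D"
  proof (rule skew_equiv_if_schur_eq[OF skew(1,2)[OF assms(2)] skew(1,2)[OF assms(1)], of N0])
    fix N and f :: "nat \<Rightarrow> nat" assume "N0 \<le> N" "\<And>v. 0 < f v"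
    note nonzero = pos[of N f, OF this]
    have rib: "schur N y (ribbon_of \<alpha>) = schur N y (ribbon_of \<alpha>')" for N and y :: "nat \<Rightarrow> complex"
      using linkable_ribbon[OF assms(1)] linkable_ribbon[OF assms(2)] assms(3)
      by (intro schur_eq_if_skew_equiv linkable_finite linkable_order_convex)
    show "schur N (\<lambda>v. of_nat (f v) :: complex) (amalg_comp \<alpha>' \<omega> D) = schur N (\<lambda>v. of_nat (f v)) (amalg_comp \<alpha> \<omega> D)"
      by (rule ribbon_recursion_transfer[OF ribbon_recursion_ribbon_of rib assms(1,2) nonzero,
            where R="\<lambda>\<alpha>. schur N (\<lambda>v. of_nat (f v)) (amalg_comp \<alpha> \<omega> D)" and
              H="\<lambda>n. schur N (\<lambda>v. of_nat (f v)) (c.power n)", symmetric])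
        (simp_all add: c.comp_single c.comp_recursion)
  qed
  moreover have "amalg_comp \<alpha> \<omega> D \<sim>\<^sub>s amalg_comp \<alpha> ?\<omega> ?D"
  proof (rule skew_equiv_if_schur_eq[OF skew[OF assms(1)], of N0])
    fix N and f :: "nat \<Rightarrow> nat" assume "N0 \<le> N" "\<And>v. 0 < f v"
    note nonzero = pos[of N f, OF this]
    \<comment> \<open>The ribbon and the powers have the same values as their rotations, so both
      families of compositions satisfy one and the same recursion.\<close>
    note rotated_power = r.comp_recursion[of _ _ _ N "\<lambda>v. of_nat (f v) :: complex",
        unfolded schur_word_ribbon_reversed[OF W k]]
    have rotated: "schur N (\<lambda>v. of_nat (f v) :: complex) (amalg_comp (\<beta> @ [m]) ?\<omega> ?D) *
        schur N (\<lambda>v. of_nat (f v)) (c.power n) =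
        schur N (\<lambda>v. of_nat (f v)) (amalg_comp (\<beta> @ [m, n]) ?\<omega> ?D) +
        schur N (\<lambda>v. of_nat (f v)) (amalg_comp (\<beta> @ [m + n]) ?\<omega> ?D) *
        schur N (\<lambda>v. of_nat (f v)) (word_ribbon k W)" if "composition (\<beta> @ [m])" "0 < n" for \<beta> m n
      using rotated_power[OF that] power[OF that(2), of N "\<lambda>v. of_nat (f v)"] by simp
    show "schur N (\<lambda>v. of_nat (f v) :: complex) (amalg_comp \<alpha> \<omega> D) = schur N (\<lambda>v. of_nat (f v)) (amalg_comp \<alpha> ?\<omega> ?D)"
      by (rule ribbon_recursion_determines[OF nonzero _ _ _ _ assms(1),
            where R="\<lambda>\<alpha>. schur N (\<lambda>v. of_nat (f v)) (amalg_comp \<alpha> \<omega> D)" and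
              R'="\<lambda>\<alpha>. schur N (\<lambda>v. of_nat (f v)) (amalg_comp \<alpha> ?\<omega> ?D)" and
              H="\<lambda>n. schur N (\<lambda>v. of_nat (f v)) (c.power n)"])
        (simp_all add: c.comp_single r.comp_single power c.comp_recursion rotated)
  qed
  ultimately show ?thesis by blast
qed

end
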